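(* Let $\mathcal{D}=\{W\subseteq\mathbb{P} : R_W \text{ admits a diophantine model of } \mathbb{Z}\}$. One (and only one) of the following two possibilities holds. (1) The class $\mathcal{D}$ is meager in $2^{\mathbb{P}}$. (2) There exist a particular triple $(h,h_+,h_\times)$ of polynomials over $\mathbb{Z}$ and a finite binary string $\sigma\in 2^{<\mathbb{P}}$ such that, for every HTP-generic $V\in\mathcal{U}_\sigma$, $R_V$ admits a diophantine model of $\mathbb{Z}$ via these three polynomials. Moreover, if (2) holds, then $\mathbb{P}\in\mathcal{D}$ (i.e., $\mathbb{Q}$ admits a diophantine model of $\mathbb{Z}$).
   Context: $\mathbb{P}$ is the set of all prime numbers. For $W\subseteq\mathbb{P}$, $R_W=\mathbb{Z}[\frac1p : p\in W]$ is the corresponding subring of $\mathbb{Q}$ (so $R_{\mathbb{P}}=\mathbb{Q}$). For a subring $R\subseteq\mathbb{Q}$, $\mathrm{HTP}(R)$ denotes the set of polynomials (each in finitely many variables, with coefficients in $\mathbb{Z}$ or, equivalently after clearing denominators, in $R$) that have a zero with all coordinates in $R$. Diophantine model: in a ring $R$, a diophantine model of $\mathbb{Z}$ consists of three polynomials $h$, $h_+$, $h_\times$ with $h\in R[X_1,\ldots,X_n,\vec{Y}]$ and $h_+,h_\times\in R[X_1,\ldots,X_{3n},\vec{Y}]$ (for some $n$, with $\vec Y$ a finite tuple of variables), such that the set $$\{\vec{x}\in R^n : h(\vec{x},\vec{Y})\in\mathrm{HTP}(R)\}$$ (that is, the set of $\vec x\in R^n$ such that $h(\vec x,\vec y)=0$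 for some finite tuple $\vec y$ from $R$) is isomorphic to the structure $(\mathbb{Z},+,\cdot)$ under the binary operations whose graphs are $$\{(\vec{x}_1,\vec{x}_2,\vec{x}_3)\in R^{3n} : h_+(\vec{x}_1,\vec{x}_2,\vec{x}_3,\vec{Y})\in\mathrm{HTP}(R)\}$$ for addition, and the corresponding set with $h_\times$ in place of $h_+$ for multiplication. In this case $R$ is said to admit a diophantine model of $\mathbb{Z}$ via $(h,h_+,h_\times)$. Topology: the power set $2^{\mathbb{P}}$ of $\mathbb{P}$ carries the Cantor-space (product) topology, identifying $W\subseteq\mathbb{P}$ with its characteristic function $\mathbb{P}\to\{0,1\}$. $2^{<\mathbb{P}}$ is the set of functions $\sigma$ from finite initial segments of $\mathbb{P}$ (in increasing order) to $\{0,1\}$, and $\mathcal{U}_\sigma=\{W\subseteq\mathbb{P} : \sigma\subset W\}$ is the basic open set of those $W$ whose characteristic function extends $\sigma$. A set is nowhere dense if its closure contains no nonempty open set, and meager if it is a countable union of nowhere dense sets. HTP-generic: for $f\in\mathbb{Z}[X_0,X_1,\ldots]$ let $\mathcal{A}(f)=\{W\subseteq\mathbb{P} : f\in\mathrm{HTP}(R_W)\}$ (an open set), and let $\mathcal{B}(f)=2^{\mathbb{P}}-\mathcal{A}(f)-\mathrm{Int}(2^{\mathbb{P}}-\mathcal{A}(f))$ be its topological boundary. A set $W\subseteq\mathbb{P}$ is HTP-generic if $W\notin\mathcal{B}(f)$ for every $f\in\mathbb{Z}[X_0,X_1,\ldots]$. *)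

theory Defs
  imports
    "HOL-Analysis.Analysis"
    "HOL-Library.Poly_Mapping"
    "HOL-Computational_Algebra.Primes"
begin

section \<open>Subrings of the rationals\<close>

abbreviation Primes :: "nat set" where
  "Primes \<equiv> {p. prime p}"

text \<open>The subring \<open>\<int>[1/p : p \<in> W]\<close> of the rationals. Negatives come from multiplying by \<open>-1\<close>.\<close>

inductive_set subring_of :: "nat set \<Rightarrow> rat set" for W :: "nat set" where
  of_int: "of_int k \<in> subring_of W"
| inverse_of: "p \<in> W \<Longrightarrow> 1 / of_nat p \<in> subring_of W"
| add: "x \<in> subring_of W \<Longrightarrow> y \<in> subring_of W \<Longrightarrow> x + y \<in> subring_of W"
| mult: "x \<in> subring_of W \<Longrightarrow> y \<in> subring_of W \<Longrightarrow> x * y \<in> subring_of W"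


section \<open>Polynomials and Hilbert's Tenth Problem\<close>

text \<open>
  Polynomials in the variables \<open>X\<^sub>0, X\<^sub>1, \<dots>\<close>: finitely supported maps from monomials
  (finitely supported exponent vectors) to coefficients. For a subring \<open>R\<close> of the rationals,
  \<open>R[X\<^sub>0, X\<^sub>1, \<dots>]\<close> is the set of those polynomials over the rationals whose coefficients lie in \<open>R\<close>;
  in particular \<open>\<int>[X\<^sub>0, X\<^sub>1, \<dots>]\<close> is \<open>polys_over \<int>\<close>.
\<close>

type_synonym rat_mpoly = "(nat \<Rightarrow>\<^sub>0 nat) \<Rightarrow>\<^sub>0 rat"

definition polys_over :: "rat set \<Rightarrow> rat_mpoly set" where
  "polys_over R = {f. \<forall>m. Poly_Mapping.lookup f m \<in> R}"

definition eval_mpoly :: "(nat \<Rightarrow> rat) \<Rightarrow> rat_mpoly \<Rightarrow> rat" where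
  "eval_mpoly v f =
     (\<Sum>m\<in>Poly_Mapping.keys f. Poly_Mapping.lookup f m *
        (\<Prod>i\<in>Poly_Mapping.keys m. v i ^ Poly_Mapping.lookup m i))"

text \<open>
  A zero is given by values for all the variables; only those of the finitely many variables
  that occur in the polynomial matter.
\<close>

definition HTP :: "rat set \<Rightarrow> rat_mpoly set" where
  "HTP R = {f \<in> polys_over R. \<exists>v. (\<forall>i. v i \<in> R) \<and> eval_mpoly v f = 0}"


section \<open>Diophantine models of the integers\<close>

text \<open>
  The variables \<open>X\<^sub>1, \<dots>, X\<^sub>k\<close> are those with index below \<open>k\<close>, the variables \<open>\<^bold>Y\<close> are the others.
\<close>

definition tuple_append :: "rat list \<Rightarrow> (nat \<Rightarrow> rat) \<Rightarrow> nat \<Rightarrow> rat" where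
  "tuple_append xs y = (\<lambda>i. if i < length xs then xs ! i else y (i - length xs))"

text \<open>The set of \<open>\<^bold>x \<in> R\<^sup>k\<close> such that \<open>f(\<^bold>x, \<^bold>Y)\<close> has a zero in \<open>R\<close>.\<close>

definition dioph_set :: "rat set \<Rightarrow> nat \<Rightarrow> rat_mpoly \<Rightarrow> rat list set" where
  "dioph_set R k f =
     {xs. length xs = k \<and> set xs \<subseteq> R \<and>
          (\<exists>y. (\<forall>i. y i \<in> R) \<and> eval_mpoly (tuple_append xs y) f = 0)}"

text \<open>
  The isomorphism \<open>\<phi>\<close> carries \<open>\<int>\<close> to the set defined by \<open>h\<close>. The sets defined by \<open>hp\<close> and \<open>ht\<close>
  have to be exactly the graphs of the transported operations, as sets of \<open>3n\<close>-tuples over \<open>R\<close>: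
  they contain no triple with an entry outside the set defined by \<open>h\<close>.
\<close>

definition dioph_model_via ::
  "rat set \<Rightarrow> nat \<Rightarrow> rat_mpoly \<Rightarrow> rat_mpoly \<Rightarrow> rat_mpoly \<Rightarrow> bool" where
  "dioph_model_via R n h hp ht \<longleftrightarrow>
     h \<in> polys_over R \<and> hp \<in> polys_over R \<and> ht \<in> polys_over R \<and>
     (\<exists>\<phi> :: int \<Rightarrow> rat list.
        bij_betw \<phi> UNIV (dioph_set R n h) \<and>
        dioph_set R (3 * n) hp = {\<phi> a @ \<phi> b @ \<phi> (a + b) | a b. True} \<and>
        dioph_set R (3 * n) ht = {\<phi> a @ \<phi> b @ \<phi> (a * b) | a b. True})"

definition admits_dioph_model :: "rat set \<Rightarrow> bool" where
  "admits_dioph_model R \<longleftrightarrow> (\<exists>n h hp ht. dioph_model_via R n h hp ht)"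

definition dioph_model_class :: "nat set set" where
  "dioph_model_class = {W. W \<subseteq> Primes \<and> admits_dioph_model (subring_of W)}"


section \<open>The space of sets of primes\<close>

definition nowhere_dense_in :: "'a topology \<Rightarrow> 'a set \<Rightarrow> bool" where
  "nowhere_dense_in X S \<longleftrightarrow> S \<subseteq> topspace X \<and> X interior_of (X closure_of S) = {}"

definition meager_in :: "'a topology \<Rightarrow> 'a set \<Rightarrow> bool" where
  "meager_in X S \<longleftrightarrow> (\<exists>\<F>. countable \<F> \<and> (\<forall>T\<in>\<F>. nowhere_dense_in X T) \<and> S = \<Union>\<F>)"

text \<open>
  The topology on the power set of the primes, obtained by identifying a set with its
  characteristic function; \<open>restrict\<close> is needed as points of the product are extensional functions.
\<close>

definition cantor_primes :: "nat set topology" where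
  "cantor_primes =
     pullback_topology (Pow Primes) (\<lambda>W. restrict (\<lambda>p. p \<in> W) Primes)
       (product_topology (\<lambda>_. discrete_topology (UNIV :: bool set)) Primes)"

text \<open>Finite binary strings indexed by an initial segment of the primes, as partial functions.\<close>

definition prime_strings :: "(nat \<Rightarrow> bool option) set" where
  "prime_strings = {\<sigma>. \<exists>k. dom \<sigma> = {p. prime p \<and> p < k}}"

definition basic_open :: "(nat \<Rightarrow> bool option) \<Rightarrow> nat set set" where
  "basic_open \<sigma> = {W. W \<subseteq> Primes \<and> (\<forall>p\<in>dom \<sigma>. \<sigma> p = Some (p \<in> W))}"


section \<open>HTP-genericity\<close>

definition HTP_locus :: "rat_mpoly \<Rightarrow> nat set set" where
  "HTP_locus f = {W. W \<subseteq> Primes \<and> f \<in> HTP (subring_of W)}"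

definition HTP_boundary :: "rat_mpoly \<Rightarrow> nat set set" where
  "HTP_boundary f =
     Pow Primes - HTP_locus f - cantor_primes interior_of (Pow Primes - HTP_locus f)"

definition HTP_generic :: "nat set \<Rightarrow> bool" where
  "HTP_generic W \<longleftrightarrow> W \<subseteq> Primes \<and> (\<forall>f\<in>polys_over \<int>. W \<notin> HTP_boundary f)"

text \<open>
  A triple \<open>(h, h\<^sub>+, h\<^sub>\<times>)\<close> comes with the number \<open>n\<close> of its distinguished variables, so \<open>n\<close> is
  chosen together with the triple, before \<open>V\<close>.
\<close>

definition generic_uniform_model :: bool where
  "generic_uniform_model \<longleftrightarrow>
     (\<exists>n. \<exists>h\<in>polys_over \<int>. \<exists>hp\<in>polys_over \<int>. \<exists>ht\<in>polys_over \<int>. \<exists>\<sigma>\<in>prime_strings.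
        \<forall>V\<in>basic_open \<sigma>. HTP_generic V \<longrightarrow> dioph_model_via (subring_of V) n h hp ht)"

end

theory Submission
  imports Defs "HOL-Number_Theory.Number_Theory" "HOL-Computational_Algebra.Squarefree"
begin

text \<open>
  Why the dichotomy holds. The class of all \<open>W\<close> whose ring has a diophantine model of the integers
  is a countable union, over the quadruples \<open>(n, h, h\<^sub>+, h\<^sub>\<times>)\<close>, of the sets of those \<open>W\<close> for which this
  quadruple gives a model. If the class is not meager, one of these sets is dense in some basic
  open set \<open>U\<close>. The statement that a given rational tuple lies in the set defined by a polynomial
  is witnessed by finitely many rationals, hence by finitely many elements of \<open>W\<close>: it is open, and it
  passes from \<open>W\<close> to every larger set. So finitely many such facts, true at various members of \<open>U\<close>,
  are all true near the union of these members, which lies in \<open>U\<close> again, and therefore at a common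
  member of the dense set. In the integers \<open>0\<close> is the only \<open>a\<close> with \<open>a + a = a\<close>, \<open>1\<close> is the only other
  idempotent, and everything else is reached by adding and subtracting \<open>1\<close>. Comparing two members
  of the dense set inside a third one shows that all of them carry the same isomorphism
  (\<open>iso_unique\<close>). The three defined sets are thus constant on the dense set, and an HTP-generic member
  of \<open>U\<close>, which decides every equation on a neighbourhood, has the same three sets.

  The two possibilities exclude each other since the HTP-generic sets form a comeager class and the
  space is a Baire space.

  For the statement about the field of rationals, the argument above also applies to the largest
  member \<open>T\<close> of \<open>U\<close>. Its complement is finite, so that its ring is an intersection of finitely many
  local rings \<open>\<int>\<^sub>(\<^sub>p\<^sub>)\<close>, and a model over this ring becomes a model over the rationals once
  every \<open>\<int>\<^sub>(\<^sub>p\<^sub>)\<close> is known to be diophantine over the rationals (\<open>diophantine_local_ring\<close>).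

  Why \<open>\<int>\<^sub>(\<^sub>p\<^sub>)\<close> is diophantine. Its elements are the quotients \<open>t\<^sub>1 / (1 + p t\<^sub>2)\<close> with \<open>t\<^sub>1\<close>, \<open>t\<^sub>2\<close> in
  any fixed set between \<open>\<int>\<close> and \<open>\<int>\<^sub>(\<^sub>p\<^sub>)\<close>, so one diophantine set of this kind is enough. For odd \<open>p\<close>
  choose a prime \<open>d\<close> with \<open>d mod 4 = 3\<close> such that \<open>- d\<close> is not a square modulo \<open>p\<close>, and consider those \<open>t\<close> for which
  \<open>1 + p (2 d t)\<^sup>2 + p d u\<^sup>2 = x\<^sup>2 + d y\<^sup>2\<close> is solvable. If \<open>t\<close> is not \<open>p\<close>-integral, the two leading
  terms are \<open>p\<close> times a \<open>p\<close>-adic square, and the equation has no \<open>p\<close>-adic solution. If \<open>t\<close> is an integer,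
  put \<open>f = 1 + p (2 d t)\<^sup>2\<close>. A prime \<open>l\<close> that is represented, up to squares, both by \<open>f z\<^sup>2 + p d u\<^sup>2\<close> and
  by \<open>x\<^sup>2 + d y\<^sup>2\<close> gives a solution. By Legendre's theorem on ternary forms (\<open>legendre_ternary\<close>) such an \<open>l\<close>
  is characterised by quadratic symbols, quadratic reciprocity shows that the required symbols
  are consistent, and a prime with these symbols exists by the case of Dirichlet's theorem that
  concerns real characters only (\<open>exists_prime_with_symbols\<close>). For \<open>p = 2\<close> sums of three squares play the same role.
\<close>

\<comment> \<open>Unbounded sums below are infinite series; the same notation for finitely supported sums would make them ambiguous.\<close>
no_syntax
  "_Sum_any" :: "pttrn \<Rightarrow> 'a \<Rightarrow> 'a::comm_monoid_add"
    (\<open>(\<open>indent=2 notation=\<open>binder \<Sum>\<close>\<close>\<Sum>_. _)\<close> [0, 10] 10)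

section \<open>Legendre's theorem on ternary quadratic forms\<close>

lemma least_nat_square_ge:
  fixes n :: nat
  obtains m where "n \<le> m\<^sup>2" and "\<And>x. x < m \<Longrightarrow> x\<^sup>2 < n"
proof -
  define m where "m = (LEAST m. n \<le> m\<^sup>2)"
  have "n \<le> n\<^sup>2" by (simp add: power2_nat_le_imp_le self_le_power power2_eq_square)
  hence "n \<le> m\<^sup>2" unfolding m_def by (rule LeastI)
  moreover have "x\<^sup>2 < n" if "x < m" for x
    using not_less_Least[of x "\<lambda>m. n \<le> m\<^sup>2"] that by (auto simp: m_def)
  ultimately show ?thesis by (rule that)
qed

lemma int_mod_eq_imp_dvd_diff:
  fixes u v :: int
  assumes "u mod m = v mod m"
  shows "m dvd u - v"
  using assms by (simp add: mod_eq_dvd_iff)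

text \<open>
  Modulo each of \<open>a\<close>, \<open>b\<close>, \<open>c\<close> the form \<open>a x\<^sup>2 + b y\<^sup>2 - c z\<^sup>2\<close> splits into linear factors, so it is
  divisible by \<open>a b c\<close> whenever three linear congruences hold. The box with \<open>x\<^sup>2 < b c\<close>, \<open>y\<^sup>2 < c a\<close>, \<open>z\<^sup>2 < a b\<close>
  has more than \<open>a b c\<close> points, as \<open>b c\<close> is not a square. By the pigeonhole principle two of them differ by a
  nonzero solution of the congruences, and there the form lies strictly between \<open>- a b c\<close> and \<open>2 a b c\<close>:
  its value is \<open>0\<close> or \<open>a b c\<close>.
\<close>

theorem legendre_ternary:
  fixes a b c :: nat
  assumes pos: "a > 0" "b > 0" "c > 0"
    and cop: "coprime a b" "coprime b c" "coprime a c"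
    and nsq: "\<And>t. b * c \<noteq> t\<^sup>2"
    and r: "int a dvd int b * r\<^sup>2 - int c"
    and s: "int b dvd int a * s\<^sup>2 - int c"
    and t: "int c dvd int a * t\<^sup>2 + int b"
  obtains x y z :: int where "int a * x\<^sup>2 + int b * y\<^sup>2 = int c * z\<^sup>2" and "(x, y, z) \<noteq> (0, 0, 0)"
proof -
  obtain m1 where m1: "b * c \<le> m1\<^sup>2" "\<And>x. x < m1 \<Longrightarrow> x\<^sup>2 < b * c"
    using least_nat_square_ge[of "b * c"] by metis
  obtain m2 where m2: "c * a \<le> m2\<^sup>2" "\<And>x. x < m2 \<Longrightarrow> x\<^sup>2 < c * a"
    using least_nat_square_ge[of "c * a"] by metis
  obtain m3 where m3: "a * b \<le> m3\<^sup>2" "\<And>x. x < m3 \<Longrightarrow> x\<^sup>2 < a * b"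
    using least_nat_square_ge[of "a * b"] by metis
  have m1': "b * c < m1\<^sup>2" using m1(1) nsq[of m1] by simp
  have "(b * c) * ((c * a) * (a * b)) < m1\<^sup>2 * (m2\<^sup>2 * m3\<^sup>2)"
  proof (rule mult_less_le_imp_less)
    show "c * a * (a * b) \<le> m2\<^sup>2 * m3\<^sup>2" using m2(1) m3(1) by (rule mult_mono) auto
  qed (use m1' pos in auto)
  hence "(a * b * c)\<^sup>2 < (m1 * m2 * m3)\<^sup>2"
    by (simp add: power2_eq_square algebra_simps)
  hence big: "a * b * c < m1 * m2 * m3"
    by (rule power_less_imp_less_base) simp
  define B :: "(nat \<times> nat \<times> nat) set" where "B = {..<m1} \<times> {..<m2} \<times> {..<m3}"
  define g :: "nat \<times> nat \<times> nat \<Rightarrow> int \<times> int \<times> int" where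
    "g = (\<lambda>(x, y, z). ((int y - r * int z) mod int a, (int x - s * int z) mod int b,
                        (int x - t * int y) mod int c))"
  define C :: "(int \<times> int \<times> int) set" where "C = {0..<int a} \<times> {0..<int b} \<times> {0..<int c}"
  have "g ` B \<subseteq> C" using pos by (auto simp: g_def C_def)
  moreover have "card C = a * b * c" by (simp add: C_def card_cartesian_product)
  moreover have "finite C" by (simp add: C_def)
  ultimately have "card (g ` B) \<le> a * b * c" using card_mono by metis
  moreover have "card B = m1 * m2 * m3" by (simp add: B_def card_cartesian_product)
  ultimately have "\<not> inj_on g B" using big card_image[of g B] by linarith
  then obtain x1 y1 z1 x2 y2 z2 where P: "(x1,y1,z1) \<in> B" "(x2,y2,z2) \<in> B"
      "(x1,y1,z1) \<noteq> (x2,y2,z2)" "g (x1,y1,z1) = g (x2,y2,z2)"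
    unfolding inj_on_def by (metis prod_cases3)
  define x y z where "x = int x1 - int x2" and "y = int y1 - int y2" and "z = int z1 - int z2"
  have nz: "(x, y, z) \<noteq> (0,0,0)" using P(3) by (auto simp: x_def y_def z_def)
  have sqbd: "(int u - int v)\<^sup>2 < int n" if "\<And>x. x < m \<Longrightarrow> x\<^sup>2 < n" "u < m" "v < m" for u v n m :: nat
  proof (cases "u \<le> v")
    case True
    hence "(int u - int v)\<^sup>2 = int ((v - u)\<^sup>2)" by (simp add: of_nat_diff power2_commute)
    also have "(v - u)\<^sup>2 < n" using that by simp
    hence "int ((v - u)\<^sup>2) < int n" by (simp only: of_nat_less_iff)
    finally show ?thesis .
  next
    case False
    hence "(int u - int v)\<^sup>2 = int ((u - v)\<^sup>2)" by (simp add: of_nat_diff)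
    also have "(u - v)\<^sup>2 < n" using that by simp
    hence "int ((u - v)\<^sup>2) < int n" by (simp only: of_nat_less_iff)
    finally show ?thesis .
  qed
  have bx: "x\<^sup>2 < int (b * c)" unfolding x_def by (rule sqbd[OF m1(2)]) (use P(1,2) in \<open>auto simp: B_def\<close>)
  have by': "y\<^sup>2 < int (c * a)" unfolding y_def by (rule sqbd[OF m2(2)]) (use P(1,2) in \<open>auto simp: B_def\<close>)
  have bz: "z\<^sup>2 < int (a * b)" unfolding z_def by (rule sqbd[OF m3(2)]) (use P(1,2) in \<open>auto simp: B_def\<close>)
  have "int a dvd (int y1 - r * int z1) - (int y2 - r * int z2)"
    by (rule int_mod_eq_imp_dvd_diff) (use P(4) in \<open>simp add: g_def\<close>)
  hence da: "int a dvd y - r * z" by (simp add: y_def z_def algebra_simps)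
  have "int b dvd (int x1 - s * int z1) - (int x2 - s * int z2)"
    by (rule int_mod_eq_imp_dvd_diff) (use P(4) in \<open>simp add: g_def\<close>)
  hence db: "int b dvd x - s * z" by (simp add: x_def z_def algebra_simps)
  have "int c dvd (int x1 - t * int y1) - (int x2 - t * int y2)"
    by (rule int_mod_eq_imp_dvd_diff) (use P(4) in \<open>simp add: g_def\<close>)
  hence dc: "int c dvd x - t * y" by (simp add: x_def y_def algebra_simps)
  define F where "F = int a * x\<^sup>2 + int b * y\<^sup>2 - int c * z\<^sup>2"
  have "F = int a * x\<^sup>2 + int b * (y + r * z) * (y - r * z) + (int b * r\<^sup>2 - int c) * z\<^sup>2"
    by (simp add: F_def power2_eq_square algebra_simps)
  hence Fa: "int a dvd F" using da r by (simp add: dvd_add)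
  have "F = int b * y\<^sup>2 + int a * (x + s * z) * (x - s * z) + (int a * s\<^sup>2 - int c) * z\<^sup>2"
    by (simp add: F_def power2_eq_square algebra_simps)
  hence Fb: "int b dvd F" using db s by (simp add: dvd_add)
  have "F = int a * (x + t * y) * (x - t * y) + (int a * t\<^sup>2 + int b) * y\<^sup>2 - int c * z\<^sup>2"
    by (simp add: F_def power2_eq_square algebra_simps)
  hence Fc: "int c dvd F" using dc t by (simp add: dvd_add dvd_diff)
  have "int a * int b dvd F" using Fa Fb cop by (intro divides_mult) auto
  hence "int a * int b * int c dvd F" using Fc cop by (intro divides_mult) auto
  then obtain k where k: "F = int a * int b * int c * k" by (auto elim: dvdE)
  define N where "N = int a * int b * int c"
  have N: "N > 0" using pos by (simp add: N_def)
  have "int a * x\<^sup>2 < N" using bx pos by (simp add: N_def mult.assoc)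
  moreover have "int b * y\<^sup>2 < N"
    using mult_strict_left_mono[OF by', of "int b"] pos by (simp add: N_def ac_simps)
  moreover have "int c * z\<^sup>2 < N"
    using mult_strict_left_mono[OF bz, of "int c"] pos by (simp add: N_def ac_simps)
  moreover have "int a * x\<^sup>2 \<ge> 0" "int b * y\<^sup>2 \<ge> 0" "int c * z\<^sup>2 \<ge> 0" by auto
  ultimately have "F < N * 2" "N * (-1) < F" unfolding F_def by linarith+
  hence "N * k < N * 2" "N * (-1) < N * k" using k by (simp_all add: N_def)
  hence "k < 2" "-1 < k" using N by (simp_all only: mult_less_cancel_left_pos)
  hence "k = 0 \<or> k = 1" by auto
  thus ?thesis
  proof
    assume "k = 0"
    thus ?thesis using that[of x y z] nz k by (simp add: F_def)
  next
    assume "k = 1"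
    hence F1: "int a * x\<^sup>2 + int b * y\<^sup>2 = int c * z\<^sup>2 + int a * int b * int c"
      using k by (simp add: F_def)
    \<comment> \<open>a value \<open>a b c\<close> is turned into a zero by composing with the norm \<open>z\<^sup>2 + a b\<close>\<close>
    have "int a * (x * z + int b * y)\<^sup>2 + int b * (y * z - int a * x)\<^sup>2
        = (int a * x\<^sup>2 + int b * y\<^sup>2) * (z\<^sup>2 + int a * int b)"
      by (simp add: power2_eq_square algebra_simps)
    also have "\<dots> = int c * (z\<^sup>2 + int a * int b)\<^sup>2"
      unfolding F1 by (simp add: power2_eq_square algebra_simps)
    finally have E: "int a * (x * z + int b * y)\<^sup>2 + int b * (y * z - int a * x)\<^sup>2
        = int c * (z\<^sup>2 + int a * int b)\<^sup>2" .
    have "int a * int b > 0" using pos by simp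
    hence "z\<^sup>2 + int a * int b \<noteq> 0" using zero_le_power2[of z] by linarith
    thus ?thesis using that[OF E] by simp
  qed
qed

section \<open>Quadratic symbols\<close>

lemma eq_if_dvd_diff_less:
  fixes u v :: int
  assumes "int p dvd u - v" "\<bar>u - v\<bar> < int p"
  shows "u = v"
  using dvd_imp_le_int[of "u - v" "int p"] assms by linarith

lemma Legendre_values: "Legendre a p \<in> {-1, 0, 1}"
  by (simp add: Legendre_def)

lemma Legendre_eq_0_iff: "Legendre a p = 0 \<longleftrightarrow> p dvd a"
  by (simp add: Legendre_def cong_0_iff)

lemma Legendre_cong:
  assumes "[a = b] (mod p)"
  shows "Legendre a p = Legendre b p"
proof -
  have "[x = a] (mod p) \<longleftrightarrow> [x = b] (mod p)" for x
    using assms cong_trans cong_sym by blast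
  moreover have "[a = 0] (mod p) \<longleftrightarrow> [b = 0] (mod p)"
    using assms cong_trans cong_sym by blast
  ultimately show ?thesis by (simp only: Legendre_def QuadRes_def)
qed

lemma Legendre_mult:
  assumes "prime p" "odd p"
  shows "Legendre (a * b) (int p) = Legendre a (int p) * Legendre b (int p)"
proof -
  have p2: "2 < p" using assms prime_ge_2_nat[of p] by (cases "p = 2") auto
  have "[Legendre (a * b) (int p) = (a * b) ^ ((p - 1) div 2)] (mod int p)"
    by (rule euler_criterion) (use assms p2 in auto)
  also have "(a * b) ^ ((p - 1) div 2) = a ^ ((p - 1) div 2) * b ^ ((p - 1) div 2)"
    by (rule power_mult_distrib)
  also have "[\<dots> = Legendre a (int p) * Legendre b (int p)] (mod int p)"
    by (intro cong_mult cong_sym[OF euler_criterion]) (use assms p2 in auto)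
  finally have *: "int p dvd Legendre (a * b) (int p) - Legendre a (int p) * Legendre b (int p)"
    by (simp add: cong_iff_dvd_diff)
  have "\<bar>Legendre (a * b) (int p) - Legendre a (int p) * Legendre b (int p)\<bar> < int p"
    using Legendre_values[of "a * b" "int p"] Legendre_values[of a "int p"]
      Legendre_values[of b "int p"] p2 by auto
  with * show ?thesis by (rule eq_if_dvd_diff_less)
qed

lemma Legendre_sq:
  assumes "prime p" "\<not> int p dvd a"
  shows "Legendre (a\<^sup>2) (int p) = 1"
proof -
  have "\<not> int p dvd a\<^sup>2" using assms prime_dvd_power[of "int p" a 2] by auto
  moreover have "QuadRes (int p) (a\<^sup>2)" unfolding QuadRes_def by (rule exI[of _ a]) simp
  ultimately show ?thesis by (simp add: Legendre_def cong_0_iff)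
qed

lemma Legendre_eq_1D:
  assumes "Legendre a (int p) = 1"
  obtains r where "int p dvd r\<^sup>2 - a"
  using assms unfolding Legendre_def QuadRes_def
  by (auto split: if_splits simp: cong_iff_dvd_diff)

text \<open>
  Since \<open>b\<close> is invertible modulo \<open>q\<close>, the congruence \<open>b r\<^sup>2 = c\<close> asks whether \<open>b c\<close> is a square.
\<close>

lemma Legendre_solve:
  assumes "prime q" "odd q" "\<not> int q dvd b" "Legendre (b * c) (int q) = 1"
  shows "\<exists>r. int q dvd b * r\<^sup>2 - c"
proof -
  obtain u where u: "int q dvd u\<^sup>2 - b * c" using Legendre_eq_1D[OF assms(4)] .
  have "coprime b (int q)" using assms(1,3) 
    by (metis prime_imp_coprime coprime_commute prime_nat_int_transfer)
  then obtain b' where b': "[b * b' = 1] (mod int q)" using cong_solve_coprime_int by blast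
  have "[b * (b' * u)\<^sup>2 = (b * b') * b' * u\<^sup>2] (mod int q)" by (simp add: power2_eq_square ac_simps)
  also have "[(b * b') * b' * u\<^sup>2 = 1 * b' * (b * c)] (mod int q)"
    by (intro cong_mult b' cong_refl) (use u in \<open>simp add: cong_iff_dvd_diff\<close>)
  also have "1 * b' * (b * c) = (b * b') * c" by simp
  also have "[(b * b') * c = 1 * c] (mod int q)" by (intro cong_mult b' cong_refl)
  finally show ?thesis by (auto simp: cong_iff_dvd_diff)
qed

lemma squarefree_solve:
  fixes m :: nat
  assumes "squarefree m" "\<And>q. prime q \<Longrightarrow> q dvd m \<Longrightarrow> \<exists>r. int q dvd b * r\<^sup>2 - c"
  shows "\<exists>r. int m dvd b * r\<^sup>2 - c"
  using assms
proof (induction m rule: less_induct)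
  case (less m)
  show ?case
  proof (cases "m = 1")
    case True
    thus ?thesis by simp
  next
    case False
    then obtain q where q: "prime q" "q dvd m" by (metis prime_factor_nat)
    then obtain k where k: "m = q * k" by (auto elim: dvdE)
    have m0: "m \<noteq> 0" using less.prems(1) by (metis not_squarefree_0)
    have cop: "coprime q k"
    proof (rule prime_imp_coprime[OF q(1)], rule notI)
      assume "q dvd k"
      hence "q\<^sup>2 dvd m" by (simp add: k power2_eq_square)
      hence "q dvd 1" by (rule squarefreeD[OF less.prems(1)])
      thus False using q(1) by auto
    qed
    have "k < m" using m0 n_less_n_mult_m[of k q] prime_gt_1_nat[OF q(1)] by (simp add: k mult.commute)
    moreover have "squarefree k" 
      by (rule squarefree_mono[OF _ less.prems(1)]) (simp add: k)
    ultimately obtain r1 where r1: "int k dvd b * r1\<^sup>2 - c"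
      using less.IH[of k] less.prems(2) k by auto
    obtain r2 where r2: "int q dvd b * r2\<^sup>2 - c" using less.prems(2) q by blast
    obtain r where r: "[r = r1] (mod int k)" "[r = r2] (mod int q)"
      using binary_chinese_remainder_int[of "int k" "int q" r1 r2] cop
      by (auto simp: coprime_commute)
    have "[b * r\<^sup>2 - c = b * r1\<^sup>2 - c] (mod int k)" by (intro cong_diff cong_mult cong_pow cong_refl r)
    hence "int k dvd b * r\<^sup>2 - c" using r1 cong_dvd_iff by blast
    moreover have "[b * r\<^sup>2 - c = b * r2\<^sup>2 - c] (mod int q)" by (intro cong_diff cong_mult cong_pow cong_refl r)
    hence "int q dvd b * r\<^sup>2 - c" using r2 cong_dvd_iff by blast
    ultimately have "int q * int k dvd b * r\<^sup>2 - c" using cop by (intro divides_mult) auto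
    thus ?thesis using k by auto
  qed
qed

lemma Legendre_prod:
  assumes "prime l" "odd l"
  shows "Legendre (\<Prod>x\<in>A. f x) (int l) = (\<Prod>x\<in>A. Legendre (f x) (int l))"
proof (induction A rule: infinite_finite_induct)
  case (insert x F)
  thus ?case using assms by (simp add: Legendre_mult)
next
  case empty
  thus ?case using Legendre_sq[of l 1] assms prime_gt_1_nat[of l] by (simp add: zdvd1_eq)
next
  case (infinite A)
  thus ?case using Legendre_sq[of l 1] assms prime_gt_1_nat[of l] by (simp add: zdvd1_eq)
qed

lemma squarefree_prod_primes:
  fixes m :: nat
  assumes "squarefree m"
  shows "m = \<Prod>(prime_factors m)"
proof -
  have m0: "m \<noteq> 0" using assms by (metis not_squarefree_0)
  have "m = (\<Prod>q\<in>prime_factors m. q ^ multiplicity q m)" using m0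
    by (metis prime_factorization_nat neq0_conv)
  also have "\<dots> = (\<Prod>q\<in>prime_factors m. q)"
    by (rule prod.cong) (use assms m0 in \<open>auto simp: squarefree_factorial_semiring'\<close>)
  finally show ?thesis by simp
qed

lemma reciprocity_1mod4:
  assumes "prime l" "prime q" "odd q" "l \<noteq> q" "l mod 4 = 1"
  shows "Legendre (int q) (int l) = Legendre (int l) (int q)"
proof -
  have "2 < l" using assms(5) prime_ge_2_nat[OF assms(1)] by (cases "l = 2") auto
  moreover have "2 < q" using assms(2,3) prime_ge_2_nat[OF assms(2)] by (cases "q = 2") auto
  ultimately have *: "Legendre (int l) (int q) * Legendre (int q) (int l) = (-1) ^ ((l - 1) div 2 * ((q - 1) div 2))"
    using Quadratic_Reciprocity assms by blast
  have "even ((l - 1) div 2)" using assms(5) by presburger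
  hence "Legendre (int l) (int q) * Legendre (int q) (int l) = 1" using * by simp
  thus ?thesis using Legendre_values[of "int l" "int q"] Legendre_values[of "int q" "int l"] by auto
qed

lemma Legendre_minus_one:
  assumes "prime q" "odd q"
  shows "Legendre (-1) (int q) = (if q mod 4 = 1 then 1 else -1)"
proof -
  have q2: "2 < q" using assms prime_ge_2_nat[of q] by (cases "q = 2") auto
  have "[Legendre (-1) (int q) = (-1) ^ ((q - 1) div 2)] (mod int q)"
    by (rule euler_criterion) (use assms q2 in auto)
  moreover have "(-1) ^ ((q - 1) div 2) = (if q mod 4 = 1 then 1 else -1 :: int)"
  proof -
    have "q mod 4 = 1 \<longleftrightarrow> even ((q - 1) div 2)" using assms(2) by presburger
    thus ?thesis by (simp add: minus_one_power_iff)
  qed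
  ultimately have *: "int q dvd Legendre (-1) (int q) - (if q mod 4 = 1 then 1 else -1)"
    by (simp add: cong_iff_dvd_diff)
  have "\<bar>Legendre (-1) (int q) - (if q mod 4 = 1 then 1 else -1)\<bar> < int q"
    using Legendre_values[of "-1" "int q"] q2 by auto
  with * show ?thesis by (rule eq_if_dvd_diff_less)
qed

lemma reciprocity_3mod4:
  assumes "prime d" "prime q" "odd q" "d \<noteq> q" "d mod 4 = 3"
  shows "Legendre (- int d) (int q) = Legendre (int q) (int d)"
proof -
  have d: "2 < d" "odd d" using assms(5) prime_ge_2_nat[OF assms(1)] by (cases "d = 2"; presburger)+
  have "2 < q" using assms(2,3) prime_ge_2_nat[OF assms(2)] by (cases "q = 2") auto
  hence *: "Legendre (int d) (int q) * Legendre (int q) (int d) = (-1) ^ ((d - 1) div 2 * ((q - 1) div 2))"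
    using Quadratic_Reciprocity assms d by blast
  have "odd ((d - 1) div 2)" using assms(5) by presburger
  moreover have "q mod 4 = 1 \<longleftrightarrow> even ((q - 1) div 2)" using assms(3) by presburger
  ultimately have "Legendre (int d) (int q) * Legendre (int q) (int d) = Legendre (-1) (int q)"
    using * assms Legendre_minus_one[of q] by (simp add: minus_one_power_iff)
  moreover have "Legendre (- int d) (int q) = Legendre (-1) (int q) * Legendre (int d) (int q)"
    using Legendre_mult[OF assms(2,3), of "-1" "int d"] by simp
  moreover have "Legendre (int d) (int q) \<noteq> 0"
    using primes_dvd_imp_eq[of q d] assms by (auto simp: Legendre_eq_0_iff)
  ultimately show ?thesis
    using Legendre_values[of "int d" "int q"] Legendre_values[of "int q" "int d"] by auto
qed

section \<open>Series of quadratic characters\<close>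

definition sign_multiplicative :: "(nat \<Rightarrow> real) \<Rightarrow> bool" where
  "sign_multiplicative \<psi> \<longleftrightarrow>
     \<psi> 1 = 1 \<and> (\<forall>a b. \<psi> (a * b) = \<psi> a * \<psi> b) \<and> (\<forall>a. \<psi> a \<in> {-1, 0, 1})"

text \<open>
  Real Dirichlet characters modulo \<open>m\<close>, not necessarily primitive. The vanishing of the sum over a period
  says that the character is not principal. Functions on \<open>nat\<close> with real values make both the
  periodicity and the series immediate.
\<close>

definition quadratic_character :: "(nat \<Rightarrow> real) \<Rightarrow> nat \<Rightarrow> bool" where
  "quadratic_character \<psi> m \<longleftrightarrow>
     sign_multiplicative \<psi> \<and> m > 0 \<and> (\<forall>a. \<psi> (a + m) = \<psi> a) \<and> (\<Sum>a<m. \<psi> a) = 0"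

lemma sign_multiplicative_abs_le_1: "sign_multiplicative \<psi> \<Longrightarrow> \<bar>\<psi> n\<bar> \<le> 1"
  unfolding sign_multiplicative_def by (metis (no_types, lifting) abs_0 abs_1 abs_minus_cancel insertE
      le_numeral_extra(1) order_refl singletonD)

lemma sign_multiplicative_power: "sign_multiplicative \<psi> \<Longrightarrow> \<psi> (a ^ k) = \<psi> a ^ k"
  by (induction k) (auto simp: sign_multiplicative_def)

lemma quadratic_character_partial_sum:
  assumes "quadratic_character \<psi> m"
  shows "\<bar>\<Sum>a<N. \<psi> a\<bar> \<le> real m"
proof -
  have per: "\<psi> (a + m) = \<psi> a" and z: "(\<Sum>a<m. \<psi> a) = 0" and m: "m > 0" for a
    using assms by (auto simp: quadratic_character_def)
  have step: "(\<Sum>a<n + m. \<psi> a) = (\<Sum>a<n. \<psi> a)" for n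
    by (induction n) (auto simp: z per)
  have steps: "(\<Sum>a<n + k * m. \<psi> a) = (\<Sum>a<n. \<psi> a)" for n k
  proof (induction k)
    case (Suc k)
    have e: "n + Suc k * m = (n + k * m) + m" by simp
    show ?case unfolding e step by (rule Suc)
  qed auto
  have "(\<Sum>a<N. \<psi> a) = (\<Sum>a<N mod m. \<psi> a)"
    using steps[of "N mod m" "N div m"] by simp
  also have "\<bar>\<dots>\<bar> \<le> (\<Sum>a<N mod m. \<bar>\<psi> a\<bar>)" by (rule sum_abs)
  also have "\<dots> \<le> (\<Sum>a<N mod m. 1)"
    by (intro sum_mono sign_multiplicative_abs_le_1) (use assms in \<open>simp add: quadratic_character_def\<close>)
  also have "\<dots> \<le> real m" using m by (simp add: less_imp_le)
  finally show ?thesis .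
qed

lemma quadratic_character_interval_sum:
  assumes "quadratic_character \<psi> m"
  shows "\<bar>\<Sum>a=N..<M. \<psi> a\<bar> \<le> 2 * real m"
proof (cases "N \<le> M")
  case True
  have "(\<Sum>a<M. \<psi> a) = (\<Sum>a<N. \<psi> a) + (\<Sum>a=N..<M. \<psi> a)"
    using True by (metis lessThan_atLeast0 sum.atLeastLessThan_concat zero_le)
  thus ?thesis using quadratic_character_partial_sum[OF assms, of M]
      quadratic_character_partial_sum[OF assms, of N] by linarith
qed auto

lemma abel_partial_summation_bound:
  fixes a g :: "nat \<Rightarrow> real"
  assumes B: "\<And>M. \<bar>\<Sum>k=N..<M. a k\<bar> \<le> B"
    and dec: "\<And>n. n \<ge> N \<Longrightarrow> g (Suc n) \<le> g n" and nn: "\<And>n. n \<ge> N \<Longrightarrow> 0 \<le> g n"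
  shows "\<bar>\<Sum>k=N..<M. a k * g k\<bar> \<le> B * g N"
proof (cases "N \<le> M")
  case False
  have "B \<ge> 0" using B[of N] by simp
  thus ?thesis using False nn[of N] by simp
next
  case True
  define Y where "Y = (\<lambda>M. \<Sum>k=N..<M. a k)"
  have "\<exists>R. (\<Sum>k=N..<M. a k * g k) = Y M * g M + R \<and> \<bar>R\<bar> \<le> B * (g N - g M)"
    using True
  proof (induction M rule: dec_induct)
    case base
    thus ?case by (auto simp: Y_def)
  next
    case (step n)
    then obtain R where R: "(\<Sum>k=N..<n. a k * g k) = Y n * g n + R" "\<bar>R\<bar> \<le> B * (g N - g n)" by blast
    define R' where "R' = R + Y (Suc n) * (g n - g (Suc n))"
    have Y: "Y (Suc n) = Y n + a n" using step by (simp add: Y_def)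
    have "(\<Sum>k=N..<Suc n. a k * g k) = Y (Suc n) * g (Suc n) + R'"
      using step R(1) by (simp add: R'_def Y algebra_simps)
    moreover have "\<bar>Y (Suc n) * (g n - g (Suc n))\<bar> \<le> B * (g n - g (Suc n))"
      using B[of "Suc n"] dec[of n] step by (auto simp: abs_mult Y_def intro!: mult_right_mono)
    hence "\<bar>R'\<bar> \<le> B * (g N - g (Suc n))"
      unfolding R'_def using R(2) by (simp add: algebra_simps abs_if split: if_splits)
    ultimately show ?case by blast
  qed
  then obtain R where R: "(\<Sum>k=N..<M. a k * g k) = Y M * g M + R" "\<bar>R\<bar> \<le> B * (g N - g M)" by blast
  have "\<bar>Y M * g M\<bar> \<le> B * g M"
    using B[of M] nn[of M] True by (auto simp: abs_mult Y_def intro!: mult_right_mono)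
  hence "\<bar>Y M * g M + R\<bar> \<le> B * g M + B * (g N - g M)"
    using R(2) by linarith
  thus ?thesis using R(1) by (simp add: algebra_simps)
qed

text \<open>
  The error is bounded by a single term, uniformly in \<open>g\<close>. This one estimate serves three series:
  the values near \<open>1\<close>, the derivative near \<open>1\<close>, and the series in the proof that the value at \<open>1\<close> does
  not vanish.
\<close>

lemma character_series_tail:
  fixes g :: "nat \<Rightarrow> real"
  assumes \<psi>: "quadratic_character \<psi> m" and sm: "summable (\<lambda>n. \<psi> n * g n)"
    and dec: "\<And>n. n \<ge> N \<Longrightarrow> g (Suc n) \<le> g n" and nn: "\<And>n. n \<ge> N \<Longrightarrow> 0 \<le> g n"
  shows "\<bar>(\<Sum>n. \<psi> n * g n) - (\<Sum>n<N. \<psi> n * g n)\<bar> \<le> 2 * real m * g N"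
proof -
  have "(\<lambda>M. \<Sum>n<M. \<psi> n * g n) \<longlonglongrightarrow> (\<Sum>n. \<psi> n * g n)" by (rule summable_LIMSEQ[OF sm])
  hence lim: "(\<lambda>M. \<bar>(\<Sum>n<M. \<psi> n * g n) - (\<Sum>n<N. \<psi> n * g n)\<bar>) \<longlonglongrightarrow>
      \<bar>(\<Sum>n. \<psi> n * g n) - (\<Sum>n<N. \<psi> n * g n)\<bar>"
    by (intro tendsto_intros)
  show ?thesis
  proof (rule LIMSEQ_le_const2[OF lim], intro exI[of _ N] allI impI)
    fix M assume "N \<le> M"
    hence "(\<Sum>n<M. \<psi> n * g n) = (\<Sum>n<N. \<psi> n * g n) + (\<Sum>n=N..<M. \<psi> n * g n)"
      by (metis lessThan_atLeast0 sum.atLeastLessThan_concat zero_le)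
    thus "\<bar>(\<Sum>n<M. \<psi> n * g n) - (\<Sum>n<N. \<psi> n * g n)\<bar> \<le> 2 * real m * g N"
      using abel_partial_summation_bound[OF quadratic_character_interval_sum[OF \<psi>], of N g M] dec nn
      by simp
  qed
qed

lemma character_series_at_one_summable:
  assumes \<psi>: "quadratic_character \<psi> m"
  shows "summable (\<lambda>n. \<psi> n * (1 / real n))"
proof (subst summable_Cauchy, intro allI impI)
  fix e :: real assume e: "e > 0"
  have m: "m > 0" using \<psi> by (simp add: quadratic_character_def)
  obtain N where N: "2 * real m / e < real N" using reals_Archimedean2 by blast
  have N0: "N > 0" using N e m by (cases N) (auto simp: field_simps)
  show "\<exists>N. \<forall>k\<ge>N. \<forall>n. norm (\<Sum>i = k..<n. \<psi> i * (1 / real i)) < e"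
  proof (intro exI[of _ N] allI impI)
    fix k n assume k: "k \<ge> N"
    have "\<bar>\<Sum>i = k..<n. \<psi> i * (1 / real i)\<bar> \<le> 2 * real m * (1 / real k)"
      by (rule abel_partial_summation_bound[OF quadratic_character_interval_sum[OF \<psi>]])
         (use k N0 in \<open>auto simp: field_simps\<close>)
    also have "\<dots> \<le> 2 * real m / real N" using k N0 by (simp add: frac_le)
    also have "\<dots> < e" using N e N0 by (simp add: field_simps)
    finally show "norm (\<Sum>i = k..<n. \<psi> i * (1 / real i)) < e" by simp
  qed
qed

text \<open>
  The pairs of positive integers are sorted by their product.
\<close>

lemma has_sum_regroup_divisors:
  fixes F :: "nat \<Rightarrow> nat \<Rightarrow> real"
  assumes "((\<lambda>(d, k). F d k) has_sum S) ({1..} \<times> {1..})"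
  shows "((\<lambda>n. \<Sum>d | d dvd n. F d (n div d)) has_sum S) {1..}"
proof -
  have bij: "bij_betw (\<lambda>(n, d). (d, n div d)) (Sigma {1..} (\<lambda>n::nat. {d. d dvd n})) ({1..} \<times> {1..})"
    by (rule bij_betwI[where g = "\<lambda>(d, k). (d * k, d)"])
       (auto simp: Suc_le_eq dvd_pos_nat intro!: Nat.gr0I elim!: dvdE)
  have "((\<lambda>(n, d). F d (n div d)) has_sum S) (Sigma {1..} (\<lambda>n::nat. {d. d dvd n}))"
    using has_sum_reindex_bij_betw[OF bij, of "\<lambda>(d, k). F d k" S] assms
    by (simp add: case_prod_unfold)
  thus ?thesis
    by (rule has_sum_SigmaD) (auto intro!: has_sum_finite)
qed

lemma has_sum_pos_of_abs_summable:
  fixes f :: "nat \<Rightarrow> real"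
  assumes "summable (\<lambda>n. \<bar>f n\<bar>)" "f 0 = 0"
  shows "(f has_sum (\<Sum>n. f n)) {1..}"
proof -
  have "summable f" using assms(1) by (rule summable_rabs_cancel)
  hence "(f has_sum (\<Sum>n. f n)) UNIV"
    using norm_summable_imp_has_sum[of f] assms(1) by (simp add: summable_sums)
  thus ?thesis
    by (subst has_sum_cong_neutral[of UNIV "{1..}" f f]) (use assms(2) not_less_eq_eq in \<open>auto simp: Suc_le_eq\<close>)
qed

lemma sums_of_has_sum_pos:
  fixes f :: "nat \<Rightarrow> real"
  assumes "(f has_sum S) {1..}" "f 0 = 0"
  shows "f sums S"
proof -
  have "(f has_sum S) UNIV"
    using assms by (subst has_sum_cong_neutral[of "{1..}" UNIV f f]) (auto simp: Suc_le_eq)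
  thus ?thesis by (rule has_sum_imp_sums)
qed

lemma dirichlet_convolution_sums:
  fixes f g :: "nat \<Rightarrow> real"
  assumes f: "summable (\<lambda>n. \<bar>f n\<bar>)" "f 0 = 0" and g: "summable (\<lambda>n. \<bar>g n\<bar>)" "g 0 = 0"
  shows "(\<lambda>n. \<Sum>d | d dvd n. f d * g (n div d)) sums ((\<Sum>n. f n) * (\<Sum>n. g n))"
proof -
  have hf: "(f has_sum (\<Sum>n. f n)) {1..}" and hg: "(g has_sum (\<Sum>n. g n)) {1..}"
    and hg': "((\<lambda>n. \<bar>g n\<bar>) has_sum (\<Sum>n. \<bar>g n\<bar>)) {1..}"
    and hf': "((\<lambda>n. \<bar>f n\<bar>) has_sum (\<Sum>n. \<bar>f n\<bar>)) {1..}"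
    using has_sum_pos_of_abs_summable[OF f] has_sum_pos_of_abs_summable[OF g]
      has_sum_pos_of_abs_summable[of "\<lambda>n. \<bar>f n\<bar>"] has_sum_pos_of_abs_summable[of "\<lambda>n. \<bar>g n\<bar>"] f g
    by simp_all
  have "(\<lambda>(d, k). \<bar>f d\<bar> * \<bar>g k\<bar>) summable_on ({1..} \<times> {1..})"
    by (rule summable_on_SigmaI[where g = "\<lambda>d. \<bar>f d\<bar> * (\<Sum>n. \<bar>g n\<bar>)"])
       (use hg' has_sum_imp_summable[OF has_sum_cmult_left[OF hf']] in \<open>auto intro!: has_sum_cmult_right\<close>)
  hence "(\<lambda>x. norm ((\<lambda>(d, k). f d * g k) x)) summable_on ({1..} \<times> {1..})"
    by (simp add: case_prod_unfold abs_mult)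
  hence "(\<lambda>(d, k). f d * g k) summable_on ({1..} \<times> {1..})"
    by (rule abs_summable_summable)
  hence "((\<lambda>(d, k). f d * g k) has_sum ((\<Sum>n. f n) * (\<Sum>n. g n))) ({1..} \<times> {1..})"
    by (intro has_sum_SigmaI[where g = "\<lambda>d. f d * (\<Sum>n. g n)"])
       (use hf hg in \<open>auto intro!: has_sum_cmult_right has_sum_cmult_left\<close>)
  hence "((\<lambda>n. \<Sum>d | d dvd n. f d * g (n div d)) has_sum ((\<Sum>n. f n) * (\<Sum>n. g n))) {1..}"
    by (rule has_sum_regroup_divisors)
  thus ?thesis by (rule sums_of_has_sum_pos) simp
qed

section \<open>The value at 1 does not vanish\<close>

lemma divisors_prime_power_mult:
  fixes p k :: nat
  assumes "prime p" "\<not> p dvd k" "k > 0"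
  shows "bij_betw (\<lambda>(i, d). p ^ i * d) ({..j} \<times> {d. d dvd k}) {d. d dvd p ^ j * k}"
proof (rule bij_betw_imageI)
  have nd: "\<not> p dvd d" if "d dvd k" for d using that assms(2) dvd_trans by blast
  have mult: "multiplicity p (p ^ i * d) = i" if "d dvd k" for i d
    using nd[OF that] assms(1) that assms(3)
    by (metis multiplicity_prime_elem_times_other not_dvd_imp_multiplicity_0 prime_imp_prime_elem
        multiplicity_times_same add.right_neutral multiplicity_same_power dvd_0_right
        prime_elem_multiplicity_mult_distrib not_prime_0 power_not_zero prime_gt_0_nat
        less_numeral_extra(3) not_prime_unit)
  show "inj_on (\<lambda>(i, d). p ^ i * d) ({..j} \<times> {d. d dvd k})"
  proof (rule inj_onI, clarsimp)
    fix i d i' d' assume *: "d dvd k" "d' dvd k" "p ^ i * d = p ^ i' * d'"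
    have "i = i'" using mult[OF *(1), of i] mult[OF *(2), of i'] *(3) by simp
    thus "i = i' \<and> d = d'" using * assms(1) by auto
  qed
  show "(\<lambda>(i, d). p ^ i * d) ` ({..j} \<times> {d. d dvd k}) = {d. d dvd p ^ j * k}"
  proof (intro equalityI subsetI)
    fix x assume "x \<in> {d. d dvd p ^ j * k}"
    then obtain a b where "x = a * b" "a dvd p ^ j" "b dvd k"
      using division_decomp[of x "p ^ j" k] by blast
    moreover then obtain i where "i \<le> j" "a = p ^ i" using divides_primepow_nat[OF assms(1)] by blast
    ultimately show "x \<in> (\<lambda>(i, d). p ^ i * d) ` ({..j} \<times> {d. d dvd k})" by auto
  qed (auto intro: mult_dvd_mono le_imp_power_dvd)
qed

lemma divisor_sum_prime_power_mult:
  assumes "sign_multiplicative \<psi>" "prime p" "\<not> p dvd k" "k > 0"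
  shows "(\<Sum>d | d dvd p ^ j * k. \<psi> d) = (\<Sum>i\<le>j. \<psi> p ^ i) * (\<Sum>d | d dvd k. \<psi> d)"
proof -
  have mult: "\<psi> (a * b) = \<psi> a * \<psi> b" for a b using assms(1) by (simp add: sign_multiplicative_def)
  have "(\<Sum>d | d dvd p ^ j * k. \<psi> d) = (\<Sum>(i, d)\<in>{..j} \<times> {d. d dvd k}. \<psi> (p ^ i * d))"
    using sum.reindex_bij_betw[OF divisors_prime_power_mult[OF assms(2-4), of j], of \<psi>]
    by (simp add: case_prod_unfold)
  also have "\<dots> = (\<Sum>i\<le>j. \<psi> p ^ i) * (\<Sum>d | d dvd k. \<psi> d)"
    by (simp add: mult sign_multiplicative_power[OF assms(1)] sum_product sum.cartesian_product)
  finally show ?thesis .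
qed

lemma sign_power_sum:
  fixes c :: real
  assumes "c \<in> {-1, 0, 1}"
  shows "(\<Sum>i\<le>j. c ^ i) \<ge> (if even j then 1 else 0)"
proof -
  consider "c = -1" | "c = 0" | "c = 1" using assms by auto
  thus ?thesis
  proof cases
    case 1
    have "(\<Sum>i\<le>j. (-1) ^ i) = (if even j then 1 else 0 :: real)" by (induction j) auto
    thus ?thesis using 1 by simp
  next
    case 2
    have "(\<Sum>i\<le>j. 0 ^ i) = (1 :: real)" by (induction j) auto
    thus ?thesis using 2 by simp
  qed auto
qed

lemma prime_power_decomposition:
  fixes n :: nat
  assumes "n > 1"
  obtains p j k where "prime p" "n = p ^ j * k" "\<not> p dvd k" "j > 0" "0 < k" "k < n"
proof -
  obtain p where p: "prime p" "p dvd n" using assms prime_factor_nat[of n] by auto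
  have nu: "\<not> is_unit p" using p(1) by (meson not_prime_unit)
  obtain k where k: "n = p ^ multiplicity p n * k" "\<not> p dvd k"
    using multiplicity_decompose'[of n p] assms nu by auto
  have j: "multiplicity p n > 0" using p assms nu by (simp add: multiplicity_gt_zero_iff)
  have "k > 0" using k assms by (cases k) auto
  moreover have "1 < p ^ multiplicity p n" by (rule one_less_power[OF prime_gt_1_nat[OF p(1)] j])
  hence "k < n" using k(1) \<open>k > 0\<close> n_less_n_mult_m[of k "p ^ multiplicity p n"] by (simp add: mult.commute)
  ultimately show ?thesis using that p(1) k j by blast
qed

text \<open>
  The divisor sum is multiplicative, and on a prime power it is a partial sum of powers of \<open>-1\<close>, \<open>0\<close> or \<open>1\<close>.
  For a square the exponents are even, whence the bound in the next lemma.
\<close>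

lemma divisor_sum_nonneg:
  assumes "sign_multiplicative \<psi>" "n > 0"
  shows "(\<Sum>d | d dvd n. \<psi> d) \<ge> 0"
  using assms(2)
proof (induction n rule: less_induct)
  case (less n)
  show ?case
  proof (cases "n = 1")
    case True
    thus ?thesis using assms(1) by (simp add: sign_multiplicative_def)
  next
    case False
    then obtain p j k where *: "prime p" "n = p ^ j * k" "\<not> p dvd k" "0 < k" "k < n"
      using prime_power_decomposition[of n] less.prems by (metis One_nat_def Suc_lessI)
    have "(\<Sum>i\<le>j. \<psi> p ^ i) \<ge> 0"
      using sign_power_sum[of "\<psi> p" j] assms(1) by (auto simp: sign_multiplicative_def split: if_splits)
    thus ?thesis using less.IH[of k] * divisor_sum_prime_power_mult[OF assms(1) *(1,3,4)] by simp
  qed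
qed

lemma divisor_sum_square_ge_1:
  assumes "sign_multiplicative \<psi>" "n > 0"
  shows "(\<Sum>d | d dvd n\<^sup>2. \<psi> d) \<ge> 1"
  using assms(2)
proof (induction n rule: less_induct)
  case (less n)
  show ?case
  proof (cases "n = 1")
    case True
    thus ?thesis using assms(1) by (simp add: sign_multiplicative_def)
  next
    case False
    then obtain p j k where *: "prime p" "n = p ^ j * k" "\<not> p dvd k" "0 < k" "k < n"
      using prime_power_decomposition[of n] less.prems by (metis One_nat_def Suc_lessI)
    have "(\<Sum>i\<le>2 * j. \<psi> p ^ i) \<ge> 1"
      using sign_power_sum[of "\<psi> p" "2 * j"] assms(1) by (auto simp: sign_multiplicative_def)
    moreover have "(\<Sum>d | d dvd k\<^sup>2. \<psi> d) \<ge> 1" using less.IH * by simp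
    moreover have "n\<^sup>2 = p ^ (2 * j) * k\<^sup>2" using *(2) by (simp add: power_mult_distrib power_mult mult.commute)
    moreover have "\<not> p dvd k\<^sup>2" using *(1,3) prime_dvd_power by blast
    ultimately show ?thesis
      using divisor_sum_prime_power_mult[OF assms(1) *(1), of "k\<^sup>2" "2 * j"] *(4)
        mult_mono[of 1 "(\<Sum>i\<le>2 * j. \<psi> p ^ i)" 1 "(\<Sum>d | d dvd k\<^sup>2. \<psi> d)"] by simp
  qed
qed

text \<open>
  The arithmetic-geometric mean inequality for opposite terms. The base is written as a square in order to
  avoid half-integral exponents.
\<close>

lemma geometric_sum_even_ge:
  fixes u :: real
  assumes "0 \<le> u"
  shows "(\<Sum>i<n. (u\<^sup>2) ^ i) \<ge> real n * u ^ (n - 1)"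
proof -
  have "(\<Sum>i<n. (u\<^sup>2) ^ i) = (\<Sum>i<n. (u\<^sup>2) ^ (n - Suc i))"
    by (rule sum.nat_diff_reindex[symmetric])
  hence "2 * (\<Sum>i<n. (u\<^sup>2) ^ i) = (\<Sum>i<n. (u\<^sup>2) ^ i + (u\<^sup>2) ^ (n - Suc i))"
    by (simp add: sum.distrib)
  also have "\<dots> \<ge> (\<Sum>i<n. 2 * u ^ (n - 1))"
  proof (rule sum_mono)
    fix i assume "i \<in> {..<n}"
    hence i: "n - 1 = i + (n - Suc i)" by auto
    have "2 * (u ^ i * u ^ (n - Suc i)) \<le> (u ^ i)\<^sup>2 + (u ^ (n - Suc i))\<^sup>2"
      using sum_squares_bound[of "u ^ i" "u ^ (n - Suc i)"] by simp
    thus "2 * u ^ (n - 1) \<le> (u\<^sup>2) ^ i + (u\<^sup>2) ^ (n - Suc i)"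
      unfolding i power_add by (simp add: power_mult[symmetric] mult.commute)
  qed
  finally show ?thesis by simp
qed

text \<open>
  With \<open>G\<^sub>n = 1 + t + \<dots> + t\<^sup>n\<^sup>-\<^sup>1\<close> the term is, up to the factor \<open>1 - t\<close>, equal to \<open>1/n - t\<^sup>n / G\<^sub>n\<close>. As
  \<open>G\<^sub>n\<^sub>+\<^sub>1 - t G\<^sub>n = 1\<close>, monotonicity amounts to \<open>n (n + 1) t\<^sup>n \<le> G\<^sub>n G\<^sub>n\<^sub>+\<^sub>1\<close>.
\<close>

lemma monsky_term_decreasing:
  fixes t :: real
  assumes t: "0 < t" "t < 1" and n: "n \<ge> 1"
  defines "b \<equiv> \<lambda>n::nat. 1 / (real n * (1 - t)) - t ^ n / (1 - t ^ n)"
  shows "b (Suc n) \<le> b n" and "b n \<ge> 0"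
proof -
  define G where "G = (\<lambda>n. \<Sum>i<n. t ^ i)"
  define u where "u = sqrt t"
  have u: "u\<^sup>2 = t" "0 \<le> u" "u < 1" using t by (auto simp: u_def)
  have G: "1 - t ^ n = (1 - t) * G n" for n unfolding G_def by (rule one_diff_power_eq)
  have Gpos: "G n > 0" if "n \<ge> 1" for n
  proof -
    have "(1 - t) * G n > 0" unfolding G[symmetric] using t that power_strict_decreasing[of 0 n t] by simp
    thus ?thesis using t by (simp add: zero_less_mult_iff)
  qed
  have b: "(1 - t) * b n = 1 / real n - t ^ n / G n" if "n \<ge> 1" for n
    
  proof -
    have "(1 - t) * b n = (1 - t) * (1 / (real n * (1 - t))) - (1 - t) * (t ^ n / ((1 - t) * G n))"
      unfolding b_def G by (rule right_diff_distrib)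
    thus ?thesis using t by simp
  qed
  have Gs: "G (Suc n) = t * G n + 1"
    unfolding G_def by (subst sum.lessThan_Suc_shift) (simp add: sum_distrib_left)
  have G1: "real n * u ^ (n - 1) \<le> G n" using geometric_sum_even_ge[OF u(2), of n] u(1) by (simp add: G_def)
  have G2: "real (Suc n) * u ^ n \<le> G (Suc n)" using geometric_sum_even_ge[OF u(2), of "Suc n"] u(1) by (simp add: G_def)
  have "real n * real (Suc n) * t ^ n = real n * real (Suc n) * u ^ (2 * n)"
    using u(1) by (simp add: power_mult)
  also have "\<dots> \<le> real n * real (Suc n) * u ^ ((n - 1) + n)"
    by (intro mult_left_mono power_decreasing) (use u in auto)
  also have "\<dots> = (real n * u ^ (n - 1)) * (real (Suc n) * u ^ n)" by (simp add: power_add)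
  also have "\<dots> \<le> G n * G (Suc n)" using G1 G2 u(2) Gpos[OF n] by (intro mult_mono) auto
  finally have key: "real n * real (Suc n) * t ^ n \<le> G n * G (Suc n)" .
  have "(1 - t) * b (Suc n) \<le> (1 - t) * b n"
  proof -
    have g: "G n > 0" "G (Suc n) > 0" using Gpos n by auto
    have "t ^ n / G n - t ^ Suc n / G (Suc n) = t ^ n * (G (Suc n) - t * G n) / (G n * G (Suc n))"
      using g by (simp add: field_simps)
    also have "\<dots> = t ^ n / (G n * G (Suc n))" by (simp add: Gs)
    also have "\<dots> \<le> 1 / (real n * real (Suc n))"
    proof -
      have "x / y \<le> 1 / z" if "z * x \<le> y" "0 < y" "0 < z" for x y z :: real
        using that by (simp add: field_simps)
      from this[OF key] show ?thesis using g n by simp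
    qed
    also have "\<dots> = 1 / real n - 1 / real (Suc n)" using n by (simp add: field_simps)
    finally show ?thesis using b[of n] b[of "Suc n"] n by simp
  qed
  thus "b (Suc n) \<le> b n" using t by simp
  have "real n * t ^ n \<le> G n"
  proof -
    have "(\<Sum>i<n. t ^ n) \<le> G n" unfolding G_def
      by (intro sum_mono power_decreasing) (use t in auto)
    thus ?thesis by simp
  qed
  hence "t ^ n / G n \<le> 1 / real n" using Gpos[OF n] n by (simp add: field_simps)
  hence "(1 - t) * b n \<ge> 0" using b[OF n] by simp
  thus "b n \<ge> 0" using t by (simp add: zero_le_mult_iff)
qed

lemma lambert_series_has_sum:
  fixes t :: real
  assumes \<psi>: "sign_multiplicative \<psi>" and t: "0 < t" "t < 1"
  shows "((\<lambda>n. \<Sum>d | d dvd n. \<psi> d * t ^ n) has_sum (\<Sum>n. \<psi> n * (t ^ n / (1 - t ^ n)))) {1..}"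
    and "summable (\<lambda>n. \<psi> n * (t ^ n / (1 - t ^ n)))"
proof -
  have inner: "((\<lambda>k. t ^ (d * k)) has_sum (t ^ d / (1 - t ^ d))) {1..}" if "d \<ge> 1" for d
  proof -
    have td: "0 \<le> t ^ d" "t ^ d < 1" using t that power_strict_decreasing[of 0 d t] by auto
    have "(\<lambda>k. (t ^ d) ^ Suc k) sums (t ^ d / (1 - t ^ d))"
      using sums_mult[OF geometric_sums[of "t ^ d"], of "t ^ d"] td by simp
    hence "(\<lambda>k. if k = 0 then 0 else (t ^ d) ^ k) sums (t ^ d / (1 - t ^ d))"
      using sums_Suc_iff[of "\<lambda>k. if k = 0 then 0 else (t ^ d) ^ k" "t ^ d / (1 - t ^ d)"] by simp
    moreover have "summable (\<lambda>k. \<bar>if k = 0 then 0 else (t ^ d) ^ k\<bar>)"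
      by (rule summable_comparison_test'[OF summable_geometric[of "t ^ d"], of 0]) (use td in auto)
    ultimately have "((\<lambda>k. if k = 0 then 0 else (t ^ d) ^ k) has_sum (t ^ d / (1 - t ^ d))) {1..}"
      using has_sum_pos_of_abs_summable[of "\<lambda>k. if k = 0 then 0 else (t ^ d) ^ k"] by (simp add: sums_iff)
    thus ?thesis
      by (subst has_sum_cong[where g = "\<lambda>k. if k = 0 then 0 else (t ^ d) ^ k"]) (auto simp: power_mult)
  qed
  have ub: "t ^ d / (1 - t ^ d) \<le> t ^ d / (1 - t)" if "d \<ge> 1" for d
    using t that power_decreasing[of 1 d t] by (intro divide_left_mono) (auto simp: mult_pos_pos power_less_one_iff)
  have sm0: "summable (\<lambda>d. t ^ d / (1 - t))"
    using summable_divide[OF summable_geometric[of t], of "1 - t"] t by simp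
  have sm: "summable (\<lambda>d. \<bar>if d = 0 then 0 else t ^ d / (1 - t ^ d)\<bar>)"
    by (rule summable_comparison_test'[OF sm0, of 0]) (use t ub in \<open>auto simp: power_le_one\<close>)
  have hs: "(\<lambda>d. t ^ d / (1 - t ^ d)) summable_on {1..}"
    using has_sum_imp_summable[OF has_sum_pos_of_abs_summable[OF sm]]
    by (subst summable_on_cong[where g = "\<lambda>d. if d = 0 then 0 else t ^ d / (1 - t ^ d)"]) auto
  have "(\<lambda>(d, k). t ^ (d * k)) summable_on ({1..} \<times> {1..})"
    by (rule summable_on_SigmaI[where g = "\<lambda>d. t ^ d / (1 - t ^ d)"]) (use inner hs t in auto)
  hence "(\<lambda>x. norm ((\<lambda>(d, k). \<psi> d * t ^ (d * k)) x)) summable_on ({1..} \<times> {1..})"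
    by (rule summable_on_comparison_test)
       (use sign_multiplicative_abs_le_1[OF \<psi>] t in \<open>auto simp: abs_mult intro!: mult_left_le_one_le\<close>)
  hence S: "(\<lambda>(d, k). \<psi> d * t ^ (d * k)) summable_on ({1..} \<times> {1..})"
    by (rule abs_summable_summable)
  have sm': "summable (\<lambda>d. \<bar>\<psi> d * (t ^ d / (1 - t ^ d))\<bar>)"
  proof (rule summable_comparison_test'[OF sm, of 1])
    fix d :: nat assume "d \<ge> 1"
    moreover have "\<bar>\<psi> d * (t ^ d / (1 - t ^ d))\<bar> \<le> 1 * \<bar>t ^ d / (1 - t ^ d)\<bar>"
      unfolding abs_mult by (rule mult_right_mono[OF sign_multiplicative_abs_le_1[OF \<psi>]]) simp
    ultimately show "norm \<bar>\<psi> d * (t ^ d / (1 - t ^ d))\<bar> \<le> \<bar>if d = 0 then 0 else t ^ d / (1 - t ^ d)\<bar>"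
      by simp
  qed
  show "summable (\<lambda>n. \<psi> n * (t ^ n / (1 - t ^ n)))" using sm' by (rule summable_rabs_cancel)
  have "((\<lambda>(d, k). \<psi> d * t ^ (d * k)) has_sum (\<Sum>n. \<psi> n * (t ^ n / (1 - t ^ n)))) ({1..} \<times> {1..})"
    using S
  proof (rule has_sum_SigmaI[rotated 2])
    show "((\<lambda>n. \<psi> n * (t ^ n / (1 - t ^ n))) has_sum (\<Sum>n. \<psi> n * (t ^ n / (1 - t ^ n)))) {1..}"
      by (rule has_sum_pos_of_abs_summable[OF sm']) simp
  qed (use has_sum_cmult_right[OF inner] in auto)
  hence "((\<lambda>n. \<Sum>d | d dvd n. \<psi> d * t ^ (d * (n div d))) has_sum (\<Sum>n. \<psi> n * (t ^ n / (1 - t ^ n)))) {1..}"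
    by (rule has_sum_regroup_divisors)
  thus "((\<lambda>n. \<Sum>d | d dvd n. \<psi> d * t ^ n) has_sum (\<Sum>n. \<psi> n * (t ^ n / (1 - t ^ n)))) {1..}"
    by (subst has_sum_cong[where g = "\<lambda>n. \<Sum>d | d dvd n. \<psi> d * t ^ (d * (n div d))"]) auto
qed

text \<open>
  Monsky's argument. If the value were \<open>0\<close>, subtracting the vanishing series \<open>\<Sum> \<psi>(n) / (n (1 - t))\<close> from the
  Lambert series \<open>f(t) = \<Sum> \<psi>(n) t\<^sup>n / (1 - t\<^sup>n)\<close> would leave a sum over decreasing terms, so that \<open>f\<close> is
  bounded by \<open>2 m\<close> on the unit interval. But \<open>f(t) = \<Sum> r(n) t\<^sup>n\<close> with divisor sums \<open>r(n) \<ge> 0\<close> which are at least \<open>1\<close> on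
  squares, so that \<open>f\<close> tends to infinity at \<open>1\<close>.
\<close>

theorem quadratic_character_L1_nonzero:
  assumes \<psi>: "quadratic_character \<psi> m"
  shows "(\<Sum>n. \<psi> n * (1 / real n)) \<noteq> 0"
proof
  assume L0: "(\<Sum>n. \<psi> n * (1 / real n)) = 0"
  have sm\<psi>: "sign_multiplicative \<psi>" using \<psi> by (simp add: quadratic_character_def)
  define K where "K = 2 * m + 1"
  have K: "K > 0" by (simp add: K_def)
  \<comment> \<open>by Bernoulli's inequality \<open>t\<close> is so close to \<open>1\<close> that the first \<open>K\<close> squares contribute more than \<open>K - 1 = 2 m\<close>\<close>
  define t :: real where "t = 1 - 1 / (real (K + 1) * real (K\<^sup>2))"
  have "1 < real (K + 1) * real (K\<^sup>2)"
  proof -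
    have "1 < (K + 1) * K\<^sup>2" using K mult_le_mono[of 2 "K + 1" 1 "K\<^sup>2"] by simp
    thus ?thesis by (metis of_nat_1 of_nat_less_iff of_nat_mult)
  qed
  hence t: "0 < t" "t < 1" by (auto simp: t_def)
  define f where "f = (\<Sum>n. \<psi> n * (t ^ n / (1 - t ^ n)))"
  define b where "b = (\<lambda>n::nat. 1 / (real n * (1 - t)) - t ^ n / (1 - t ^ n))"
  have smL: "summable (\<lambda>n. \<psi> n * (1 / (real n * (1 - t))))"
    using summable_divide[OF character_series_at_one_summable[OF \<psi>], of "1 - t"] by simp
  have sumL: "(\<Sum>n. \<psi> n * (1 / (real n * (1 - t)))) = 0"
    using suminf_divide[OF character_series_at_one_summable[OF \<psi>], of "1 - t"] L0 by simp
  note smf = lambert_series_has_sum(2)[OF sm\<psi> t]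
  have smb: "summable (\<lambda>n. \<psi> n * b n)"
    using summable_diff[OF smL smf] by (simp add: b_def right_diff_distrib)
  have "(\<Sum>n. \<psi> n * b n) = - f"
    using suminf_diff[OF smL smf] sumL by (simp add: b_def right_diff_distrib f_def)
  moreover have "\<bar>(\<Sum>n. \<psi> n * b n) - (\<Sum>n<1. \<psi> n * b n)\<bar> \<le> 2 * real m * b 1"
    by (rule character_series_tail[OF \<psi> smb]) (use monsky_term_decreasing[OF t] in \<open>auto simp: b_def\<close>)
  moreover have "b 1 = 1" using t by (simp add: b_def field_simps)
  moreover have "b 0 = 0" by (simp add: b_def)
  ultimately have f_ub: "f \<le> 2 * real m" by simp
  have "(\<Sum>n\<in>(\<lambda>k. k\<^sup>2) ` {1..K}. \<Sum>d | d dvd n. \<psi> d * t ^ n) \<le> f"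
    unfolding f_def
  proof (rule finite_sum_le_has_sum[OF lambert_series_has_sum(1)[OF sm\<psi> t]])
    fix n :: nat assume "n \<in> {1..} - (\<lambda>k. k\<^sup>2) ` {1..K}"
    hence "n > 0" by auto
    thus "0 \<le> (\<Sum>d | d dvd n. \<psi> d * t ^ n)"
      using divisor_sum_nonneg[OF sm\<psi>, of n] t by (simp add: sum_distrib_right[symmetric])
  qed auto
  also have "(\<Sum>n\<in>(\<lambda>k. k\<^sup>2) ` {1..K}. \<Sum>d | d dvd n. \<psi> d * t ^ n)
      = (\<Sum>k\<in>{1..K}. \<Sum>d | d dvd k\<^sup>2. \<psi> d * t ^ (k\<^sup>2))"
    by (subst sum.reindex) (auto simp: inj_on_def power2_eq_iff_nonneg)
  finally have "(\<Sum>k\<in>{1..K}. \<Sum>d | d dvd k\<^sup>2. \<psi> d * t ^ (k\<^sup>2)) \<le> f" .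
  moreover have "(\<Sum>k\<in>{1..K}. t ^ (K\<^sup>2)) \<le> (\<Sum>k\<in>{1..K}. \<Sum>d | d dvd k\<^sup>2. \<psi> d * t ^ (k\<^sup>2))"
  proof (rule sum_mono)
    fix k assume k: "k \<in> {1..K}"
    have "t ^ (K\<^sup>2) \<le> t ^ (k\<^sup>2)" using k t by (intro power_decreasing power_mono) auto
    also have "\<dots> \<le> (\<Sum>d | d dvd k\<^sup>2. \<psi> d) * t ^ (k\<^sup>2)"
      using divisor_sum_square_ge_1[OF sm\<psi>, of k] k t by simp
    finally show "t ^ (K\<^sup>2) \<le> (\<Sum>d | d dvd k\<^sup>2. \<psi> d * t ^ (k\<^sup>2))" by (simp add: sum_distrib_right)
  qed
  ultimately have "real K * t ^ (K\<^sup>2) \<le> 2 * real m" using f_ub by simp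
  moreover have "t ^ (K\<^sup>2) \<ge> 1 - 1 / real (K + 1)"
  proof -
    have "1 + real (K\<^sup>2) * (- (1 / (real (K + 1) * real (K\<^sup>2)))) \<le> (1 + (- (1 / (real (K + 1) * real (K\<^sup>2))))) ^ (K\<^sup>2)"
      by (rule Bernoulli_inequality) (use t in \<open>simp add: t_def\<close>)
    moreover have "e * (- (1 / (c * e))) = - (1 / c)" if "e \<noteq> 0" for c e :: real using that by simp
    from this[of "real (K\<^sup>2)" "real (K + 1)"]
    have "real (K\<^sup>2) * (- (1 / (real (K + 1) * real (K\<^sup>2)))) = - (1 / real (K + 1))"
      using K by simp
    ultimately show ?thesis by (simp add: t_def)
  qed
  hence "real K * (1 - 1 / real (K + 1)) \<le> real K * t ^ (K\<^sup>2)" by (intro mult_left_mono) auto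
  moreover have "real K * (1 - 1 / real (K + 1)) > 2 * real m"
    by (simp add: K_def field_simps)
  ultimately show False by linarith
qed

section \<open>Logarithmic derivatives near 1\<close>

lemma summable_ln_powr:
  fixes s :: real
  assumes s: "s > 1"
  shows "summable (\<lambda>n. ln (real n) * real n powr (-s))"
proof -
  define e where "e = (s - 1) / 2"
  have e: "e > 0" using s by (simp add: e_def)
  have "summable (\<lambda>n. real n powr (-(1 + e)))" using e by (subst summable_real_powr_iff) simp
  hence "summable (\<lambda>n. (1 / e) * real n powr (-(1 + e)))" by (rule summable_mult)
  thus ?thesis
  proof (rule summable_comparison_test'[where N = 1])
    fix n :: nat assume n: "n \<ge> 1"
    have "ln (real n) * real n powr (-s) \<le> (real n powr e / e) * real n powr (-s)"
      using ln_powr_bound[of "real n" e] e n by (intro mult_right_mono) auto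
    also have "\<dots> = (1 / e) * (real n powr e * real n powr (-s))" by simp
    also have "real n powr e * real n powr (-s) = real n powr (e + (-s))"
      by (rule powr_add[symmetric])
    also have "e + (-s) = -(1 + e)" by (simp add: e_def field_simps)
    finally show "norm (ln (real n) * real n powr (-s)) \<le> (1 / e) * real n powr (-(1 + e))"
      using n by simp
  qed
qed

lemma mangoldt_le_ln: "n > 0 \<Longrightarrow> mangoldt n \<le> ln (real n)"
proof -
  assume n: "n > 0"
  have "mangoldt n \<le> (\<Sum>d | d dvd n. mangoldt d :: real)"
    using n by (intro member_le_sum) (auto simp: mangoldt_nonneg)
  thus ?thesis using mangoldt_sum[of n, where 'a = real] n by simp
qed

lemma summable_mangoldt_powr:
  fixes s :: real
  assumes "s > 1"
  shows "summable (\<lambda>n. mangoldt n * real n powr (-s))"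
proof (rule summable_comparison_test'[OF summable_ln_powr[OF assms], of 1])
  fix n :: nat assume "n \<ge> 1"
  thus "norm (mangoldt n * real n powr (-s)) \<le> ln (real n) * real n powr (-s)"
    using mangoldt_le_ln[of n] mangoldt_nonneg[of n] by (auto simp: abs_mult intro!: mult_right_mono)
qed

lemma summable_sign_times:
  assumes \<psi>: "sign_multiplicative \<psi>" and sm: "summable f" and nn: "\<And>n. (0::real) \<le> f n"
  shows "summable (\<lambda>n. \<bar>\<psi> n * f n\<bar>)" and "summable (\<lambda>n. \<psi> n * f n)"
proof -
  show *: "summable (\<lambda>n. \<bar>\<psi> n * f n\<bar>)"
  proof (rule summable_comparison_test'[OF sm, of 0])
    fix n :: nat
    have "\<bar>\<psi> n\<bar> * \<bar>f n\<bar> \<le> 1 * \<bar>f n\<bar>"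
      by (rule mult_right_mono[OF sign_multiplicative_abs_le_1[OF \<psi>]]) simp
    thus "norm \<bar>\<psi> n * f n\<bar> \<le> f n" using nn[of n] by (simp add: abs_mult)
  qed
  show "summable (\<lambda>n. \<psi> n * f n)" using * by (rule summable_rabs_cancel)
qed

text \<open>
  The identity \<open>L' = L \<cdot> L'/L\<close> in terms of coefficients: the values of the von Mangoldt function at the
  divisors of \<open>n\<close> sum up to \<open>ln n\<close>.
\<close>

lemma character_log_derivative_identity:
  fixes s :: real
  assumes \<psi>: "sign_multiplicative \<psi>" and s: "s > 1"
  shows "(\<Sum>n. \<psi> n * (mangoldt n * real n powr (-s))) * (\<Sum>n. \<psi> n * real n powr (-s))
       = (\<Sum>n. \<psi> n * (ln (real n) * real n powr (-s)))"
proof -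
  have smz: "summable (\<lambda>n. real n powr (-s))" using s by (subst summable_real_powr_iff) simp
  have "(\<lambda>n. \<Sum>d | d dvd n. \<psi> d * (mangoldt d * real d powr (-s)) * (\<psi> (n div d) * real (n div d) powr (-s)))
      sums ((\<Sum>n. \<psi> n * (mangoldt n * real n powr (-s))) * (\<Sum>n. \<psi> n * real n powr (-s)))"
    by (rule dirichlet_convolution_sums)
       (use summable_sign_times(1)[OF \<psi> summable_mangoldt_powr[OF s]] summable_sign_times(1)[OF \<psi> smz]
         in \<open>auto simp: mangoldt_nonneg\<close>)
  moreover have "(\<Sum>d | d dvd n. \<psi> d * (mangoldt d * real d powr (-s)) * (\<psi> (n div d) * real (n div d) powr (-s)))
      = \<psi> n * (ln (real n) * real n powr (-s))" for n
  proof (cases "n = 0")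
    case False
    have "(\<Sum>d | d dvd n. \<psi> d * (mangoldt d * real d powr (-s)) * (\<psi> (n div d) * real (n div d) powr (-s)))
        = (\<Sum>d | d dvd n. \<psi> n * real n powr (-s) * mangoldt d)"
    proof (rule sum.cong[OF refl])
      fix d assume "d \<in> {d. d dvd n}"
      then obtain k where k: "n = d * k" by (auto elim: dvdE)
      hence d: "d > 0" "k > 0" using False by auto
      have "\<psi> n = \<psi> d * \<psi> k" using \<psi> k by (simp add: sign_multiplicative_def)
      moreover have "real n powr (-s) = real d powr (-s) * real k powr (-s)"
        using d by (simp add: k powr_mult)
      moreover have "n div d = k" using k d by simp
      ultimately show "\<psi> d * (mangoldt d * real d powr (-s)) * (\<psi> (n div d) * real (n div d) powr (-s))
          = \<psi> n * real n powr (-s) * mangoldt d" by simp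
    qed
    also have "\<dots> = \<psi> n * real n powr (-s) * ln (real n)"
      using mangoldt_sum[of n, where 'a = real] False by (simp add: sum_distrib_left[symmetric])
    finally show ?thesis by (simp add: mult_ac)
  qed auto
  ultimately show ?thesis by (simp add: sums_iff)
qed

lemma ln_powr_decreasing:
  fixes s :: real
  assumes "s \<ge> 1" "n \<ge> 3"
  shows "ln (real (Suc n)) * real (Suc n) powr (-s) \<le> ln (real n) * real n powr (-s)"
proof -
  have split: "ln x * x powr (-s) = (ln x / x) * x powr (-(s - 1))" if "x > 0" for x :: real
  proof -
    have "x powr (-s) = x powr ((-1) + (-(s - 1)))" by simp
    also have "\<dots> = x powr (-1) * x powr (-(s - 1))" by (rule powr_add)
    also have "x powr (-1) = 1 / x" using that by (simp add: powr_minus_divide)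
    finally show ?thesis by simp
  qed
  have "exp 1 \<le> real n" using exp_le assms(2) by simp
  hence "ln (real (Suc n)) / real (Suc n) \<le> ln (real n) / real n" by (intro ln_x_over_x_mono) auto
  moreover have "real (Suc n) powr (-(s - 1)) \<le> real n powr (-(s - 1))"
    using assms by (intro powr_mono2') auto
  ultimately have "(ln (real (Suc n)) / real (Suc n)) * real (Suc n) powr (-(s - 1))
      \<le> (ln (real n) / real n) * real n powr (-(s - 1))"
    using assms by (intro mult_mono) auto
  thus ?thesis using split[of "real (Suc n)"] split[of "real n"] assms by simp
qed

lemma tendsto_nat_powr_at_1: "((\<lambda>s. real n powr (-s)) \<longlongrightarrow> real n powr (-1)) (at_right 1)"
proof (cases "n = 0")
  case False
  show ?thesis by (rule tendsto_powr) (use False in \<open>auto intro!: tendsto_intros\<close>)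
qed simp

text \<open>
  This is where the value at \<open>1\<close> enters: the series \<open>L(s)\<close> stays away from \<open>0\<close> near \<open>1\<close>, the
  derivative is bounded there, and the sum in question is their quotient.
\<close>

lemma character_log_derivative_bounded:
  assumes \<psi>: "quadratic_character \<psi> m"
  shows "\<exists>C. \<forall>\<^sub>F s in at_right 1. \<bar>\<Sum>n. \<psi> n * (mangoldt n * real n powr (-s))\<bar> \<le> C"
proof -
  have sm\<psi>: "sign_multiplicative \<psi>" and m: "m > 0" using \<psi> by (auto simp: quadratic_character_def)
  define L where "L = (\<Sum>n. \<psi> n * (1 / real n))"
  \<comment> \<open>three errors of size \<open>e\<close> separate \<open>L(s)\<close> from \<open>L = L(1)\<close>, so that \<open>L(s)\<close> keeps absolute value at least \<open>e\<close>\<close>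
  define e where "e = \<bar>L\<bar> / 4"
  have e: "e > 0" using quadratic_character_L1_nonzero[OF \<psi>] by (simp add: e_def L_def)
  obtain N where N: "2 * real m / e < real N" using reals_Archimedean2 by blast
  have N0: "N > 0" using N e m by (cases N) (auto simp: field_simps)
  have tail: "2 * real m * (1 / real N) < e" using N e N0 by (simp add: field_simps)
  have "((\<lambda>s. \<Sum>n<N. \<psi> n * real n powr (-s)) \<longlongrightarrow> (\<Sum>n<N. \<psi> n * real n powr (-1))) (at_right 1)"
    by (intro tendsto_sum tendsto_mult tendsto_const tendsto_nat_powr_at_1)
  hence ev: "\<forall>\<^sub>F s in at_right 1. dist (\<Sum>n<N. \<psi> n * real n powr (-s)) (\<Sum>n<N. \<psi> n * real n powr (-1)) < e"
    using e by (rule tendstoD)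
  have gt: "\<forall>\<^sub>F s in at_right (1::real). s > 1" by (auto simp: eventually_at_right_less)
  define D where "D = \<bar>\<psi> 2\<bar> * ln 2 + 2 * real m * ln 3"
  have "\<forall>\<^sub>F s in at_right 1. \<bar>\<Sum>n. \<psi> n * (mangoldt n * real n powr (-s))\<bar> \<le> D / e"
    using ev gt
  proof eventually_elim
    case (elim s)
    hence s: "s > 1" by simp
    have smz: "summable (\<lambda>n. real n powr (-s))" using s by (subst summable_real_powr_iff) simp
    have "\<bar>(\<Sum>n. \<psi> n * real n powr (-s)) - (\<Sum>n<N. \<psi> n * real n powr (-s))\<bar> \<le> 2 * real m * real N powr (-s)"
      by (rule character_series_tail[OF \<psi> summable_sign_times(2)[OF sm\<psi> smz]])
         (use s N0 in \<open>auto intro!: powr_mono2'\<close>)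
    also have "\<dots> \<le> 2 * real m * (1 / real N)"
    proof (intro mult_left_mono)
      have "real N powr (-s) \<le> real N powr (-1)" using s N0 by (intro powr_mono) auto
      thus "real N powr (-s) \<le> 1 / real N" using N0 by (simp add: powr_minus_divide)
    qed auto
    finally have 1: "\<bar>(\<Sum>n. \<psi> n * real n powr (-s)) - (\<Sum>n<N. \<psi> n * real n powr (-s))\<bar> < e" using tail by simp
    have "\<bar>L - (\<Sum>n<N. \<psi> n * (1 / real n))\<bar> \<le> 2 * real m * (1 / real N)"
      unfolding L_def by (rule character_series_tail[OF \<psi> character_series_at_one_summable[OF \<psi>]])
         (use N0 in \<open>auto simp: field_simps\<close>)
    hence 2: "\<bar>L - (\<Sum>n<N. \<psi> n * (1 / real n))\<bar> < e" using tail by simp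
    have "(\<Sum>n<N. \<psi> n * real n powr (-1)) = (\<Sum>n<N. \<psi> n * (1 / real n))"
      by (intro sum.cong refl) (simp add: powr_minus_divide)
    hence 3: "\<bar>(\<Sum>n<N. \<psi> n * real n powr (-s)) - (\<Sum>n<N. \<psi> n * (1 / real n))\<bar> < e"
      using elim(1) by (simp add: dist_real_def)
    have Ls: "\<bar>\<Sum>n. \<psi> n * real n powr (-s)\<bar> \<ge> e"
      using 1 2 3 unfolding e_def by linarith
    \<comment> \<open>the terms \<open>ln n / n\<^sup>s\<close> decrease from \<open>n = 3 > e\<close> on\<close>
    have "\<bar>(\<Sum>n. \<psi> n * (ln (real n) * real n powr (-s))) - (\<Sum>n<3. \<psi> n * (ln (real n) * real n powr (-s)))\<bar>
        \<le> 2 * real m * (ln (real 3) * real 3 powr (-s))"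
    proof (rule character_series_tail[OF \<psi>])
      have "0 \<le> ln (real n) * real n powr (-s)" for n :: nat by (cases "n = 0") auto
      thus "summable (\<lambda>n. \<psi> n * (ln (real n) * real n powr (-s)))"
        by (intro summable_sign_times(2)[OF sm\<psi> summable_ln_powr[OF s]])
    qed (use ln_powr_decreasing[of s] s in auto)
    moreover have "2 * real m * (ln (real 3) * real 3 powr (-s)) \<le> 2 * real m * (ln (real 3) * 1)"
    proof (intro mult_left_mono)
      have "(3::real) powr (-s) \<le> 3 powr 0" using s by (intro powr_mono) auto
      thus "real 3 powr (-s) \<le> 1" by simp
    qed auto
    moreover have "2 * real m * (ln (real 3) * 1) = 2 * real m * ln 3" by simp
    moreover have "(\<Sum>n<3. \<psi> n * (ln (real n) * real n powr (-s))) = \<psi> 2 * (ln 2 * 2 powr (-s))"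
      by (simp add: eval_nat_numeral)
    moreover have "\<bar>\<psi> 2 * (ln 2 * 2 powr (-s))\<bar> \<le> \<bar>\<psi> 2\<bar> * ln 2"
    proof -
      have "(2::real) powr (-s) \<le> 2 powr 0" using s by (intro powr_mono) auto
      hence "\<bar>\<psi> 2\<bar> * (ln 2 * 2 powr (-s)) \<le> \<bar>\<psi> 2\<bar> * (ln 2 * 1)" by (intro mult_left_mono) auto
      thus ?thesis by (simp add: abs_mult)
    qed
    ultimately have Db: "\<bar>\<Sum>n. \<psi> n * (ln (real n) * real n powr (-s))\<bar> \<le> D"
      unfolding D_def by linarith
    have "\<bar>\<Sum>n. \<psi> n * (mangoldt n * real n powr (-s))\<bar> * e
        \<le> \<bar>\<Sum>n. \<psi> n * (mangoldt n * real n powr (-s))\<bar> * \<bar>\<Sum>n. \<psi> n * real n powr (-s)\<bar>"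
      using Ls by (intro mult_left_mono) auto
    also have "\<dots> = \<bar>\<Sum>n. \<psi> n * (ln (real n) * real n powr (-s))\<bar>"
      by (simp only: abs_mult[symmetric] character_log_derivative_identity[OF sm\<psi> s])
    also note Db
    finally show ?case using e by (simp add: field_simps)
  qed
  thus ?thesis by blast
qed

lemma zeta_diverges:
  "\<forall>\<^sub>F s in at_right 1. (\<Sum>n. real n powr (-s)) \<ge> K"
proof -
  have "\<not> summable (\<lambda>n. real n powr (-1))" by (subst summable_real_powr_iff) simp
  hence "\<not> (\<forall>N. (\<Sum>n<N. real n powr (-1)) \<le> K + 1)"
    using summableI_nonneg_bounded[of "\<lambda>n. real n powr (-1)" "K + 1"] by auto
  then obtain N where N: "(\<Sum>n<N. real n powr (-1)) > K + 1" by (auto simp: not_le)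
  have "((\<lambda>s. \<Sum>n<N. real n powr (-s)) \<longlongrightarrow> (\<Sum>n<N. real n powr (-1))) (at_right 1)"
    by (intro tendsto_sum tendsto_mult tendsto_const tendsto_nat_powr_at_1)
  hence ev: "\<forall>\<^sub>F s in at_right 1. dist (\<Sum>n<N. real n powr (-s)) (\<Sum>n<N. real n powr (-1)) < 1"
    by (rule tendstoD) simp
  have gt: "\<forall>\<^sub>F s in at_right (1::real). s > 1" by (auto simp: eventually_at_right_less)
  show ?thesis using ev gt
  proof eventually_elim
    case (elim s)
    have "summable (\<lambda>n. real n powr (-s))" using elim(2) by (subst summable_real_powr_iff) simp
    hence "(\<Sum>n<N. real n powr (-s)) \<le> (\<Sum>n. real n powr (-s))" by (intro sum_le_suminf) auto
    thus ?case using elim(1) N by (simp add: dist_real_def)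
  qed
qed

text \<open>
  The quotient of \<open>\<Sum> ln n / n\<^sup>s\<close> and \<open>\<Sum> 1 / n\<^sup>s\<close> exceeds \<open>ln N / 2\<close> near \<open>1\<close> for each \<open>N\<close>, because the
  terms with \<open>n < N\<close> become negligible in the divergent denominator.
\<close>

lemma mangoldt_series_diverges:
  "\<forall>\<^sub>F s in at_right 1. (\<Sum>n. mangoldt n * real n powr (-s)) \<ge> K"
proof -
  define N :: nat where "N = nat \<lceil>exp (2 * \<bar>K\<bar>)\<rceil> + 1"
  have eN: "exp (2 * \<bar>K\<bar>) \<le> real N" unfolding N_def by linarith
  have Npos: "real N > 0" using eN exp_gt_zero[of "2 * \<bar>K\<bar>"] by linarith
  from eN Npos have lnN: "2 * \<bar>K\<bar> \<le> ln (real N)" by (simp only: ln_ge_iff)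
  have gt: "\<forall>\<^sub>F s in at_right (1::real). s > 1" by (auto simp: eventually_at_right_less)
  show ?thesis using zeta_diverges[of "2 * real N"] gt
  proof eventually_elim
    case (elim s)
    hence s: "s > 1" by simp
    have sm1: "sign_multiplicative (\<lambda>_. 1)" by (simp add: sign_multiplicative_def)
    have smz: "summable (\<lambda>n. real n powr (-s))" using s by (subst summable_real_powr_iff) simp
    define Z where "Z = (\<Sum>n. real n powr (-s))"
    define A where "A = (\<Sum>n. mangoldt n * real n powr (-s))"
    have id: "A * Z = (\<Sum>n. ln (real n) * real n powr (-s))"
      using character_log_derivative_identity[OF sm1 s] by (simp add: A_def Z_def)
    have fin: "(\<Sum>n<N. real n powr (-s)) \<le> real N"
    proof -
      have "(\<Sum>n<N. real n powr (-s)) \<le> (\<Sum>n<N. 1)"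
      proof (rule sum_mono)
        fix n :: nat
        show "real n powr (-s) \<le> 1"
        proof (cases "n = 0")
          case False
          hence "real n powr (-s) \<le> real n powr 0" using s by (intro powr_mono) auto
          thus ?thesis using False by simp
        qed auto
      qed
      thus ?thesis by simp
    qed
    have lnN0: "0 \<le> ln (real N)" using lnN by simp
    have tm: "ln (real N) * (if n < N then 0 else real n powr (-s)) \<le> ln (real n) * real n powr (-s)" for n
    proof (cases "n < N")
      case True
      thus ?thesis by (cases "n = 0") auto
    next
      case False
      hence "ln (real N) \<le> ln (real n)" using Npos by simp
      thus ?thesis using False by (auto intro!: mult_right_mono)
    qed
    have smt: "(\<lambda>n. if n < N then 0 else real n powr (-s)) sums (Z - (\<Sum>n<N. real n powr (-s)))"
    proof -
      have "(\<lambda>n. real n powr (-s) - (if n \<in> {..<N} then real n powr (-s) else 0))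
          sums (Z - (\<Sum>n<N. real n powr (-s)))"
        unfolding Z_def by (intro sums_diff summable_sums smz sums_If_finite_set) auto
      moreover have "(\<lambda>n. real n powr (-s) - (if n \<in> {..<N} then real n powr (-s) else 0))
          = (\<lambda>n. if n < N then 0 else real n powr (-s))" by auto
      ultimately show ?thesis by simp
    qed
    have "ln (real N) * (Z - (\<Sum>n<N. real n powr (-s))) \<le> A * Z"
    proof -
      have "(\<lambda>n. ln (real N) * (if n < N then 0 else real n powr (-s))) sums
          (ln (real N) * (Z - (\<Sum>n<N. real n powr (-s))))" by (rule sums_mult[OF smt])
      moreover have "(\<lambda>n. ln (real n) * real n powr (-s)) sums (A * Z)"
        unfolding id by (rule summable_sums[OF summable_ln_powr[OF s]])
      ultimately show ?thesis by (rule sums_le[rotated]) (rule tm)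
    qed
    moreover have "Z - (\<Sum>n<N. real n powr (-s)) \<ge> Z / 2"
      using elim(1) fin by (simp add: Z_def)
    hence "ln (real N) * (Z / 2) \<le> ln (real N) * (Z - (\<Sum>n<N. real n powr (-s)))"
      using lnN0 by (intro mult_left_mono) auto
    moreover have Z: "Z > 0" using elim(1) Npos unfolding Z_def by linarith
    hence "2 * \<bar>K\<bar> * (Z / 2) \<le> ln (real N) * (Z / 2)" using lnN by (intro mult_right_mono) auto
    ultimately have "\<bar>K\<bar> * Z \<le> A * Z" by simp
    hence "\<bar>K\<bar> \<le> A" using Z by simp
    thus "K \<le> (\<Sum>n. mangoldt n * real n powr (-s))" by (simp add: A_def)
  qed
qed

section \<open>Primes with prescribed signs\<close>

text \<open>
  The integers of the form \<open>e j\<^sup>2\<close> with \<open>e \<le> M\<close> cover the higher prime powers and the powers of small primes.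
  They are too sparse to matter in the limit: \<open>ln n / n \<le> 4 / n\<^sup>3\<^sup>/\<^sup>4 \<le> 4 / j\<^sup>3\<^sup>/\<^sup>2\<close>.
\<close>

lemma prime_powers_not_prime_bound:
  "\<exists>W. \<forall>N. \<forall>s>1. (\<Sum>n | n < N \<and> (\<exists>e j. n = e * j\<^sup>2 \<and> 1 \<le> e \<and> e \<le> M). ln (real n) * real n powr (-s)) \<le> W"
proof -
  have sm: "summable (\<lambda>j. real j powr (-3/2))" by (subst summable_real_powr_iff) simp
  define W where "W = real M * (4 * (\<Sum>j. real j powr (-3/2)))"
  have "(\<Sum>n | n < N \<and> (\<exists>e j. n = e * j\<^sup>2 \<and> 1 \<le> e \<and> e \<le> M). ln (real n) * real n powr (-s)) \<le> W"
    if s: "s > 1" for N s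
  proof -
    define g :: "nat \<Rightarrow> real" where "g = (\<lambda>n. ln (real n) * real n powr (-s))"
    have g0: "g n \<ge> 0" for n unfolding g_def by (cases "n = 0") auto
    have gb: "g (e * j\<^sup>2) \<le> 4 * real j powr (-3/2)" if "e \<ge> 1" for e j
    proof (cases "j = 0")
      case False
      define n where "n = e * j\<^sup>2"
      have "n > 0" using that False by (simp add: n_def)
      hence n: "real n \<ge> 1" by simp
      have jn: "real j powr 2 \<le> real n"
      proof -
        have "1 * j\<^sup>2 \<le> e * j\<^sup>2" using that by (intro mult_right_mono) auto
        hence "real (j\<^sup>2) \<le> real n" unfolding n_def by (metis mult_1 of_nat_le_iff)
        thus ?thesis using False by simp
      qed
      have "g n \<le> (real n powr (1/4) / (1/4)) * real n powr (-1)"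
        unfolding g_def using ln_powr_bound[of "real n" "1/4"] n s
        by (intro mult_mono powr_mono) auto
      also have "\<dots> = 4 * (real n powr (1/4) * real n powr (-1))" by simp
      also have "real n powr (1/4) * real n powr (-1) = real n powr (1/4 + (-1))"
        by (rule powr_add[symmetric])
      also have "1/4 + (-1) = (-3/4 :: real)" by simp
      also have "real n powr (-3/4) \<le> (real j powr 2) powr (-3/4)"
        using jn False by (intro powr_mono2') auto
      also have "(real j powr 2) powr (-3/4) = real j powr (-3/2)" by (subst powr_powr) simp
      finally show ?thesis by (simp add: n_def)
    qed (auto simp: g_def)
    let ?T = "{n. n < N \<and> (\<exists>e j. n = e * j\<^sup>2 \<and> 1 \<le> e \<and> e \<le> M)}"
    let ?P = "{1..M} \<times> {..<Suc N}"
    have sub: "?T \<subseteq> insert 0 ((\<lambda>(e, j). e * j\<^sup>2) ` ?P)"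
    proof
      fix n assume "n \<in> ?T"
      then obtain e j where *: "n < N" "n = e * j\<^sup>2" "1 \<le> e" "e \<le> M" by blast
      show "n \<in> insert 0 ((\<lambda>(e, j). e * j\<^sup>2) ` ?P)"
      proof (cases "j = 0")
        case False
        have "j \<le> 1 * j\<^sup>2" by (simp add: power2_eq_square)
        also have "\<dots> \<le> e * j\<^sup>2" using * by (intro mult_right_mono) auto
        finally have "j < Suc N" using * by simp
        thus ?thesis using * by force
      qed (use * in auto)
    qed
    have "sum g ?T \<le> sum g (insert 0 ((\<lambda>(e, j). e * j\<^sup>2) ` ?P))"
      by (rule sum_mono2[OF _ sub]) (auto simp: g0)
    also have "\<dots> = sum g ((\<lambda>(e, j). e * j\<^sup>2) ` ?P)"
      by (subst sum.insert_if) (auto simp: g_def)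
    also have "\<dots> \<le> sum (g \<circ> (\<lambda>(e, j). e * j\<^sup>2)) ?P"
      by (rule sum_image_le) (auto simp: g0)
    also have "\<dots> \<le> sum (\<lambda>(e, j). 4 * real j powr (-3/2)) ?P"
      by (rule sum_mono) (use gb in auto)
    also have "\<dots> = (\<Sum>e=1..M. \<Sum>j<Suc N. 4 * real j powr (-3/2))"
      by (rule sum.cartesian_product[symmetric])
    also have "\<dots> = real M * (4 * (\<Sum>j<Suc N. real j powr (-3/2)))"
      by (simp add: sum_distrib_left[symmetric])
    also have "\<dots> \<le> W" unfolding W_def
      by (intro mult_left_mono sum_le_suminf sm) auto
    finally show ?thesis by (simp add: g_def)
  qed
  thus ?thesis by blast
qed

text \<open>
  The weight \<open>w(n) = \<Prod> (1 + \<epsilon>\<^sub>i \<psi>\<^sub>i(n))\<close> vanishes at every large prime that does not have all the prescribed signs.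
  Expanding the product, \<open>\<Sum> w(n) \<Lambda>(n) / n\<^sup>s\<close> is a sum of \<open>\<Sum> \<Lambda>(n) / n\<^sup>s\<close>, which tends to infinity at \<open>1\<close>,
  and of bounded contributions of the nonprincipal characters. Without a suitable prime only sparse prime
  powers would be left on the other side.
\<close>

theorem exists_prime_with_signs:
  fixes \<psi> :: "nat \<Rightarrow> nat \<Rightarrow> real" and \<epsilon> :: "nat \<Rightarrow> real"
  assumes fin: "finite I"
    and sm: "\<And>i. i \<in> I \<Longrightarrow> sign_multiplicative (\<psi> i)"
    and ch: "\<And>S. S \<subseteq> I \<Longrightarrow> S \<noteq> {} \<Longrightarrow> \<exists>m. quadratic_character (\<lambda>n. \<Prod>i\<in>S. \<psi> i n) m"
    and \<epsilon>: "\<And>i. i \<in> I \<Longrightarrow> \<epsilon> i \<in> {-1, 1}"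
    and zero: "\<And>i p. i \<in> I \<Longrightarrow> prime p \<Longrightarrow> \<psi> i p = 0 \<Longrightarrow> p \<le> M"
  shows "\<exists>p. prime p \<and> (\<forall>i\<in>I. \<psi> i p = \<epsilon> i)"
proof (rule ccontr)
  assume no: "\<not> ?thesis"
  define w where "w = (\<lambda>n. \<Prod>i\<in>I. 1 + \<epsilon> i * \<psi> i n)"
  have vals: "\<psi> i n \<in> {-1, 0, 1}" if "i \<in> I" for i n
    using sm[OF that] by (simp add: sign_multiplicative_def)
  have fac: "0 \<le> 1 + \<epsilon> i * \<psi> i n \<and> 1 + \<epsilon> i * \<psi> i n \<le> 2" if "i \<in> I" for i n
    using vals[OF that, of n] \<epsilon>[OF that] by auto
  have w0: "w n \<ge> 0" for n unfolding w_def by (rule prod_nonneg) (use fac in auto)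
  have w2: "w n \<le> 2 ^ card I" for n
  proof -
    have "w n \<le> (\<Prod>i\<in>I. 2)" unfolding w_def by (rule prod_mono) (use fac in auto)
    thus ?thesis by simp
  qed
  have wp: "p \<le> M" if "prime p" "w p \<noteq> 0" for p
  proof (rule ccontr)
    assume "\<not> p \<le> M"
    have "\<not> (\<forall>i\<in>I. \<psi> i p = \<epsilon> i)"
    proof
      assume "\<forall>i\<in>I. \<psi> i p = \<epsilon> i"
      with that(1) have "\<exists>p. prime p \<and> (\<forall>i\<in>I. \<psi> i p = \<epsilon> i)" by (intro exI conjI)
      with no show False by contradiction
    qed
    then obtain i where i: "i \<in> I" "\<psi> i p \<noteq> \<epsilon> i" by auto
    have "\<psi> i p \<noteq> 0" using zero[OF i(1) that(1)] \<open>\<not> p \<le> M\<close> by auto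
    hence "1 + \<epsilon> i * \<psi> i p = 0" using vals[OF i(1), of p] \<epsilon>[OF i(1)] i(2) by auto
    hence "w p = 0" unfolding w_def by (intro prod_zero[OF fin] bexI[OF _ i(1)])
    thus False using that by simp
  qed
  \<comment> \<open>an odd power of a prime has the same signs as the prime itself, an even power is a square\<close>
  have supp: "\<exists>e j. n = e * j\<^sup>2 \<and> 1 \<le> e \<and> e \<le> Suc M" if "mangoldt n * w n \<noteq> (0::real)" for n
  proof -
    have "primepow n" using that by (auto simp: mangoldt_def split: if_splits)
    then obtain p k where pk: "prime p" "k > 0" "n = p ^ k" by (auto simp: primepow_def)
    show ?thesis
    proof (cases "even k")
      case True
      then obtain l where "k = 2 * l" by blast
      hence "n = 1 * (p ^ l)\<^sup>2" using pk by (simp add: power_mult mult.commute[of 2])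
      thus ?thesis by (intro exI[of _ 1] exI[of _ "p ^ l"]) auto
    next
      case False
      then obtain l where l: "k = 2 * l + 1" by (blast elim: oddE)
      have "\<psi> i n = \<psi> i p" if "i \<in> I" for i
      proof -
        have "\<psi> i n = \<psi> i p ^ k" using sign_multiplicative_power[OF sm[OF that]] pk by simp
        thus ?thesis using vals[OF that, of p] False pk(2) by auto
      qed
      hence "w n = w p" by (simp add: w_def cong: prod.cong)
      hence "p \<le> M" using wp[OF pk(1)] that by auto
      moreover have "n = p * (p ^ l)\<^sup>2" using pk l by (simp add: power_mult mult.commute[of 2])
      ultimately show ?thesis using prime_ge_1_nat[OF pk(1)] by (intro exI[of _ p] exI[of _ "p ^ l"]) auto
    qed
  qed
  obtain W where W: "\<And>N s. s > 1 \<Longrightarrow>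
      (\<Sum>n | n < N \<and> (\<exists>e j. n = e * j\<^sup>2 \<and> 1 \<le> e \<and> e \<le> Suc M). ln (real n) * real n powr (-s)) \<le> W"
    using prime_powers_not_prime_bound[of "Suc M"] by blast
  have smw: "summable (\<lambda>n. w n * (mangoldt n * real n powr (-s)))" if s: "s > 1" for s
  proof (rule summable_comparison_test'[OF summable_mult[OF summable_mangoldt_powr[OF s], of "2 ^ card I"], of 0])
    fix n :: nat
    show "norm (w n * (mangoldt n * real n powr (-s))) \<le> 2 ^ card I * (mangoldt n * real n powr (-s))"
      using w0[of n] w2[of n] by (auto simp: abs_mult mangoldt_nonneg intro!: mult_right_mono)
  qed
  have upper: "(\<Sum>n. w n * (mangoldt n * real n powr (-s))) \<le> 2 ^ card I * W" if s: "s > 1" for s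
  proof (rule suminf_le_const[OF smw[OF s]])
    fix N
    let ?T = "{n. n < N \<and> (\<exists>e j. n = e * j\<^sup>2 \<and> 1 \<le> e \<and> e \<le> Suc M)}"
    have "(\<Sum>n<N. w n * (mangoldt n * real n powr (-s))) = (\<Sum>n\<in>?T. w n * (mangoldt n * real n powr (-s)))"
      by (rule sum.mono_neutral_right) (use supp in auto)
    also have "\<dots> \<le> (\<Sum>n\<in>?T. 2 ^ card I * (ln (real n) * real n powr (-s)))"
    proof (rule sum_mono)
      fix n assume "n \<in> ?T"
      show "w n * (mangoldt n * real n powr (-s)) \<le> 2 ^ card I * (ln (real n) * real n powr (-s))"
      proof (cases "n = 0")
        case False
        thus ?thesis using w0[of n] w2[of n] mangoldt_le_ln[of n]
          by (intro mult_mono mult_right_mono) (auto simp: mangoldt_nonneg)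
      qed auto
    qed
    also have "\<dots> = 2 ^ card I * (\<Sum>n\<in>?T. ln (real n) * real n powr (-s))"
      by (rule sum_distrib_left[symmetric])
    also have "\<dots> \<le> 2 ^ card I * W" using W[OF s] by (intro mult_left_mono) auto
    finally show "(\<Sum>n<N. w n * (mangoldt n * real n powr (-s))) \<le> 2 ^ card I * W" .
  qed
  define \<Psi> where "\<Psi> = (\<lambda>S n. \<Prod>i\<in>S. \<psi> i n)"
  define c where "c = (\<lambda>S. \<Prod>i\<in>S. \<epsilon> i)"
  have wexp: "w n = (\<Sum>S\<in>Pow I. c S * \<Psi> S n)" for n
  proof -
    have "w n = (\<Prod>i\<in>I. \<epsilon> i * \<psi> i n + 1)" by (simp add: w_def add.commute)
    also have "\<dots> = (\<Sum>S\<in>Pow I. (\<Prod>i\<in>S. \<epsilon> i * \<psi> i n) * (\<Prod>i\<in>I - S. 1))" by (rule prod_add[OF fin])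
    finally show ?thesis by (simp add: c_def \<Psi>_def prod.distrib)
  qed
  have smS: "sign_multiplicative (\<Psi> S)" if "S \<subseteq> I" for S
  proof (cases "S = {}")
    case False
    thus ?thesis using ch[OF that] by (auto simp: \<Psi>_def quadratic_character_def)
  qed (simp add: \<Psi>_def sign_multiplicative_def)
  have cS: "\<bar>c S\<bar> = 1" if "S \<subseteq> I" for S
  proof -
    have "\<bar>c S\<bar> = (\<Prod>i\<in>S. \<bar>\<epsilon> i\<bar>)" by (simp add: c_def abs_prod)
    also have "\<dots> = (\<Prod>i\<in>S. 1)" by (rule prod.cong) (use \<epsilon> that in fastforce)+
    finally show ?thesis by simp
  qed
  have "\<forall>S\<in>Pow I - {{}}. \<exists>c. \<forall>\<^sub>F s in at_right 1. \<bar>\<Sum>n. \<Psi> S n * (mangoldt n * real n powr (-s))\<bar> \<le> c"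
  proof
    fix S assume "S \<in> Pow I - {{}}"
    then obtain m where "quadratic_character (\<Psi> S) m" using ch[of S] by (auto simp: \<Psi>_def)
    thus "\<exists>c. \<forall>\<^sub>F s in at_right 1. \<bar>\<Sum>n. \<Psi> S n * (mangoldt n * real n powr (-s))\<bar> \<le> c"
      by (rule character_log_derivative_bounded)
  qed
  from bchoice[OF this]
  obtain C where C: "\<And>S. S \<in> Pow I - {{}} \<Longrightarrow>
      \<forall>\<^sub>F s in at_right 1. \<bar>\<Sum>n. \<Psi> S n * (mangoldt n * real n powr (-s))\<bar> \<le> C S" by blast
  have "\<forall>\<^sub>F s in at_right 1. \<forall>S\<in>Pow I - {{}}. \<bar>\<Sum>n. \<Psi> S n * (mangoldt n * real n powr (-s))\<bar> \<le> C S"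
    by (rule eventually_ball_finite) (use fin C in auto)
  moreover have "\<forall>\<^sub>F s in at_right (1::real). s > 1" by (auto simp: eventually_at_right_less)
  moreover note mangoldt_series_diverges[of "2 ^ card I * W + (\<Sum>S\<in>Pow I - {{}}. C S) + 1"]
  ultimately have "\<forall>\<^sub>F s in at_right (1::real). False"
  proof eventually_elim
    case (elim s)
    define A where "A = (\<lambda>S. \<Sum>n. \<Psi> S n * (mangoldt n * real n powr (-s)))"
    have "(\<lambda>n. \<Sum>S\<in>Pow I. c S * (\<Psi> S n * (mangoldt n * real n powr (-s)))) sums (\<Sum>S\<in>Pow I. c S * A S)"
      unfolding A_def
      by (intro sums_sum sums_mult summable_sums summable_sign_times(2)[OF smS summable_mangoldt_powr])
         (use elim(2) in \<open>auto simp: mangoldt_nonneg\<close>)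
    moreover have "(\<Sum>S\<in>Pow I. c S * (\<Psi> S n * (mangoldt n * real n powr (-s))))
        = w n * (mangoldt n * real n powr (-s))" for n
      by (simp add: wexp sum_distrib_right mult.assoc)
    ultimately have "(\<Sum>n. w n * (mangoldt n * real n powr (-s))) = (\<Sum>S\<in>Pow I. c S * A S)"
      by (simp add: sums_iff)
    also have "\<dots> = c {} * A {} + (\<Sum>S\<in>Pow I - {{}}. c S * A S)"
      by (rule sum.remove) (use fin in auto)
    also have "\<dots> \<ge> A {} - (\<Sum>S\<in>Pow I - {{}}. C S)"
    proof -
      have "\<bar>\<Sum>S\<in>Pow I - {{}}. c S * A S\<bar> \<le> (\<Sum>S\<in>Pow I - {{}}. \<bar>c S * A S\<bar>)" by (rule sum_abs)
      also have "\<dots> \<le> (\<Sum>S\<in>Pow I - {{}}. C S)"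
        by (rule sum_mono) (use elim(1) cS in \<open>auto simp: abs_mult A_def\<close>)
      finally show ?thesis by (simp add: c_def)
    qed
    finally have "(\<Sum>n. w n * (mangoldt n * real n powr (-s))) \<ge> A {} - (\<Sum>S\<in>Pow I - {{}}. C S)" .
    moreover have "A {} = (\<Sum>n. mangoldt n * real n powr (-s))" by (simp add: A_def \<Psi>_def)
    ultimately show False using elim(3) upper[OF elim(2)] by linarith
  qed
  thus False by (simp add: trivial_limit_at_right_real)
qed

section \<open>Primes with prescribed quadratic symbols\<close>

definition sign_mod4 :: "nat \<Rightarrow> real" where
  "sign_mod4 n = (if n mod 4 = 1 then 1 else if n mod 4 = 3 then -1 else 0)"

text \<open>
  The index \<open>4\<close>, which is not a prime, stands for the character modulo \<open>4\<close>, so that all conditions on a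
  prime form one family.
\<close>

definition residue_sign :: "nat \<Rightarrow> nat \<Rightarrow> real" where
  "residue_sign q n = (if q = 4 then sign_mod4 n else real_of_int (Legendre (int n) (int q)))"

lemma sign_mod4_mult: "sign_mod4 (a * b) = sign_mod4 a * sign_mod4 b"
proof -
  have e: "(a * b) mod 4 = (a mod 4) * (b mod 4) mod 4" by (simp add: mod_mult_eq)
  have "a mod 4 < 4" "b mod 4 < 4" by auto
  hence "a mod 4 \<in> {0, 1, 2, 3}" "b mod 4 \<in> {0, 1, 2, 3}" by auto
  thus ?thesis unfolding sign_mod4_def e by auto
qed

lemma sign_mod4_one: "sign_mod4 (Suc 0) = 1"
  by (simp add: sign_mod4_def)

lemma sign_multiplicative_residue_sign:
  assumes "q = 4 \<or> prime q \<and> odd q"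
  shows "sign_multiplicative (residue_sign q)"
proof (cases "q = 4")
  case True
  thus ?thesis unfolding sign_multiplicative_def residue_sign_def
    by (auto simp: sign_mod4_mult) (auto simp: sign_mod4_def)
next
  case False
  hence q: "prime q" "odd q" using assms by auto
  have "Legendre 1 (int q) = 1" using Legendre_sq[OF q(1), of 1] prime_gt_1_nat[OF q(1)] by (simp add: zdvd1_eq)
  moreover have "real_of_int (Legendre a (int q)) \<in> {-1, 0, 1}" for a
    using Legendre_values[of a "int q"] by auto
  ultimately show ?thesis
    using False Legendre_mult[OF q] by (simp add: sign_multiplicative_def residue_sign_def)
qed

lemma residue_sign_cong:
  assumes "[a = b] (mod q)"
  shows "residue_sign q a = residue_sign q b"
proof (cases "q = 4")
  case True
  thus ?thesis using assms by (simp add: residue_sign_def sign_mod4_def unique_euclidean_semiring_class.cong_def)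
next
  case False
  have "[int a = int b] (mod int q)" using assms by (simp add: cong_int_iff)
  thus ?thesis using False Legendre_cong by (simp add: residue_sign_def)
qed

lemma residue_sign_nonzero_coprime:
  assumes "q = 4 \<or> prime q \<and> odd q" "residue_sign q a \<noteq> 0"
  shows "coprime a q"
proof (cases "q = 4")
  case True
  hence "odd a" using assms(2) by (auto simp: residue_sign_def sign_mod4_def split: if_splits) presburger+
  hence "coprime a 2" by simp
  hence "coprime a (2 * 2)" by (simp only: coprime_mult_right_iff)
  thus ?thesis using True by simp
next
  case False
  hence "\<not> q dvd a" using assms by (auto simp: residue_sign_def Legendre_eq_0_iff)
  thus ?thesis using False assms(1) prime_imp_coprime[of q a] by (auto simp: coprime_commute)
qed

lemma exists_nonresidue:
  assumes "prime q" "odd q"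
  shows "\<exists>a::nat. Legendre (int a) (int q) = -1"
proof (rule ccontr)
  assume no: "\<not> ?thesis"
  have q2: "q > 2" using assms prime_ge_2_nat[of q] by (cases "q = 2") auto
  define f where "f = (\<lambda>x. x\<^sup>2 mod q)"
  have "{..<q} \<subseteq> f ` {..<q}"
  proof
    fix a assume a: "a \<in> {..<q}"
    show "a \<in> f ` {..<q}"
    proof (cases "a = 0")
      case True
      thus ?thesis using q2 by (intro image_eqI[of _ _ 0]) (auto simp: f_def)
    next
      case False
      have "Legendre (int a) (int q) = 1"
        using no a False Legendre_values[of "int a" "int q"] by (auto simp: Legendre_eq_0_iff dest: dvd_imp_le)
      then obtain r where r: "int q dvd r\<^sup>2 - int a" by (rule Legendre_eq_1D)
      define x where "x = nat (r mod int q)"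
      have ix: "int x = r mod int q" using q2 by (simp add: x_def)
      have "int (x\<^sup>2 mod q) = (r mod int q)\<^sup>2 mod int q" by (simp add: zmod_int ix)
      also have "\<dots> = r\<^sup>2 mod int q" by (rule power_mod)
      also have "\<dots> = int a mod int q" using r by (simp add: mod_eq_dvd_iff)
      also have "\<dots> = int a" using a by simp
      finally have "f x = a" by (simp add: f_def)
      moreover have "x < q" using ix q2 by (metis of_nat_less_iff pos_mod_bound of_nat_0_less_iff less_trans zero_less_numeral)
      ultimately show ?thesis by auto
    qed
  qed
  moreover have "f ` {..<q} \<subseteq> {..<q}" using q2 by (auto simp: f_def)
  ultimately have "f ` {..<q} = {..<q}" by blast
  hence "inj_on f {..<q}" by (intro eq_card_imp_inj_on) auto
  moreover have "f 1 = f (q - 1)"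
  proof -
    have e: "(q - 1)\<^sup>2 = 1 + q * (q - 2)"
    proof -
      obtain k where "q = k + 2" using q2 by (metis add.commute less_imp_add_positive)
      thus ?thesis by (simp add: power2_eq_square)
    qed
    show ?thesis unfolding f_def e power_one by (rule mod_mult_self2[symmetric])
  qed
  ultimately have "1 = q - 1" by (rule inj_onD) (use q2 in auto)
  thus False using q2 by simp
qed

text \<open>
  By the Chinese remainder theorem some \<open>a\<close> prime to the modulus has value \<open>-1\<close>, since it can be chosen as a non-residue
  for one factor and as \<open>1\<close> for the others. Multiplication by \<open>a\<close> permutes the residues and changes the sign of the sum
  over a period, which is therefore \<open>0\<close>.
\<close>

lemma quadratic_character_residue_signs:
  assumes fin: "finite S" and S: "S \<noteq> {}" and el: "\<And>q. q \<in> S \<Longrightarrow> q = 4 \<or> prime q \<and> odd q"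
  shows "quadratic_character (\<lambda>n. \<Prod>q\<in>S. residue_sign q n) (\<Prod>S)"
proof -
  define \<psi> where "\<psi> = (\<lambda>n. \<Prod>q\<in>S. residue_sign q n)"
  define m where "m = \<Prod>S"
  have sm: "sign_multiplicative (residue_sign q)" if "q \<in> S" for q
    by (rule sign_multiplicative_residue_sign[OF el[OF that]])
  have sm\<psi>: "sign_multiplicative \<psi>"
    unfolding sign_multiplicative_def
  proof (intro conjI allI)
    show "\<psi> 1 = 1" unfolding \<psi>_def by (rule prod.neutral) (use sm in \<open>simp add: sign_multiplicative_def\<close>)
    show "\<psi> (a * b) = \<psi> a * \<psi> b" for a b
      unfolding \<psi>_def prod.distrib[symmetric]
      by (rule prod.cong) (use sm in \<open>auto simp: sign_multiplicative_def\<close>)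
    show "\<psi> a \<in> {-1, 0, 1}" for a
      unfolding \<psi>_def using fin sm
    proof (induction S rule: finite_induct)
      case (insert q F)
      have "residue_sign q a \<in> {-1, 0, 1}" using insert.prems[of q] by (simp add: sign_multiplicative_def)
      thus ?case using insert by auto
    qed simp
  qed
  have pos: "q > 0" if "q \<in> S" for q using el[OF that] by (auto simp: prime_gt_0_nat)
  have m: "m > 0" unfolding m_def using pos by (intro prod_pos) auto
  have \<psi>_cong: "\<psi> a = \<psi> b" if "[a = b] (mod m)" for a b
    unfolding \<psi>_def
  proof (rule prod.cong[OF refl])
    fix q assume "q \<in> S"
    hence "q dvd m" unfolding m_def using dvd_prodI[OF fin, of q "\<lambda>x. x"] by simp
    thus "residue_sign q a = residue_sign q b" using that by (intro residue_sign_cong) (rule cong_dvd_modulus_nat)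
  qed
  obtain q0 where q0: "q0 \<in> S" using S by blast
  obtain v where v: "residue_sign q0 v = -1"
  proof (cases "q0 = 4")
    case True
    thus ?thesis using that[of 3] by (simp add: residue_sign_def sign_mod4_def)
  next
    case False
    then obtain a where "Legendre (int a) (int q0) = -1" using exists_nonresidue[of q0] el[OF q0] by blast
    hence "residue_sign q0 a = -1" using False by (simp add: residue_sign_def)
    thus ?thesis by (rule that)
  qed
  have "\<forall>i\<in>S. \<forall>j\<in>S. i \<noteq> j \<longrightarrow> coprime i j"
  proof (intro ballI impI)
    fix i j assume ij: "i \<in> S" "j \<in> S" "i \<noteq> j"
    have 4: "coprime q 4" if "prime q" "odd q" for q :: nat
    proof -
      have "coprime q 2" using that by simp
      hence "coprime q (2 * 2)" by (simp only: coprime_mult_right_iff)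
      thus ?thesis by simp
    qed
    show "coprime i j"
      using el[OF ij(1)] el[OF ij(2)] ij(3) 4 by (auto simp: primes_coprime coprime_commute)
  qed
  from chinese_remainder_nat[OF fin this, of "\<lambda>q. if q = q0 then v else 1"]
  obtain a where a: "\<And>q. q \<in> S \<Longrightarrow> [a = (if q = q0 then v else 1)] (mod q)" by auto
  have rs: "residue_sign q a = (if q = q0 then -1 else 1)" if "q \<in> S" for q
    using residue_sign_cong[OF a[OF that]] v sm[OF that] by (auto simp: sign_multiplicative_def)
  have "\<psi> a = (\<Prod>q\<in>S. if q = q0 then -1 else 1)" unfolding \<psi>_def by (rule prod.cong) (use rs in auto)
  hence \<psi>a: "\<psi> a = -1" using fin q0 by (simp add: prod.delta)
  have "coprime a q" if "q \<in> S" for q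
    by (rule residue_sign_nonzero_coprime[OF el[OF that]]) (use rs[OF that] in auto)
  hence cop: "coprime a m" unfolding m_def by (intro prod_coprime_right) auto
  have "inj_on (\<lambda>n. a * n mod m) {..<m}"
  proof (rule inj_onI)
    fix x y assume xy: "x \<in> {..<m}" "y \<in> {..<m}" "a * x mod m = a * y mod m"
    hence "[a * x = a * y] (mod m)" by (simp add: unique_euclidean_semiring_class.cong_def)
    hence "[x = y] (mod m)" using cop cong_mult_lcancel_nat by blast
    thus "x = y" using xy by (simp add: unique_euclidean_semiring_class.cong_def)
  qed
  moreover have "(\<lambda>n. a * n mod m) ` {..<m} \<subseteq> {..<m}" using m by auto
  ultimately have bij: "bij_betw (\<lambda>n. a * n mod m) {..<m} {..<m}"
    by (simp add: bij_betw_def endo_inj_surj)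
  have "(\<Sum>n<m. \<psi> n) = (\<Sum>n<m. \<psi> (a * n mod m))"
    by (rule sum.reindex_bij_betw[OF bij, symmetric])
  also have "\<dots> = (\<Sum>n<m. - \<psi> n)"
  proof (rule sum.cong[OF refl])
    fix n
    have "\<psi> (a * n mod m) = \<psi> (a * n)" by (rule \<psi>_cong) (simp add: unique_euclidean_semiring_class.cong_def)
    also have "\<dots> = - \<psi> n" using sm\<psi> \<psi>a by (simp add: sign_multiplicative_def)
    finally show "\<psi> (a * n mod m) = - \<psi> n" .
  qed
  finally have "(\<Sum>n<m. \<psi> n) = 0" by (simp add: sum_negf)
  moreover have "\<psi> (n + m) = \<psi> n" for n by (rule \<psi>_cong) (simp add: unique_euclidean_semiring_class.cong_def)
  ultimately have "quadratic_character \<psi> m" using sm\<psi> m by (simp add: quadratic_character_def)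
  thus ?thesis by (simp add: \<psi>_def m_def)
qed

theorem exists_prime_with_symbols:
  fixes Q :: "nat set" and \<epsilon> :: "nat \<Rightarrow> int" and c :: nat
  assumes fin: "finite Q" and Q: "\<And>q. q \<in> Q \<Longrightarrow> prime q \<and> odd q"
    and \<epsilon>: "\<And>q. q \<in> Q \<Longrightarrow> \<epsilon> q \<in> {-1, 1}" and c: "c \<in> {1, 3}"
  obtains l where "prime l" "l mod 4 = c" "\<And>q. q \<in> Q \<Longrightarrow> Legendre (int l) (int q) = \<epsilon> q"
proof -
  define I where "I = insert 4 Q"
  have el: "q = 4 \<or> prime q \<and> odd q" if "q \<in> I" for q using that Q by (auto simp: I_def)
  have Q4: "4 \<notin> Q" using Q by force
  define e where "e = (\<lambda>q. if q = 4 then sign_mod4 c else real_of_int (\<epsilon> q))"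
  have "\<exists>p. prime p \<and> (\<forall>i\<in>I. residue_sign i p = e i)"
  proof (rule exists_prime_with_signs[where M = "\<Sum>I"])
    show finI: "finite I" using fin by (simp add: I_def)
    show "sign_multiplicative (residue_sign i)" if "i \<in> I" for i
      by (rule sign_multiplicative_residue_sign[OF el[OF that]])
    show "\<exists>m. quadratic_character (\<lambda>n. \<Prod>i\<in>S. residue_sign i n) m" if "S \<subseteq> I" "S \<noteq> {}" for S
    proof
      show "quadratic_character (\<lambda>n. \<Prod>i\<in>S. residue_sign i n) (\<Prod>S)"
        by (rule quadratic_character_residue_signs) (use that finI el in \<open>auto intro: finite_subset\<close>)
    qed
    show "e i \<in> {-1, 1}" if "i \<in> I" for i
    proof (cases "i = 4")
      case True
      thus ?thesis using c by (auto simp: e_def sign_mod4_def)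
    next
      case False
      hence "\<epsilon> i \<in> {-1, 1}" using that \<epsilon> by (simp add: I_def)
      thus ?thesis using False by (auto simp: e_def)
    qed
    show "p \<le> \<Sum>I" if i: "i \<in> I" and p: "prime p" and z: "residue_sign i p = 0" for i p
    proof -
      have "i \<le> \<Sum>I" using i finI by (intro member_le_sum) auto
      moreover have "p \<le> i"
      proof (cases "i = 4")
        case True
        hence "p mod 4 \<noteq> 1" "p mod 4 \<noteq> 3" using z by (auto simp: residue_sign_def sign_mod4_def split: if_splits)
        hence "even p" by presburger
        hence "p = 2" using p primes_dvd_imp_eq[of 2 p] by auto
        thus ?thesis using True by simp
      next
        case False
        hence "i dvd p" "prime i" using z el[OF i] by (auto simp: residue_sign_def Legendre_eq_0_iff)
        thus ?thesis using p primes_dvd_imp_eq by auto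
      qed
      ultimately show ?thesis by linarith
    qed
  qed
  then obtain l where l: "prime l" "\<And>i. i \<in> I \<Longrightarrow> residue_sign i l = e i" by blast
  have "sign_mod4 l = sign_mod4 c" using l(2)[of 4] by (simp add: I_def residue_sign_def e_def)
  hence "l mod 4 = c" using c by (auto simp: sign_mod4_def split: if_splits)
  moreover have "Legendre (int l) (int q) = \<epsilon> q" if "q \<in> Q" for q
  proof -
    have "q \<noteq> 4" using that Q4 by auto
    thus ?thesis using l(2)[of q] that by (simp add: I_def residue_sign_def e_def)
  qed
  ultimately show ?thesis using that l(1) by blast
qed

section \<open>Values represented by quaternary forms\<close>

lemma prime_mult_not_square:
  fixes l k t :: nat
  assumes "prime l" "\<not> l dvd k"
  shows "k * l \<noteq> t\<^sup>2"
proof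
  assume e: "k * l = t\<^sup>2"
  hence "l dvd t\<^sup>2" by (metis dvd_triv_right)
  hence "l dvd t" using assms(1) prime_dvd_power by blast
  then obtain s where "t = l * s" by (auto elim: dvdE)
  hence "k * l = (l * s\<^sup>2) * l" using e by (simp only: power2_eq_square mult_ac)
  hence "k = l * s\<^sup>2" using assms(1) by (simp add: prime_gt_0_nat)
  thus False using assms(2) by simp
qed

lemma Legendre_squarefree_part:
  assumes "prime q" "odd q" "[f = 1] (mod q)" "f = f0 * g\<^sup>2"
  shows "Legendre (int f0) (int q) = 1"
proof -
  have 1: "Legendre 1 (int q) = 1" using Legendre_sq[OF assms(1), of 1] prime_gt_1_nat[OF assms(1)] by (simp add: zdvd1_eq)
  have "[int f = 1] (mod int q)" using assms(3) by (metis cong_int_iff of_nat_1)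
  hence f: "Legendre (int f) (int q) = 1" using Legendre_cong 1 by metis
  have "Legendre (int f) (int q) = Legendre (int f0) (int q) * Legendre ((int g)\<^sup>2) (int q)"
    using Legendre_mult[OF assms(1,2), of "int f0" "(int g)\<^sup>2"] by (simp add: assms(4))
  moreover have "\<not> q dvd g"
  proof
    assume "q dvd g"
    hence "q dvd f" by (simp add: assms(4) power2_eq_square)
    hence "q dvd 1" using assms(3) cong_dvd_iff by blast
    thus False using assms(1) by auto
  qed
  hence "Legendre ((int g)\<^sup>2) (int q) = 1" using Legendre_sq[OF assms(1), of "int g"] by simp
  ultimately show ?thesis using f by simp
qed

lemma norm_form_represents_prime:
  fixes d l :: nat
  assumes "prime l" "l mod 4 = 1" "prime d" "d mod 4 = 3" "Legendre (int l) (int d) = 1"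
  obtains x y z :: int where "x\<^sup>2 + int d * y\<^sup>2 = int l * z\<^sup>2" "z \<noteq> 0"
proof -
  have odd: "odd l" "odd d" using assms by presburger+
  have ne: "l \<noteq> d" using assms by auto
  have nd: "\<not> l dvd d" using primes_dvd_imp_eq[OF assms(1,3)] ne by auto
  have m1: "Legendre (-1) (int l) = 1" using Legendre_minus_one[OF assms(1) odd(1)] assms(2) by simp
  have "Legendre (int d) (int l) = 1" using reciprocity_1mod4[OF assms(1,3) odd(2) ne assms(2)] assms(5) by simp
  hence "Legendre (- int d) (int l) = 1" using m1 Legendre_mult[OF assms(1) odd(1), of "-1" "int d"] by simp
  then obtain t where t: "int l dvd t\<^sup>2 - (- int d)" by (rule Legendre_eq_1D)
  obtain s where s: "int d dvd s\<^sup>2 - int l" using assms(5) by (rule Legendre_eq_1D)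
  have "coprime d l" using assms(1,3) ne by (simp add: primes_coprime)
  then obtain x y z :: int where xyz: "int 1 * x\<^sup>2 + int d * y\<^sup>2 = int l * z\<^sup>2" "(x, y, z) \<noteq> (0, 0, 0)"
    using legendre_ternary[of 1 d l 0 s t] prime_mult_not_square[OF assms(1) nd] s t
      assms(1,3) prime_gt_0_nat by auto
  have "z \<noteq> 0"
  proof
    assume "z = 0"
    hence "x\<^sup>2 + int d * y\<^sup>2 = 0" using xyz by simp
    moreover have "x\<^sup>2 \<ge> 0" "int d * y\<^sup>2 \<ge> 0" by auto
    ultimately have "x\<^sup>2 = 0" "int d * y\<^sup>2 = 0" by linarith+
    thus False using xyz \<open>z = 0\<close> assms(3) by auto
  qed
  thus ?thesis using that[of x y z] xyz by simp
qed

text \<open>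
  Let \<open>f = 1 + p n\<^sup>2\<close> with squarefree part \<open>f\<^sub>0\<close>. The prime \<open>l\<close> is chosen to be \<open>1\<close> modulo \<open>4\<close>, a square modulo \<open>p\<close> and
  \<open>d\<close>, and to have the symbol of \<open>p d\<close> at each prime \<open>q\<close> dividing \<open>f\<^sub>0\<close>. All conditions of Legendre's theorem for
  \<open>f\<^sub>0 x\<^sup>2 + p d y\<^sup>2 = l z\<^sup>2\<close> hold by this choice, except for the one at \<open>l\<close>, where \<open>f\<^sub>0\<close> has to be a square. There reciprocity helps:
  modulo \<open>q\<close> the number \<open>- p\<close> is a square, so the symbol of \<open>l\<close> at \<open>q\<close> is that of \<open>- d\<close>, which is the symbol of \<open>q\<close>
  at \<open>d\<close>; the product over all \<open>q\<close> is the symbol of \<open>f\<^sub>0\<close> at \<open>d\<close>, and \<open>f\<close> is \<open>1\<close> modulo \<open>d\<close>.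
\<close>

theorem norm_form_represents_odd:
  fixes p d :: nat and n :: int
  assumes p: "prime p" "odd p" and d: "prime d" "d mod 4 = 3" and pd: "p \<noteq> d"
    and n: "2 * int d dvd n"
  shows "\<exists>u x y :: rat. 1 + of_nat p * (of_int n)\<^sup>2 + of_nat p * of_nat d * u\<^sup>2 = x\<^sup>2 + of_nat d * y\<^sup>2"
proof -
  define N where "N = nat \<bar>n\<bar>"
  have N2: "(of_int n :: rat)\<^sup>2 = (of_nat N)\<^sup>2" 
  proof -
    have "(int N)\<^sup>2 = n\<^sup>2" by (simp add: N_def)
    hence "(of_int ((int N)\<^sup>2) :: rat) = of_int (n\<^sup>2)" by (rule arg_cong)
    thus ?thesis by simp
  qed
  define f where "f = 1 + p * N\<^sup>2"
  have f0: "f > 0" by (simp add: f_def)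
  define f0 g where "f0 = squarefree_part f" and "g = square_part f"
  have fg: "f = f0 * g\<^sup>2" unfolding f0_def g_def by (rule squarefree_decompose)
  have sqf: "squarefree f0" by (simp add: f0_def)
  have pos: "f0 > 0" "g > 0" using fg f0 by (auto intro!: Nat.gr0I)
  have "int (2 * d) dvd int N" using n by (simp add: N_def)
  hence dN: "2 * d dvd N" by (simp only: of_nat_dvd_iff)
  have odd_d: "odd d" using d by presburger
  have fp: "[f = 1] (mod p)"
    by (simp only: f_def unique_euclidean_semiring_class.cong_def mod_mult_self2)
  have "d dvd N" using dN by (rule dvd_mult_right)
  then obtain N' where "N = d * N'" by (auto elim: dvdE)
  hence "f = 1 + d * (p * d * N'\<^sup>2)" by (simp add: f_def power2_eq_square)
  hence fd: "[f = 1] (mod d)"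
    by (simp only: unique_euclidean_semiring_class.cong_def mod_mult_self2)
  have "even N" using dN by (rule dvd_mult_left)
  hence odd_f: "odd f" by (simp add: f_def)
  define Q0 where "Q0 = prime_factors f0"
  have Q0: "prime q" "odd q" "q dvd f0" "q dvd f" "q \<noteq> p" "q \<noteq> d" if "q \<in> Q0" for q
  proof -
    show q: "prime q" "q dvd f0" using that by (auto simp: Q0_def in_prime_factors_iff)
    show qf: "q dvd f" using q(2) by (simp add: fg)
    show "odd q" using qf odd_f by (meson dvd_trans)
    have "\<not> q dvd 1" using q(1) by auto
    thus "q \<noteq> p" "q \<noteq> d" using cong_dvd_iff[OF fp] cong_dvd_iff[OF fd] qf by auto
  qed
  have npd: "\<not> int q dvd int p * int d" if "q \<in> Q0" for q
  proof
    assume "int q dvd int p * int d"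
    hence "q dvd p * d" by (metis of_nat_dvd_iff of_nat_mult)
    hence "q dvd p \<or> q dvd d" using Q0(1)[OF that] by (simp add: prime_dvd_mult_iff)
    thus False using primes_dvd_imp_eq[OF Q0(1)[OF that]] p d Q0(5,6)[OF that] by blast
  qed
  define Q where "Q = insert p (insert d Q0)"
  define \<epsilon> where "\<epsilon> = (\<lambda>q. if q = p \<or> q = d then 1 else Legendre (int p * int d) (int q))"
  obtain l where l: "prime l" "l mod 4 = 1" and lQ: "\<And>q. q \<in> Q \<Longrightarrow> Legendre (int l) (int q) = \<epsilon> q"
  proof (rule exists_prime_with_symbols[of Q \<epsilon> 1])
    show "finite Q" by (simp add: Q_def Q0_def)
    show "prime q \<and> odd q" if "q \<in> Q" for q using that p d odd_d Q0 by (auto simp: Q_def)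
    show "\<epsilon> q \<in> {-1, 1}" if "q \<in> Q" for q
    proof (cases "q = p \<or> q = d")
      case False
      hence "q \<in> Q0" using that by (simp add: Q_def)
      hence "Legendre (int p * int d) (int q) \<noteq> 0" using npd by (simp add: Legendre_eq_0_iff)
      thus ?thesis using False Legendre_values[of "int p * int d" "int q"] by (auto simp: \<epsilon>_def)
    qed (auto simp: \<epsilon>_def)
  qed auto
  have lp: "Legendre (int l) (int p) = 1" and ld: "Legendre (int l) (int d) = 1"
    using lQ[of p] lQ[of d] by (auto simp: Q_def \<epsilon>_def)
  have lq: "Legendre (int l) (int q) = Legendre (int p * int d) (int q)" if "q \<in> Q0" for q
    using lQ[of q] that Q0(5,6)[OF that] by (simp add: Q_def \<epsilon>_def)
  have odd_l: "odd l" using l(2) by presburger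
  have self: "Legendre (int l) (int l) = 0" by (simp add: Legendre_eq_0_iff)
  have l_ne: "l \<noteq> p" "l \<noteq> d" using lp ld self by auto
  have l_nQ0: "l \<notin> Q0"
  proof
    assume "l \<in> Q0"
    hence "Legendre (int p * int d) (int l) = 0" using lq self by simp
    thus False using npd[OF \<open>l \<in> Q0\<close>] by (simp add: Legendre_eq_0_iff)
  qed
  have l_nf0: "\<not> l dvd f0" using l_nQ0 l(1) pos by (auto simp: Q0_def in_prime_factors_iff)
  have l_npd: "\<not> l dvd p * d"
    using l_ne primes_dvd_imp_eq[OF l(1) p(1)] primes_dvd_imp_eq[OF l(1) d(1)] l(1)
    by (auto simp: prime_dvd_mult_iff)
  have Lf0p: "Legendre (int f0) (int p) = 1" by (rule Legendre_squarefree_part[OF p fp fg])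
  have Lf0d: "Legendre (int f0) (int d) = 1" by (rule Legendre_squarefree_part[OF d(1) odd_d fd fg])
  have Lpdq: "Legendre (int p * int d) (int q) = Legendre (int q) (int d)" if q: "q \<in> Q0" for q
  proof -
    have qN: "\<not> int q dvd int N"
    proof
      assume "int q dvd int N"
      hence "q dvd N" by simp
      hence "q dvd p * N\<^sup>2" by (simp add: power2_eq_square)
      moreover have "q dvd 1 + p * N\<^sup>2" using Q0(4)[OF q] by (simp only: f_def)
      ultimately have "q dvd 1" by (simp only: dvd_add_left_iff)
      thus False using Q0(1)[OF q] by auto
    qed
    have "int q dvd int f" using Q0(4)[OF q] by simp
    hence "[int p * (int N)\<^sup>2 = -1] (mod int q)" by (simp add: cong_iff_dvd_diff f_def add.commute)
    hence "Legendre (int p * (int N)\<^sup>2) (int q) = Legendre (-1) (int q)" by (rule Legendre_cong)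
    moreover have "Legendre (int p * (int N)\<^sup>2) (int q) = Legendre (int p) (int q)"
      using Legendre_mult[OF Q0(1,2)[OF q], of "int p" "(int N)\<^sup>2"] Legendre_sq[OF Q0(1)[OF q] qN] by simp
    ultimately have "Legendre (int p) (int q) = Legendre (-1) (int q)" by simp
    hence "Legendre (int p * int d) (int q) = Legendre (- int d) (int q)"
      using Legendre_mult[OF Q0(1,2)[OF q], of "int p" "int d"]
        Legendre_mult[OF Q0(1,2)[OF q], of "-1" "int d"] by simp
    also have "\<dots> = Legendre (int q) (int d)"
      using reciprocity_3mod4[OF d(1) Q0(1,2)[OF q] _ d(2)] Q0(6)[OF q] by auto
    finally show ?thesis .
  qed
  have f0prod: "int f0 = (\<Prod>q\<in>Q0. int q)"
    using arg_cong[OF squarefree_prod_primes[OF sqf], of int] by (simp add: Q0_def)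
  have "Legendre (int f0) (int l) = (\<Prod>q\<in>Q0. Legendre (int q) (int l))"
    unfolding f0prod by (rule Legendre_prod[OF l(1) odd_l])
  also have "\<dots> = (\<Prod>q\<in>Q0. Legendre (int q) (int d))"
  proof (rule prod.cong[OF refl])
    fix q assume q: "q \<in> Q0"
    have "l \<noteq> q" using q l_nQ0 by auto
    thus "Legendre (int q) (int l) = Legendre (int q) (int d)"
      using reciprocity_1mod4[OF l(1) Q0(1,2)[OF q] _ l(2)] lq[OF q] Lpdq[OF q] by simp
  qed
  also have "\<dots> = Legendre (int f0) (int d)"
    unfolding f0prod by (rule Legendre_prod[OF d(1) odd_d, symmetric])
  finally have Lf0l: "Legendre (int f0) (int l) = 1" using Lf0d by simp
  have Lpl: "Legendre (int p) (int l) = 1" using reciprocity_1mod4[OF l(1) p l_ne(1) l(2)] lp by simp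
  have Ldl: "Legendre (int d) (int l) = 1" using reciprocity_1mod4[OF l(1) d(1) odd_d l_ne(2) l(2)] ld by simp
  have m1: "Legendre (-1) (int l) = 1" using Legendre_minus_one[OF l(1) odd_l] l(2) by simp
  have sq_pd: "squarefree (p * d)"
    using p d pd by (intro squarefree_mult_coprime) (auto simp: primes_coprime squarefree_prime)
  obtain r where r: "int f0 dvd int (p * d) * r\<^sup>2 - int l"
  proof -
    have "\<exists>r. int q dvd int (p * d) * r\<^sup>2 - int l" if "prime q" "q dvd f0" for q
    proof -
      have q: "q \<in> Q0" using that pos by (auto simp: Q0_def in_prime_factors_iff)
      have "Legendre (int (p * d)) (int q) \<noteq> 0" using npd[OF q] by (simp add: Legendre_eq_0_iff)
      hence "Legendre (int (p * d) * int l) (int q) = 1"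
        using Legendre_mult[OF Q0(1,2)[OF q], of "int (p * d)" "int l"] lq[OF q]
          Legendre_values[of "int (p * d)" "int q"] by auto
      thus ?thesis using npd[OF q] by (intro Legendre_solve[OF Q0(1,2)[OF q]]) auto
    qed
    thus ?thesis using squarefree_solve[OF sqf, of "int (p * d)" "int l"] that by blast
  qed
  obtain s where s: "int (p * d) dvd int f0 * s\<^sup>2 - int l"
  proof -
    have "\<exists>s. int q dvd int f0 * s\<^sup>2 - int l" if "prime q" "q dvd p * d" for q
    proof -
      have "q = p \<or> q = d" using that p d by (auto simp: prime_dvd_mult_iff dest: primes_dvd_imp_eq)
      hence *: "Legendre (int f0) (int q) = 1" "Legendre (int l) (int q) = 1" "odd q"
        using Lf0p Lf0d lp ld p odd_d by auto
      hence "\<not> int q dvd int f0" by (metis Legendre_eq_0_iff zero_neq_one)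
      thus ?thesis using * that(1) Legendre_mult[OF that(1) *(3), of "int f0" "int l"]
        by (intro Legendre_solve) auto
    qed
    thus ?thesis using squarefree_solve[OF sq_pd, of "int f0" "int l"] that by blast
  qed
  obtain t where t: "int l dvd int f0 * t\<^sup>2 + int (p * d)"
  proof -
    have "Legendre (int f0 * (-1 * (int p * int d))) (int l) = 1"
      by (simp only: Legendre_mult[OF l(1) odd_l] Lf0l m1 Lpl Ldl)
    hence "\<exists>t. int l dvd int f0 * t\<^sup>2 - (-1 * (int p * int d))"
      using l_nf0 by (intro Legendre_solve[OF l(1) odd_l]) auto
    thus ?thesis using that by auto
  qed
  have cop: "coprime f0 (p * d)" "coprime (p * d) l" "coprime f0 l"
  proof -
    have "\<not> p dvd f0" "\<not> d dvd f0"
      using Q0(5)[of p] Q0(6)[of d] p d pos by (auto simp: Q0_def in_prime_factors_iff)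
    hence "coprime p f0" "coprime d f0" using p d prime_imp_coprime by blast+
    thus "coprime f0 (p * d)" by (simp add: coprime_commute)
    show "coprime (p * d) l" "coprime f0 l"
      using prime_imp_coprime[OF l(1) l_npd] prime_imp_coprime[OF l(1) l_nf0] by (auto simp: coprime_commute)
  qed
  have nsq: "p * d * l \<noteq> t\<^sup>2" for t by (rule prime_mult_not_square[OF l(1) l_npd])
  obtain x y z :: int where xyz: "int f0 * x\<^sup>2 + int (p * d) * y\<^sup>2 = int l * z\<^sup>2" "(x, y, z) \<noteq> (0, 0, 0)"
    using legendre_ternary[OF _ _ _ cop nsq r s t] pos p d l prime_gt_0_nat by auto
  have pd0: "int (p * d) > 0" using p d prime_gt_0_nat by simp
  have x0: "x \<noteq> 0"
  proof
    \<comment> \<open>otherwise \<open>p d l\<close> would be the square of \<open>l z / y\<close>\<close>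
    assume xz: "x = 0"
    hence e: "int (p * d) * y\<^sup>2 = int l * z\<^sup>2" using xyz xz by simp
    have yz: "y \<noteq> 0" using e xz xyz l by (auto simp: prime_gt_0_nat)
    have "int (p * d * l) * y\<^sup>2 = (int l * z)\<^sup>2" using e by (simp add: power2_eq_square mult_ac)
    hence e2: "(p * d * l) * (nat \<bar>y\<bar>)\<^sup>2 = (l * nat \<bar>z\<bar>)\<^sup>2"
    proof -
      assume a: "int (p * d * l) * y\<^sup>2 = (int l * z)\<^sup>2"
      have "int ((p * d * l) * (nat \<bar>y\<bar>)\<^sup>2) = int ((l * nat \<bar>z\<bar>)\<^sup>2)"
        using a by (simp add: power_mult_distrib)
      thus ?thesis by (simp only: of_nat_eq_iff)
    qed
    hence "(nat \<bar>y\<bar>)\<^sup>2 dvd (l * nat \<bar>z\<bar>)\<^sup>2" by (metis dvd_triv_right)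
    hence "nat \<bar>y\<bar> dvd l * nat \<bar>z\<bar>" by (simp add: pow_divides_pow_iff)
    then obtain k where "l * nat \<bar>z\<bar> = nat \<bar>y\<bar> * k" by (rule dvdE)
    hence "(p * d * l) * (nat \<bar>y\<bar>)\<^sup>2 = k\<^sup>2 * (nat \<bar>y\<bar>)\<^sup>2" using e2 by (simp add: power_mult_distrib mult_ac)
    hence "p * d * l = k\<^sup>2" using yz by simp
    thus False using nsq by blast
  qed
  obtain X Y Z :: int where XYZ: "X\<^sup>2 + int d * Y\<^sup>2 = int l * Z\<^sup>2" "Z \<noteq> 0"
    using norm_form_represents_prime[OF l(1,2) d ld] by blast
  define x' y' z' X' Y' Z' :: rat where defs: "x' = of_int x" "y' = of_int y" "z' = of_int z"
    "X' = of_int X" "Y' = of_int Y" "Z' = of_int Z"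
  define F L P D G :: rat where defs2: "F = of_nat f0" "L = of_nat l" "P = of_nat p" "D = of_nat d" "G = of_nat g"
  have E1: "F * x'\<^sup>2 + P * D * y'\<^sup>2 = L * z'\<^sup>2"
    using arg_cong[OF xyz(1), of "of_int :: int \<Rightarrow> rat"] by (simp add: defs defs2)
  have E2: "X'\<^sup>2 + D * Y'\<^sup>2 = L * Z'\<^sup>2"
    using arg_cong[OF XYZ(1), of "of_int :: int \<Rightarrow> rat"] by (simp add: defs defs2)
  have nz: "x' \<noteq> 0" "Z' \<noteq> 0" using x0 XYZ(2) by (auto simp: defs)
  have "1 + P * (of_int n)\<^sup>2 = of_nat f" by (simp add: f_def N2 defs2)
  hence fF: "1 + P * (of_int n)\<^sup>2 = F * G\<^sup>2" by (simp add: fg defs2)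
  have "F * G\<^sup>2 + P * D * (y' * G / x')\<^sup>2 = (F * x'\<^sup>2 + P * D * y'\<^sup>2) * (G / x')\<^sup>2"
    using nz by (simp add: power_divide power_mult_distrib field_simps)
  also have "\<dots> = (L * Z'\<^sup>2) * (z' * G / (x' * Z'))\<^sup>2"
    unfolding E1 using nz by (simp add: power_divide power_mult_distrib field_simps)
  also have "\<dots> = (X' * (z' * G / (x' * Z')))\<^sup>2 + D * (Y' * (z' * G / (x' * Z')))\<^sup>2"
    unfolding E2[symmetric] power_mult_distrib by (simp add: distrib_right)
  finally have "1 + P * (of_int n)\<^sup>2 + P * D * (y' * G / x')\<^sup>2
      = (X' * (z' * G / (x' * Z')))\<^sup>2 + D * (Y' * (z' * G / (x' * Z')))\<^sup>2"
    unfolding fF .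
  thus ?thesis unfolding defs2 by blast
qed

text \<open>
  The same method with the form \<open>x\<^sup>2 + l y\<^sup>2 = f\<^sub>0 z\<^sup>2\<close>, where \<open>f\<^sub>0\<close> is the squarefree part of \<open>f = 2 + 7 n\<^sup>2\<close>, and with \<open>l\<close> a sum of two squares.
  The symbol of \<open>l\<close> at a prime \<open>q\<close> dividing \<open>f\<^sub>0\<close> is chosen to be that of \<open>-1\<close>. The product of these symbols is \<open>1\<close>
  because \<open>f\<^sub>0\<close> is \<open>1\<close> modulo \<open>4\<close>, and this uses that \<open>n\<close> is odd.
\<close>

theorem three_squares_represent:
  fixes n :: int
  assumes n: "odd n"
  shows "\<exists>u x y :: rat. 2 + 7 * (of_int n)\<^sup>2 = u\<^sup>2 + x\<^sup>2 + y\<^sup>2"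
proof -
  define N where "N = nat \<bar>n\<bar>"
  have N2: "(of_int n :: rat)\<^sup>2 = (of_nat N)\<^sup>2" 
  proof -
    have "(int N)\<^sup>2 = n\<^sup>2" by (simp add: N_def)
    hence "(of_int ((int N)\<^sup>2) :: rat) = of_int (n\<^sup>2)" by (rule arg_cong)
    thus ?thesis by simp
  qed
  have oddN: "odd N" using n by (simp add: N_def even_nat_iff)
  define f where "f = 2 + 7 * N\<^sup>2"
  define f0 g where "f0 = squarefree_part f" and "g = square_part f"
  have fg: "f = f0 * g\<^sup>2" unfolding f0_def g_def by (rule squarefree_decompose)
  have sqf: "squarefree f0" by (simp add: f0_def)
  have pos: "f0 > 0" "g > 0" using fg by (auto intro!: Nat.gr0I simp: f_def)
  have sq4: "k\<^sup>2 mod 4 = 1" if odd_k: "odd k" for k :: nat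
  proof -
    obtain j where "k = 2 * j + 1" using odd_k by (rule oddE)
    hence "k\<^sup>2 = 4 * (j\<^sup>2 + j) + 1" by (simp add: power2_eq_square algebra_simps)
    thus ?thesis by simp
  qed
  have f4: "f mod 4 = 1" using sq4[OF oddN] unfolding f_def by presburger
  have "odd g"
  proof
    assume "even g"
    hence "even f" using fg by simp
    thus False using f4 by presburger
  qed
  hence "f0 * (g\<^sup>2 mod 4) mod 4 = f0 mod 4" using sq4 by simp
  hence f04: "f0 mod 4 = 1" using f4 fg by (simp add: mod_mult_right_eq)
  define Q where "Q = prime_factors f0"
  have Q: "prime q" "odd q" "q dvd f0" if "q \<in> Q" for q
  proof -
    show "prime q" and q: "q dvd f0" using that by (auto simp: Q_def in_prime_factors_iff)
    have "odd f0" using f04 by presburger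
    thus "odd q" using q by (meson dvd_trans)
  qed
  obtain l where l: "prime l" "l mod 4 = 1" and lq: "\<And>q. q \<in> Q \<Longrightarrow> Legendre (int l) (int q) = Legendre (-1) (int q)"
  proof (rule exists_prime_with_symbols[of Q "\<lambda>q. Legendre (-1) (int q)" 1])
    show "Legendre (-1) (int q) \<in> {-1, 1}" if "q \<in> Q" for q
      using Legendre_minus_one[OF Q(1,2)[OF that]] by simp
  qed (use Q in \<open>auto simp: Q_def\<close>)
  have odd_l: "odd l" using l(2) by presburger
  have m1: "Legendre (-1) (int l) = 1" using Legendre_minus_one[OF l(1) odd_l] l(2) by simp
  have l_nQ: "l \<notin> Q"
  proof
    assume "l \<in> Q"
    moreover have "Legendre (int l) (int l) = 0" by (simp add: Legendre_eq_0_iff)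
    ultimately show False using lq[of l] m1 by simp
  qed
  have l_nf0: "\<not> l dvd f0" using l_nQ l(1) pos by (auto simp: Q_def in_prime_factors_iff)
  have f0prod: "f0 = (\<Prod>q\<in>Q. q)" using squarefree_prod_primes[OF sqf] by (simp add: Q_def)
  have "real_of_int (Legendre (int f0) (int l)) = (\<Prod>q\<in>Q. sign_mod4 q)"
  proof -
    have "Legendre (int f0) (int l) = (\<Prod>q\<in>Q. Legendre (int q) (int l))"
      unfolding f0prod of_nat_prod by (rule Legendre_prod[OF l(1) odd_l])
    hence "real_of_int (Legendre (int f0) (int l)) = (\<Prod>q\<in>Q. real_of_int (Legendre (int q) (int l)))" by simp
    also have "\<dots> = (\<Prod>q\<in>Q. sign_mod4 q)"
    proof (rule prod.cong[OF refl])
      fix q assume q: "q \<in> Q"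
      have "l \<noteq> q" using q l_nQ by auto
      hence "Legendre (int q) (int l) = (if q mod 4 = 1 then 1 else -1)"
        using reciprocity_1mod4[OF l(1) Q(1,2)[OF q] _ l(2)] lq[OF q] Legendre_minus_one[OF Q(1,2)[OF q]] by simp
      moreover have "q mod 4 = 1 \<or> q mod 4 = 3" using Q(2)[OF q] by presburger
      ultimately show "real_of_int (Legendre (int q) (int l)) = sign_mod4 q" by (auto simp: sign_mod4_def)
    qed
    finally show ?thesis .
  qed
  also have "(\<Prod>q\<in>Q. sign_mod4 q) = sign_mod4 f0"
  proof -
    have *: "(\<Prod>q\<in>A. sign_mod4 q) = sign_mod4 (\<Prod>q\<in>A. q)" if "finite A" for A
      using that by (induction A rule: finite_induct) (simp_all add: sign_mod4_mult sign_mod4_one)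
    have "finite Q" by (simp add: Q_def)
    thus ?thesis by (subst f0prod) (rule *)
  qed
  finally have Lf0l: "Legendre (int f0) (int l) = 1" using f04 by (simp add: sign_mod4_def)
  obtain s where s: "int l dvd s\<^sup>2 - int f0" using Lf0l by (rule Legendre_eq_1D)
  obtain t where t: "int f0 dvd t\<^sup>2 + int l"
  proof -
    have "\<exists>t. int q dvd 1 * t\<^sup>2 - (- int l)" if "prime q" "q dvd f0" for q
    proof -
      have q: "q \<in> Q" using that pos by (auto simp: Q_def in_prime_factors_iff)
      have "Legendre (-1) (int q) * Legendre (-1) (int q) = 1"
        using Legendre_minus_one[OF Q(1,2)[OF q]] by simp
      hence "Legendre (1 * (- int l)) (int q) = 1"
        using Legendre_mult[OF Q(1,2)[OF q], of "-1" "int l"] lq[OF q] by simp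
      thus ?thesis using prime_gt_1_nat[OF that(1)]
        by (intro Legendre_solve[OF Q(1,2)[OF q]]) (auto simp: zdvd1_eq)
    qed
    thus ?thesis using squarefree_solve[OF sqf, of 1 "- int l"] that by auto
  qed
  have cop: "coprime l f0" using prime_imp_coprime[OF l(1) l_nf0] .
  have nsq: "l * f0 \<noteq> t\<^sup>2" for t using prime_mult_not_square[OF l(1) l_nf0, of t] by (simp add: mult.commute)
  obtain x y z :: int where xyz: "x\<^sup>2 + int l * y\<^sup>2 = int f0 * z\<^sup>2" "(x, y, z) \<noteq> (0, 0, 0)"
    using legendre_ternary[of 1 l f0 0 s t] cop nsq s t pos prime_gt_0_nat[OF l(1)] by auto
  have z0: "z \<noteq> 0"
  proof
    assume "z = 0"
    hence "x\<^sup>2 + int l * y\<^sup>2 = 0" using xyz by simp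
    moreover have "x\<^sup>2 \<ge> 0" "int l * y\<^sup>2 \<ge> 0" by auto
    ultimately have "x\<^sup>2 = 0" "int l * y\<^sup>2 = 0" by linarith+
    thus False using xyz \<open>z = 0\<close> prime_gt_0_nat[OF l(1)] by auto
  qed
  obtain t' where t': "int l dvd t'\<^sup>2 - (-1)" using m1 by (rule Legendre_eq_1D)
  obtain X Y Z :: int where XYZ: "X\<^sup>2 + Y\<^sup>2 = int l * Z\<^sup>2" "(X, Y, Z) \<noteq> (0, 0, 0)"
  proof (rule legendre_ternary[of 1 1 l 0 0 t'])
    show "1 * l \<noteq> t\<^sup>2" for t by (rule prime_mult_not_square[OF l(1)]) (use l(1) in auto)
    fix X Y Z :: int
    assume "int 1 * X\<^sup>2 + int 1 * Y\<^sup>2 = int l * Z\<^sup>2" "(X, Y, Z) \<noteq> (0, 0, 0)"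
    thus thesis using that[of X Y Z] by simp
  qed (use t' prime_gt_0_nat[OF l(1)] in auto)
  have Z0: "Z \<noteq> 0"
  proof
    assume "Z = 0"
    hence "X\<^sup>2 + Y\<^sup>2 = 0" using XYZ by simp
    thus False using XYZ \<open>Z = 0\<close> by (simp add: sum_power2_eq_zero_iff)
  qed
  define x' y' z' X' Y' Z' :: rat where defs: "x' = of_int x" "y' = of_int y" "z' = of_int z"
    "X' = of_int X" "Y' = of_int Y" "Z' = of_int Z"
  define F L G :: rat where defs2: "F = of_nat f0" "L = of_nat l" "G = of_nat g"
  have E1: "x'\<^sup>2 + L * y'\<^sup>2 = F * z'\<^sup>2"
    using arg_cong[OF xyz(1), of "of_int :: int \<Rightarrow> rat"] by (simp add: defs defs2)
  have E2: "X'\<^sup>2 + Y'\<^sup>2 = L * Z'\<^sup>2"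
    using arg_cong[OF XYZ(1), of "of_int :: int \<Rightarrow> rat"] by (simp add: defs defs2)
  have nz: "z' \<noteq> 0" "Z' \<noteq> 0" using z0 Z0 by (auto simp: defs)
  have "2 + 7 * (of_int n)\<^sup>2 = (of_nat f :: rat)" by (simp add: f_def N2)
  also have "\<dots> = F * G\<^sup>2" by (simp add: fg defs2)
  also have "\<dots> = (F * z'\<^sup>2) * (G / z')\<^sup>2" using nz by (simp add: power_divide)
  also have "\<dots> = (x' * (G / z'))\<^sup>2 + (L * Z'\<^sup>2) * (y' * G / (z' * Z'))\<^sup>2"
    unfolding E1[symmetric] using nz by (simp add: power_divide power_mult_distrib field_simps)
  also have "\<dots> = (x' * (G / z'))\<^sup>2 + (X' * (y' * G / (z' * Z')))\<^sup>2 + (Y' * (y' * G / (z' * Z')))\<^sup>2"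
    unfolding E2[symmetric] power_mult_distrib by (simp add: distrib_right)
  finally show ?thesis by blast
qed

section \<open>Local obstructions\<close>

text \<open>
  The local ring \<open>\<int>\<^sub>(\<^sub>p\<^sub>)\<close> as a set of rationals, for a prime \<open>p\<close>.
\<close>

definition local_ring :: "nat \<Rightarrow> rat set" where
  "local_ring p = {x. \<exists>a b. x = of_int a / of_int b \<and> \<not> int p dvd b}"

lemma not_in_local_ringE:
  assumes "x \<notin> local_ring p"
  obtains a b where "x = of_int a / of_int b" "b \<noteq> 0" "coprime a b" "int p dvd b"
proof -
  obtain a b where ab: "quotient_of x = (a, b)" by fastforce
  have x: "x = of_int a / of_int b" using quotient_of_div[OF ab] .
  moreover have "b \<noteq> 0" using quotient_of_denom_pos[OF ab] by simp
  moreover have "coprime a b" using quotient_of_coprime[OF ab] .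
  moreover have "int p dvd b" using assms x by (auto simp: local_ring_def)
  ultimately show ?thesis using that by blast
qed

lemma common_denominator:
  fixes xs :: "rat list"
  shows "\<exists>D::int. D \<noteq> 0 \<and> (\<forall>x\<in>set xs. \<exists>k. of_int D * x = of_int k)"
proof (induction xs)
  case (Cons x xs)
  then obtain D where D: "D \<noteq> 0" "\<forall>y\<in>set xs. \<exists>k. of_int D * y = of_int k" by blast
  obtain a b where ab: "quotient_of x = (a, b)" by fastforce
  have x: "x = of_int a / of_int b" and b: "b \<noteq> 0"
    using quotient_of_div[OF ab] quotient_of_denom_pos[OF ab] by auto
  have "\<exists>k. of_int (D * b) * y = of_int k" if "y \<in> set (x # xs)" for y
  proof (cases "y = x")
    case True
    hence "of_int (D * b) * y = of_int (D * a)" using x b by simp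
    thus ?thesis by blast
  next
    case False
    hence "y \<in> set xs" using that by simp
    then obtain k where "of_int D * y = of_int k" using D(2) by blast
    hence "of_int (D * b) * y = of_int (k * b)" by (simp add: mult_ac)
    thus ?thesis by blast
  qed
  thus ?case using D(1) b by (intro exI[of _ "D * b"]) auto
qed (auto intro: exI[of _ 1])

lemma anisotropic_mod_prime:
  fixes a b d :: int
  assumes p: "prime p" and d: "Legendre (- d) (int p) = -1" and dv: "int p dvd a\<^sup>2 + d * b\<^sup>2"
  shows "int p dvd a \<and> int p dvd b"
proof -
  have pp: "prime (int p)" using p by simp
  have "int p dvd b"
  proof (rule ccontr)
    assume nb: "\<not> int p dvd b"
    then obtain b' where b': "[b * b' = 1] (mod int p)"
      using cong_solve_coprime_int[of b "int p"] prime_imp_coprime[OF pp nb] by (auto simp: coprime_commute)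
    have "[(a * b')\<^sup>2 = a\<^sup>2 * b'\<^sup>2] (mod int p)" by (simp add: power_mult_distrib)
    also have "[a\<^sup>2 * b'\<^sup>2 = (- d * b\<^sup>2) * b'\<^sup>2] (mod int p)"
      by (rule cong_mult) (use dv in \<open>simp_all add: cong_iff_dvd_diff\<close>)
    also have "(- d * b\<^sup>2) * b'\<^sup>2 = - d * (b * b')\<^sup>2" by (simp add: power_mult_distrib)
    also have "[- d * (b * b')\<^sup>2 = - d * 1\<^sup>2] (mod int p)"
      by (intro cong_mult cong_pow b' cong_refl)
    finally have "QuadRes (int p) (- d)" unfolding QuadRes_def by auto
    thus False using d by (auto simp: Legendre_def split: if_splits)
  qed
  moreover have "int p dvd a"
  proof -
    have "int p dvd d * b\<^sup>2" using \<open>int p dvd b\<close> by (simp add: power2_eq_square)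
    hence "int p dvd a\<^sup>2" using dv by (simp only: dvd_add_left_iff)
    thus ?thesis using pp prime_dvd_power by blast
  qed
  ultimately show ?thesis by blast
qed

text \<open>
  Infinite descent: both sides are norms up to factors, and a norm divisible by \<open>p\<close> has both coordinates
  divisible by \<open>p\<close>. Used once for each side this divides all four variables by \<open>p\<close>.
\<close>

lemma quaternary_anisotropic_odd:
  fixes m w z u x y d :: int
  assumes p: "prime p" and d: "Legendre (- d) (int p) = -1"
    and m: "[m = w\<^sup>2] (mod int p)" "\<not> int p dvd w"
    and eq: "int p * m * z\<^sup>2 + int p * d * u\<^sup>2 = x\<^sup>2 + d * y\<^sup>2"
  shows "z = 0"
  using eq
proof (induction "nat \<bar>z\<bar>" arbitrary: z u x y rule: less_induct)
  case less
  have pp: "prime (int p)" using p by simp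
  have p1: "int p > 1" using prime_gt_1_nat[OF p] by simp
  have "x\<^sup>2 + d * y\<^sup>2 = int p * (m * z\<^sup>2 + d * u\<^sup>2)" using less.prems by (simp add: algebra_simps)
  hence "int p dvd x\<^sup>2 + d * y\<^sup>2" by simp
  hence "int p dvd x" "int p dvd y" using anisotropic_mod_prime[OF p d, of x y] by blast+
  then obtain x' y' where x': "x = int p * x'" "y = int p * y'" unfolding dvd_def by blast
  have "int p * (m * z\<^sup>2 + d * u\<^sup>2) = int p * (int p * (x'\<^sup>2 + d * y'\<^sup>2))"
    using less.prems x' by (simp add: power2_eq_square algebra_simps)
  hence e1: "m * z\<^sup>2 + d * u\<^sup>2 = int p * (x'\<^sup>2 + d * y'\<^sup>2)" using p1 by simp
  have "[(w * z)\<^sup>2 + d * u\<^sup>2 = m * z\<^sup>2 + d * u\<^sup>2] (mod int p)"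
    unfolding power_mult_distrib by (intro cong_add cong_mult cong_sym[OF m(1)] cong_refl)
  moreover have "int p dvd m * z\<^sup>2 + d * u\<^sup>2" unfolding e1 by simp
  ultimately have "int p dvd (w * z)\<^sup>2 + d * u\<^sup>2" using cong_dvd_iff by blast
  hence dv: "int p dvd w * z" "int p dvd u" using anisotropic_mod_prime[OF p d, of "w * z" u] by blast+
  have "int p dvd z" using prime_dvd_multD[OF pp dv(1)] m(2) by blast
  then obtain z' where z'1: "z = int p * z'" by (rule dvdE)
  obtain u' where z'2: "u = int p * u'" using dv(2) by (rule dvdE)
  note z' = z'1 z'2
  have "int p * (int p * m * z'\<^sup>2 + int p * d * u'\<^sup>2) = int p * (x'\<^sup>2 + d * y'\<^sup>2)"
    using e1 z' by (simp add: power2_eq_square algebra_simps)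
  hence e2: "int p * m * z'\<^sup>2 + int p * d * u'\<^sup>2 = x'\<^sup>2 + d * y'\<^sup>2" using p1 by simp
  show "z = 0"
  proof (rule ccontr)
    assume "z \<noteq> 0"
    hence "z' \<noteq> 0" using z' by auto
    hence "\<bar>z'\<bar> < \<bar>z\<bar>" using z'(1) p1 by (simp add: abs_mult)
    hence "nat \<bar>z'\<bar> < nat \<bar>z\<bar>" by simp
    from less.hyps[OF this e2] show False using \<open>z' \<noteq> 0\<close> by simp
  qed
qed

lemma square_mod_8: "(even x \<longrightarrow> x\<^sup>2 mod 8 \<in> {0, 4}) \<and> (odd x \<longrightarrow> x\<^sup>2 mod 8 = 1)" for x :: int
proof -
  have "x mod 8 \<in> {0,1,2,3,4,5,6,7}"
    using pos_mod_bound[of 8 x] pos_mod_sign[of 8 x] by auto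
  moreover have "x\<^sup>2 mod 8 = (x mod 8)\<^sup>2 mod 8" by (simp add: power_mod)
  moreover have "even x \<longleftrightarrow> even (x mod 8)" by presburger
  ultimately show ?thesis by auto
qed

lemma mod_add3: "(a + b + c) mod m = (a mod m + b mod m + c mod m) mod m" for a b c m :: int
proof -
  have "(a mod m + b mod m + c mod m) mod m = ((a mod m + b mod m) mod m + c mod m) mod m"
    by (rule mod_add_left_eq[symmetric])
  also have "(a mod m + b mod m) mod m = (a + b) mod m" by (rule mod_add_eq)
  also have "((a + b) mod m + c mod m) mod m = (a + b + c) mod m" by (rule mod_add_eq)
  finally show ?thesis ..
qed

text \<open>
  A sum of three squares is not \<open>7\<close> modulo \<open>8\<close>, and it is divisible by \<open>4\<close> only if all three are even.
\<close>

lemma three_squares_anisotropic: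
  fixes m z u x y :: int
  assumes m: "m mod 8 = 7" and eq: "m * z\<^sup>2 = u\<^sup>2 + x\<^sup>2 + y\<^sup>2"
  shows "z = 0"
  using eq
proof (induction "nat \<bar>z\<bar>" arbitrary: z u x y rule: less_induct)
  case less
  note sq = square_mod_8
  have "even z"
  proof (rule ccontr)
    assume "odd z"
    hence m7: "(m * z\<^sup>2) mod 8 = 7" using m sq[of z] by (simp add: mod_mult_eq[of m 8, symmetric])
    have sq8: "k\<^sup>2 mod 8 = 0 \<or> k\<^sup>2 mod 8 = 1 \<or> k\<^sup>2 mod 8 = 4" for k :: int using sq[of k] by auto
    have ne7: "(a + b + c) mod 8 \<noteq> 7"
      if "a mod 8 = 0 \<or> a mod 8 = 1 \<or> a mod 8 = 4" "b mod 8 = 0 \<or> b mod 8 = 1 \<or> b mod 8 = 4"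
        "c mod 8 = 0 \<or> c mod 8 = 1 \<or> c mod 8 = 4" for a b c :: int
    proof -
      have "(a + b + c) mod 8 = (a mod 8 + b mod 8 + c mod 8) mod 8" by (rule mod_add3)
      thus ?thesis using that by auto
    qed
    have "(u\<^sup>2 + x\<^sup>2 + y\<^sup>2) mod 8 \<noteq> 7" by (rule ne7) (rule sq8)+
    with m7 show False using less.prems by simp
  qed
  then obtain z' where z': "z = 2 * z'" by (rule evenE)
  have "u\<^sup>2 + x\<^sup>2 + y\<^sup>2 = 4 * (m * z'\<^sup>2)"
    using less.prems by (simp add: z' power_mult_distrib)
  hence sum4: "(u\<^sup>2 + x\<^sup>2 + y\<^sup>2) mod 4 = 0" by simp
  have sq4: "(even k \<and> k\<^sup>2 mod 4 = 0) \<or> (odd k \<and> k\<^sup>2 mod 4 = 1)" for k :: int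
  proof -
    have h0: "a mod 4 = 0" if "a mod 8 = 0 \<or> a mod 8 = 4" for a :: int using that by presburger
    have h1: "a mod 4 = 1" if "a mod 8 = 1" for a :: int using that by presburger
    show ?thesis using sq[of k] h0[of "k\<^sup>2"] h1[of "k\<^sup>2"] by (cases "even k") auto
  qed
  have zero4: "a mod 4 = 0 \<and> b mod 4 = 0 \<and> c mod 4 = 0"
    if "(a + b + c) mod 4 = 0" "a mod 4 = 0 \<or> a mod 4 = 1" "b mod 4 = 0 \<or> b mod 4 = 1"
      "c mod 4 = 0 \<or> c mod 4 = 1" for a b c :: int
  proof -
    have "(a + b + c) mod 4 = (a mod 4 + b mod 4 + c mod 4) mod 4" by (rule mod_add3)
    thus ?thesis using that by auto
  qed
  have "u\<^sup>2 mod 4 = 0 \<and> x\<^sup>2 mod 4 = 0 \<and> y\<^sup>2 mod 4 = 0"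
    by (rule zero4[OF sum4]) (use sq4[of u] sq4[of x] sq4[of y] in auto)
  hence "even u \<and> even x \<and> even y" using sq4[of u] sq4[of x] sq4[of y] by auto
  then obtain u' x' y' where *: "u = 2 * u'" "x = 2 * x'" "y = 2 * y'" unfolding dvd_def by blast
  have e: "m * z'\<^sup>2 = u'\<^sup>2 + x'\<^sup>2 + y'\<^sup>2"
    using less.prems by (simp add: z' * power_mult_distrib)
  show "z = 0"
  proof (rule ccontr)
    assume "z \<noteq> 0"
    hence "nat \<bar>z'\<bar> < nat \<bar>z\<bar>" using z' by auto
    from less.hyps[OF this e] show False using \<open>z \<noteq> 0\<close> z' by simp
  qed
qed

text \<open>
  For \<open>n = a / b\<close> in lowest terms with \<open>b = p c\<close> one has \<open>1 + p n\<^sup>2 = p (a\<^sup>2 + p c\<^sup>2) / b\<^sup>2\<close>, and \<open>a\<^sup>2 + p c\<^sup>2\<close> is a nonzero square modulo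
  \<open>p\<close>. Clearing denominators gives an integral solution that contradicts the descent.
\<close>

lemma odd_condition_integral:
  fixes n u x y :: rat and p :: nat and d :: int
  assumes p: "prime p" and d: "Legendre (- d) (int p) = -1"
    and eq: "1 + of_nat p * n\<^sup>2 + of_nat p * of_int d * u\<^sup>2 = x\<^sup>2 + of_int d * y\<^sup>2"
  shows "n \<in> local_ring p"
proof (rule ccontr)
  assume "n \<notin> local_ring p"
  then obtain a b where ab: "n = of_int a / of_int b" "b \<noteq> 0" "coprime a b" "int p dvd b"
    by (rule not_in_local_ringE)
  obtain c where c: "b = int p * c" using ab(4) by (auto elim: dvdE)
  have pp: "prime (int p)" using p by simp
  have na: "\<not> int p dvd a"
  proof
    assume "int p dvd a"
    hence "is_unit (int p)" by (rule coprime_common_divisor[OF ab(3) _ ab(4)])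
    thus False using pp by (simp add: not_prime_unit)
  qed
  obtain D where D: "D \<noteq> 0" "\<forall>v\<in>set [1 / of_int b, u, x, y]. \<exists>k. of_int D * v = (of_int k :: rat)"
    using common_denominator by blast
  obtain z U X Y where ints: "of_int D * (1 / of_int b) = (of_int z :: rat)" "of_int D * u = of_int U"
      "of_int D * x = of_int X" "of_int D * y = of_int Y"
    using D(2) by auto
  define m where "m = a\<^sup>2 + int p * c\<^sup>2"
  have fm: "1 + of_nat p * n\<^sup>2 = of_nat p * of_int m * (1 / of_int b :: rat)\<^sup>2"
    using ab(2) unfolding ab(1) m_def c by (simp add: field_simps power2_eq_square)
  have "of_int (int p * m * z\<^sup>2 + int p * d * U\<^sup>2) = (of_int (X\<^sup>2 + d * Y\<^sup>2) :: rat)"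
  proof -
    have "of_int (int p * m * z\<^sup>2 + int p * d * U\<^sup>2)
        = of_nat p * of_int m * (of_int z)\<^sup>2 + of_nat p * of_int d * (of_int U :: rat)\<^sup>2" by simp
    also have "\<dots> = (of_int D)\<^sup>2 * (of_nat p * of_int m * (1 / of_int b)\<^sup>2 + of_nat p * of_int d * u\<^sup>2)"
      unfolding ints(1,2)[symmetric] power_mult_distrib by (simp add: algebra_simps)
    also have "\<dots> = (of_int D)\<^sup>2 * (x\<^sup>2 + of_int d * y\<^sup>2)" using eq fm by simp
    also have "\<dots> = (of_int X)\<^sup>2 + of_int d * (of_int Y)\<^sup>2"
      unfolding ints(3,4)[symmetric] power_mult_distrib by (simp add: algebra_simps)
    finally show ?thesis by simp
  qed
  hence "int p * m * z\<^sup>2 + int p * d * U\<^sup>2 = X\<^sup>2 + d * Y\<^sup>2" by (simp only: of_int_eq_iff)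
  moreover have "[m = a\<^sup>2] (mod int p)" by (simp add: m_def cong_iff_dvd_diff)
  ultimately have "z = 0" using quaternary_anisotropic_odd[OF p d _ na] by blast
  thus False using ints(1) D(1) ab(2) by simp
qed

text \<open>
  For \<open>n = a / b\<close> in lowest terms with \<open>b = 2 c\<close> one has \<open>2 + 7 n\<^sup>2 = (8 c\<^sup>2 + 7 a\<^sup>2) / b\<^sup>2\<close> with \<open>a\<close> odd.
\<close>

lemma two_condition_integral:
  fixes n u x y :: rat
  assumes eq: "2 + 7 * n\<^sup>2 = u\<^sup>2 + x\<^sup>2 + y\<^sup>2"
  shows "n \<in> local_ring 2"
proof (rule ccontr)
  assume "n \<notin> local_ring 2"
  then obtain a b where ab: "n = of_int a / of_int b" "b \<noteq> 0" "coprime a b" "int 2 dvd b"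
    by (rule not_in_local_ringE)
  obtain c where c: "b = 2 * c" using ab(4) by (auto elim: dvdE)
  have oa: "odd a"
  proof
    assume "even a"
    hence "is_unit (2::int)" using ab(4) by (intro coprime_common_divisor[OF ab(3)]) auto
    thus False by simp
  qed
  obtain D where D: "D \<noteq> 0" "\<forall>v\<in>set [1 / of_int b, u, x, y]. \<exists>k. of_int D * v = (of_int k :: rat)"
    using common_denominator by blast
  obtain z U X Y where ints: "of_int D * (1 / of_int b) = (of_int z :: rat)" "of_int D * u = of_int U"
      "of_int D * x = of_int X" "of_int D * y = of_int Y"
    using D(2) by auto
  define m where "m = 8 * c\<^sup>2 + 7 * a\<^sup>2"
  have "a\<^sup>2 mod 8 = 1" using square_mod_8[of a] oa by auto
  hence m: "m mod 8 = 7" unfolding m_def by presburger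
  have fm: "2 + 7 * n\<^sup>2 = of_int m * (1 / of_int b :: rat)\<^sup>2"
    using ab(2) unfolding ab(1) m_def c by (simp add: field_simps power2_eq_square)
  have "of_int (m * z\<^sup>2) = (of_int (U\<^sup>2 + X\<^sup>2 + Y\<^sup>2) :: rat)"
  proof -
    have "of_int (m * z\<^sup>2) = of_int m * (of_int z :: rat)\<^sup>2" by simp
    also have "\<dots> = (of_int D)\<^sup>2 * (of_int m * (1 / of_int b)\<^sup>2)"
      unfolding ints(1)[symmetric] power_mult_distrib by (simp add: algebra_simps)
    also have "\<dots> = (of_int D)\<^sup>2 * (u\<^sup>2 + x\<^sup>2 + y\<^sup>2)" using eq fm by simp
    also have "\<dots> = (of_int U)\<^sup>2 + (of_int X)\<^sup>2 + (of_int Y)\<^sup>2"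
      unfolding ints(2-4)[symmetric] power_mult_distrib by (simp add: algebra_simps)
    finally show ?thesis by simp
  qed
  hence "m * z\<^sup>2 = U\<^sup>2 + X\<^sup>2 + Y\<^sup>2" by (simp only: of_int_eq_iff)
  hence "z = 0" by (rule three_squares_anisotropic[OF m])
  thus False using ints(1) D(1) ab(2) by simp
qed

text \<open>
  A denominator \<open>b\<close> prime to \<open>p\<close> can be multiplied by its inverse modulo \<open>p\<close>, which gives a denominator of the form
  \<open>1 + p e\<close>. Conversely \<open>1 + p t\<close> is a unit of the local ring for every element \<open>t\<close> of it.
\<close>

lemma local_ring_eq_of_integers:
  assumes p: "prime p" and Z: "\<And>k. of_int k \<in> J" and J: "J \<subseteq> local_ring p"
  shows "x \<in> local_ring p \<longleftrightarrow> (\<exists>t1\<in>J. \<exists>t2\<in>J. x * (1 + of_nat p * t2) = t1)"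
proof
  have pp: "prime (int p)" using p by simp
  {
    assume "x \<in> local_ring p"
    then obtain a b where ab: "x = of_int a / of_int b" "\<not> int p dvd b" by (auto simp: local_ring_def)
    have b0: "b \<noteq> 0" using ab(2) by auto
    have "coprime b (int p)" using prime_imp_coprime[OF pp ab(2)] by (simp add: coprime_commute)
    then obtain b' where "[b * b' = 1] (mod int p)" using cong_solve_coprime_int by blast
    then obtain e where e: "b * b' - 1 = int p * e" by (auto simp: cong_iff_dvd_diff elim: dvdE)
    have "1 + of_nat p * of_int e = (of_int (1 + int p * e) :: rat)" by simp
    also have "1 + int p * e = b * b'" using e by simp
    finally have "x * (1 + of_nat p * of_int e) = of_int (a * b')" using b0 by (simp add: ab(1))
    thus "\<exists>t1\<in>J. \<exists>t2\<in>J. x * (1 + of_nat p * t2) = t1" using Z by blast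
  }
  {
    assume "\<exists>t1\<in>J. \<exists>t2\<in>J. x * (1 + of_nat p * t2) = t1"
    then obtain t1 t2 where t: "t1 \<in> J" "t2 \<in> J" "x * (1 + of_nat p * t2) = t1" by blast
    obtain a b where ab: "t2 = of_int a / of_int b" "\<not> int p dvd b" using t J by (auto simp: local_ring_def)
    obtain c e where ce: "t1 = of_int c / of_int e" "\<not> int p dvd e" using t J by (auto simp: local_ring_def)
    have nz: "b \<noteq> 0" "e \<noteq> 0" using ab ce by auto
    have nd: "\<not> int p dvd b + int p * a" using ab(2) by (simp add: dvd_add_left_iff)
    hence nz': "b + int p * a \<noteq> 0" by auto
    have "1 + of_nat p * t2 = of_int (b + int p * a) / of_int b" using nz by (simp add: ab(1) field_simps)
    hence "x * (of_int (b + int p * a) / of_int b) = of_int c / of_int e" using t(3) ce(1) by simp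
    hence "x = of_int (c * b) / of_int (e * (b + int p * a))"
      using nz nz' by (simp only: of_int_mult) (simp add: divide_simps mult_ac del: of_int_add)
    moreover have "\<not> int p dvd e * (b + int p * a)" using nd ce(2) pp by (simp add: prime_dvd_mult_iff)
    ultimately show "x \<in> local_ring p" unfolding local_ring_def by blast
  }
qed

text \<open>
  The factor \<open>2 d\<close> makes every integer \<open>t\<close> meet the divisibility condition of \<open>norm_form_represents_odd\<close>.
\<close>

definition odd_integer_test :: "nat \<Rightarrow> nat \<Rightarrow> rat \<Rightarrow> bool" where
  "odd_integer_test p d t \<longleftrightarrow> (\<exists>u x y. 1 + of_nat p * (2 * of_nat d * t)\<^sup>2 + of_nat p * of_nat d * u\<^sup>2
     = x\<^sup>2 + of_nat d * y\<^sup>2)"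

text \<open>
  Three squares represent \<open>2 + 7 n\<^sup>2\<close> for odd \<open>n\<close>, and one of \<open>t\<close> and \<open>t + 1\<close> is odd.
\<close>

definition even_integer_test :: "rat \<Rightarrow> bool" where
  "even_integer_test t \<longleftrightarrow>
     (\<exists>u x y. 2 + 7 * t\<^sup>2 = u\<^sup>2 + x\<^sup>2 + y\<^sup>2 \<or> 2 + 7 * (t + 1)\<^sup>2 = u\<^sup>2 + x\<^sup>2 + y\<^sup>2)"

lemma odd_integer_test_exists:
  assumes p: "prime p" "odd p"
  obtains d where "\<And>k. odd_integer_test p d (of_int k)" "\<And>t. odd_integer_test p d t \<Longrightarrow> t \<in> local_ring p"
proof -
  have v: "Legendre (-1) (int p) \<in> {-1, 1}" using Legendre_minus_one[OF p] by simp
  obtain d where d: "prime d" "d mod 4 = 3" and dp: "Legendre (int d) (int p) = - Legendre (-1) (int p)"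
  proof (rule exists_prime_with_symbols[of "{p}" "\<lambda>_. - Legendre (-1) (int p)" 3])
  qed (use p v in auto)
  have nr: "Legendre (- int d) (int p) = -1"
    using Legendre_mult[OF p, of "-1" "int d"] dp v by auto
  have pd: "p \<noteq> d"
  proof
    assume "p = d"
    hence "Legendre (int d) (int p) = 0" by (simp add: Legendre_eq_0_iff)
    thus False using dp v by auto
  qed
  have "odd_integer_test p d (of_int k)" for k
    using norm_form_represents_odd[OF p d pd, of "2 * int d * k"] by (simp add: odd_integer_test_def)
  moreover have "t \<in> local_ring p" if t: "odd_integer_test p d t" for t
  proof -
    have "2 * of_nat d * t \<in> local_ring p"
      using t odd_condition_integral[OF p(1) nr] by (auto simp: odd_integer_test_def)
    then obtain a b where ab: "2 * of_nat d * t = of_int a / of_int b" "\<not> int p dvd b"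
      by (auto simp: local_ring_def)
    have pp: "prime (int p)" using p by simp
    have d0: "d > 0" using d(1) prime_gt_0_nat by blast
    have "t = of_int a / (of_int b * (2 * of_nat d))"
    proof -
      have "t = (2 * of_nat d * t) / (2 * of_nat d)" using d0 by simp
      thus ?thesis unfolding ab(1) by simp
    qed
    hence "t = of_int a / of_int (b * (2 * int d))" by simp
    moreover have "\<not> int p dvd 2 * int d"
    proof -
      have "\<not> p dvd 2 * d"
        using p pd primes_dvd_imp_eq[OF p(1) d(1)] primes_dvd_imp_eq[OF p(1) two_is_prime_nat]
        by (auto simp: prime_dvd_mult_iff)
      thus ?thesis by (metis of_nat_dvd_iff of_nat_mult of_nat_numeral)
    qed
    hence "\<not> int p dvd b * (2 * int d)" using pp ab(2) by (simp add: prime_dvd_mult_iff)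
    ultimately show ?thesis unfolding local_ring_def by blast
  qed
  ultimately show ?thesis using that by blast
qed

lemma even_integer_test_of_int: "even_integer_test (of_int k)"
proof (cases "odd k")
  case True
  thus ?thesis using three_squares_represent[of k] by (auto simp: even_integer_test_def)
next
  case False
  hence "odd (k + 1)" by simp
  from three_squares_represent[OF this] show ?thesis by (auto simp: even_integer_test_def)
qed

lemma even_integer_test_integral:
  assumes "even_integer_test t"
  shows "t \<in> local_ring 2"
proof -
  have "t \<in> local_ring 2 \<or> t + 1 \<in> local_ring 2"
    using assms two_condition_integral unfolding even_integer_test_def by blast
  thus ?thesis
  proof
    assume "t + 1 \<in> local_ring 2"
    then obtain a b where ab: "t + 1 = of_int a / of_int b" "\<not> int 2 dvd b" by (auto simp: local_ring_def)
    have "b \<noteq> 0" using ab(2) by auto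
    hence "t = of_int (a - b) / of_int b" using ab(1) by (simp add: field_simps)
    thus ?thesis using ab(2) unfolding local_ring_def by blast
  qed
qed

section \<open>Polynomial functions\<close>

definition monomial_value :: "(nat \<Rightarrow> rat) \<Rightarrow> (nat \<Rightarrow>\<^sub>0 nat) \<Rightarrow> rat" where
  "monomial_value v m = (\<Prod>i\<in>Poly_Mapping.keys m. v i ^ Poly_Mapping.lookup m i)"

lemma eval_mpoly_superset:
  assumes "finite K" "Poly_Mapping.keys f \<subseteq> K"
  shows "eval_mpoly v f = (\<Sum>m\<in>K. Poly_Mapping.lookup f m * monomial_value v m)"
  unfolding eval_mpoly_def monomial_value_def
  by (rule sum.mono_neutral_left) (use assms in \<open>auto simp: in_keys_iff\<close>)

lemma monomial_value_superset:
  assumes "finite K" "Poly_Mapping.keys m \<subseteq> K"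
  shows "monomial_value v m = (\<Prod>i\<in>K. v i ^ Poly_Mapping.lookup m i)"
  unfolding monomial_value_def
  by (rule prod.mono_neutral_left) (use assms in \<open>auto simp: in_keys_iff\<close>)

lemma monomial_value_add: "monomial_value v (m + m') = monomial_value v m * monomial_value v m'"
proof -
  let ?K = "Poly_Mapping.keys m \<union> Poly_Mapping.keys m'"
  have "Poly_Mapping.keys (m + m') \<subseteq> ?K" by (rule keys_add)
  thus ?thesis
    by (simp add: monomial_value_superset[of ?K] lookup_add power_add prod.distrib)
qed

lemma eval_mpoly_add: "eval_mpoly v (f + g) = eval_mpoly v f + eval_mpoly v g"
proof -
  let ?K = "Poly_Mapping.keys f \<union> Poly_Mapping.keys g"
  have "Poly_Mapping.keys (f + g) \<subseteq> ?K" by (rule keys_add)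
  thus ?thesis
    by (simp add: eval_mpoly_superset[of ?K] lookup_add algebra_simps sum.distrib)
qed

lemma eval_mpoly_zero: "eval_mpoly v 0 = 0"
  by (simp add: eval_mpoly_def)

lemma eval_mpoly_sum: "eval_mpoly v (\<Sum>x\<in>A. f x) = (\<Sum>x\<in>A. eval_mpoly v (f x))"
  by (induction A rule: infinite_finite_induct) (auto simp: eval_mpoly_add eval_mpoly_zero)

lemma eval_mpoly_single: "eval_mpoly v (Poly_Mapping.single m c) = c * monomial_value v m"
  using eval_mpoly_superset[of "{m}" "Poly_Mapping.single m c" v] by (simp add: keys_single)

lemma mpoly_sum_of_monomials:
  "f = (\<Sum>m\<in>Poly_Mapping.keys f. Poly_Mapping.single m (Poly_Mapping.lookup f m))"
proof (rule poly_mapping_eqI)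
  fix k
  have "(\<Sum>m\<in>Poly_Mapping.keys f. Poly_Mapping.lookup (Poly_Mapping.single m (Poly_Mapping.lookup f m)) k)
      = (\<Sum>m\<in>Poly_Mapping.keys f. if m = k then Poly_Mapping.lookup f k else 0)"
    by (rule sum.cong) (auto simp: lookup_single when_def)
  also have "\<dots> = Poly_Mapping.lookup f k" by (simp add: sum.delta in_keys_iff)
  finally show "Poly_Mapping.lookup f k
      = Poly_Mapping.lookup (\<Sum>m\<in>Poly_Mapping.keys f. Poly_Mapping.single m (Poly_Mapping.lookup f m)) k"
    by (simp add: lookup_sum)
qed

lemma eval_mpoly_mult: "eval_mpoly v (f * g) = eval_mpoly v f * eval_mpoly v g"
proof -
  let ?S = "\<lambda>f :: rat_mpoly. \<Sum>m\<in>Poly_Mapping.keys f. Poly_Mapping.single m (Poly_Mapping.lookup f m)"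
  have "f * g = ?S f * ?S g" by (simp only: mpoly_sum_of_monomials[symmetric])
  also have "\<dots> = (\<Sum>m\<in>Poly_Mapping.keys f. \<Sum>m'\<in>Poly_Mapping.keys g.
      Poly_Mapping.single (m + m') (Poly_Mapping.lookup f m * Poly_Mapping.lookup g m'))"
    by (simp add: sum_product mult_single)
  finally have "f * g = (\<Sum>m\<in>Poly_Mapping.keys f. \<Sum>m'\<in>Poly_Mapping.keys g.
      Poly_Mapping.single (m + m') (Poly_Mapping.lookup f m * Poly_Mapping.lookup g m'))" .
  hence "eval_mpoly v (f * g) = (\<Sum>m\<in>Poly_Mapping.keys f. \<Sum>m'\<in>Poly_Mapping.keys g.
      (Poly_Mapping.lookup f m * monomial_value v m) * (Poly_Mapping.lookup g m' * monomial_value v m'))"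
    by (simp add: eval_mpoly_sum eval_mpoly_single monomial_value_add mult_ac)
  thus ?thesis
    by (simp add: sum_product eval_mpoly_superset[of "Poly_Mapping.keys f" f]
        eval_mpoly_superset[of "Poly_Mapping.keys g" g])
qed

definition polynomial_function :: "((nat \<Rightarrow> rat) \<Rightarrow> rat) \<Rightarrow> bool" where
  "polynomial_function F \<longleftrightarrow> (\<exists>f. \<forall>v. eval_mpoly v f = F v)"

lemma polynomial_function_eval: "polynomial_function (\<lambda>v. eval_mpoly v f)"
  by (auto simp: polynomial_function_def)

lemma polynomial_function_const: "polynomial_function (\<lambda>_. c)"
  unfolding polynomial_function_def
  by (rule exI[of _ "Poly_Mapping.single 0 c"]) (simp add: eval_mpoly_single monomial_value_def)

lemma polynomial_function_var: "polynomial_function (\<lambda>v. v i)"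
  unfolding polynomial_function_def
  by (rule exI[of _ "Poly_Mapping.single (Poly_Mapping.single i 1) 1"])
     (simp add: eval_mpoly_single monomial_value_def)

lemma polynomial_function_add:
  assumes "polynomial_function F" "polynomial_function G"
  shows "polynomial_function (\<lambda>v. F v + G v)"
  using assms unfolding polynomial_function_def by (metis eval_mpoly_add)

lemma polynomial_function_mult:
  assumes "polynomial_function F" "polynomial_function G"
  shows "polynomial_function (\<lambda>v. F v * G v)"
  using assms unfolding polynomial_function_def by (metis eval_mpoly_mult)

lemma polynomial_function_diff:
  assumes "polynomial_function F" "polynomial_function G"
  shows "polynomial_function (\<lambda>v. F v - G v)"
  using polynomial_function_add[OF assms(1) polynomial_function_mult[OF polynomial_function_const[of "-1"] assms(2)]]
  by simp

lemma polynomial_function_power: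
  assumes "polynomial_function F"
  shows "polynomial_function (\<lambda>v. F v ^ k)"
  by (induction k) (auto intro: polynomial_function_const polynomial_function_mult assms)

lemma polynomial_function_sum:
  assumes "\<And>x. x \<in> A \<Longrightarrow> polynomial_function (F x)"
  shows "polynomial_function (\<lambda>v. \<Sum>x\<in>A. F x v)"
  using assms
  by (induction A rule: infinite_finite_induct)
     (auto intro: polynomial_function_const polynomial_function_add)

lemma polynomial_function_prod:
  assumes "\<And>x. x \<in> A \<Longrightarrow> polynomial_function (F x)"
  shows "polynomial_function (\<lambda>v. \<Prod>x\<in>A. F x v)"
  using assms
  by (induction A rule: infinite_finite_induct)
     (auto intro: polynomial_function_const polynomial_function_mult)

lemmas polynomial_function_intros =
  polynomial_function_const polynomial_function_var polynomial_function_add polynomial_function_mult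
  polynomial_function_diff polynomial_function_power polynomial_function_sum polynomial_function_prod
  polynomial_function_eval

lemma polynomial_function_rename:
  assumes "polynomial_function F"
  shows "polynomial_function (\<lambda>v. F (\<lambda>i. v (\<rho> i)))"
proof -
  obtain f where f: "\<And>v. eval_mpoly v f = F v" using assms by (auto simp: polynomial_function_def)
  have "polynomial_function (\<lambda>v. eval_mpoly (\<lambda>i. v (\<rho> i)) f)"
    unfolding eval_mpoly_def by (intro polynomial_function_intros)
  thus ?thesis by (simp add: f)
qed

lemma integer_multiple_of_mpoly:
  obtains f' and c :: rat where "f' \<in> polys_over \<int>" "c \<noteq> 0" "\<And>v. eval_mpoly v f' = c * eval_mpoly v f"
proof -
  obtain xs where xs: "set xs = Poly_Mapping.lookup f ` Poly_Mapping.keys f"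
    using finite_list[of "Poly_Mapping.lookup f ` Poly_Mapping.keys f"] by auto
  obtain D where D: "D \<noteq> 0" "\<And>x. x \<in> set xs \<Longrightarrow> \<exists>k. of_int D * x = (of_int k :: rat)"
    using common_denominator[of xs] by blast
  define f' where "f' = Poly_Mapping.map ((*) (of_int D)) f"
  have "Poly_Mapping.lookup f' m \<in> \<int>" for m
  proof (cases "m \<in> Poly_Mapping.keys f")
    case True
    then obtain k where "of_int D * Poly_Mapping.lookup f m = of_int k" using D(2) xs by blast
    thus ?thesis by (simp add: f'_def map.rep_eq when_def)
  qed (simp add: f'_def map.rep_eq when_def in_keys_iff)
  hence "f' \<in> polys_over \<int>" by (simp add: polys_over_def)
  moreover have "eval_mpoly v f' = of_int D * eval_mpoly v f" for v
    unfolding f'_def mult_map_scale_conv_mult eval_mpoly_mult eval_mpoly_single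
    by (simp add: monomial_value_def)
  ultimately show ?thesis using that D(1) by (metis of_int_0_eq_iff)
qed

lemma integer_polynomial_for_zeros:
  assumes "polynomial_function F"
  obtains f where "f \<in> polys_over \<int>" "\<And>v. eval_mpoly v f = 0 \<longleftrightarrow> F v = 0"
proof -
  obtain g where g: "\<And>v. eval_mpoly v g = F v" using assms by (auto simp: polynomial_function_def)
  obtain f c where "f \<in> polys_over \<int>" "c \<noteq> 0" "\<And>v. eval_mpoly v f = c * eval_mpoly v g"
    using integer_multiple_of_mpoly[of g] by blast
  thus ?thesis using that g by (metis mult_eq_0_iff)
qed

lemma eval_mpoly_cong_finite:
  obtains N where "\<And>v v'. (\<And>i. i < N \<Longrightarrow> v i = v' i) \<Longrightarrow> eval_mpoly v f = eval_mpoly v' f"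
proof -
  define K where "K = (\<Union>m\<in>Poly_Mapping.keys f. Poly_Mapping.keys m)"
  have "finite K" by (simp add: K_def)
  hence "\<exists>N. \<forall>i\<in>K. i < N" by (simp only: finite_nat_set_iff_bounded)
  then obtain N where N: "\<And>i. i \<in> K \<Longrightarrow> i < N" by auto
  have "eval_mpoly v f = eval_mpoly v' f" if "\<And>i. i < N \<Longrightarrow> v i = v' i" for v v'
    unfolding eval_mpoly_def
  proof (rule sum.cong[OF refl], rule arg_cong2[where f = "(*)", OF refl], rule prod.cong[OF refl])
    fix m i assume "m \<in> Poly_Mapping.keys f" "i \<in> Poly_Mapping.keys m"
    hence "i \<in> K" by (auto simp: K_def)
    thus "v i ^ Poly_Mapping.lookup m i = v' i ^ Poly_Mapping.lookup m i" using that N by simp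
  qed
  thus ?thesis using that by blast
qed

section \<open>Diophantine subsets of the rationals\<close>

definition diophantine_in_Q :: "rat set \<Rightarrow> bool" where
  "diophantine_in_Q S \<longleftrightarrow> (\<exists>F. polynomial_function F \<and> (\<forall>x. x \<in> S \<longleftrightarrow> (\<exists>v. v 0 = x \<and> F v = 0)))"

lemma diophantine_UNIV: "diophantine_in_Q UNIV"
  unfolding diophantine_in_Q_def
  by (rule exI[of _ "\<lambda>_. 0"]) (auto intro: polynomial_function_const)

text \<open>
  The witnesses of the two conditions are kept apart at even and at odd positions; both share position \<open>0\<close>.
\<close>

lemma diophantine_Int:
  assumes "diophantine_in_Q S" "diophantine_in_Q T"
  shows "diophantine_in_Q (S \<inter> T)"
proof -
  obtain F where F: "polynomial_function F" "\<And>x. x \<in> S \<longleftrightarrow> (\<exists>v. v 0 = x \<and> F v = 0)"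
    using assms(1) unfolding diophantine_in_Q_def by blast
  obtain G where G: "polynomial_function G" "\<And>x. x \<in> T \<longleftrightarrow> (\<exists>v. v 0 = x \<and> G v = 0)"
    using assms(2) unfolding diophantine_in_Q_def by blast
  define H where "H = (\<lambda>v. (F (\<lambda>i. v (2 * i)))\<^sup>2 + (G (\<lambda>i. v (if i = 0 then 0 else 2 * i + 1)))\<^sup>2)"
  have "polynomial_function H" unfolding H_def
    by (intro polynomial_function_add polynomial_function_power
        polynomial_function_rename[OF F(1)] polynomial_function_rename[OF G(1)])
  moreover have "x \<in> S \<inter> T \<longleftrightarrow> (\<exists>v. v 0 = x \<and> H v = 0)" for x
  proof
    assume "x \<in> S \<inter> T"
    then obtain v w where v: "v 0 = x" "F v = 0" and w: "w 0 = x" "G w = 0" using F(2) G(2) by blast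
    define u where "u = (\<lambda>i. if even i then v (i div 2) else w (i div 2))"
    have "(\<lambda>i. u (2 * i)) = v" by (auto simp: u_def)
    moreover have "(\<lambda>i. u (if i = 0 then 0 else 2 * i + 1)) = w" using v w by (auto simp: u_def)
    ultimately have "H u = 0" using v w by (simp add: H_def)
    moreover have "u 0 = x" using v by (simp add: u_def)
    ultimately show "\<exists>v. v 0 = x \<and> H v = 0" by blast
  next
    assume "\<exists>v. v 0 = x \<and> H v = 0"
    then obtain v where v: "v 0 = x" "H v = 0" by blast
    hence z: "F (\<lambda>i. v (2 * i)) = 0" "G (\<lambda>i. v (if i = 0 then 0 else 2 * i + 1)) = 0"
      by (auto simp: H_def sum_power2_eq_zero_iff)
    have "x \<in> S" unfolding F(2) by (rule exI[of _ "\<lambda>i. v (2 * i)"]) (simp add: z v)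
    moreover have "x \<in> T"
      unfolding G(2) by (rule exI[of _ "\<lambda>i. v (if i = 0 then 0 else 2 * i + 1)"]) (simp add: z v)
    ultimately show "x \<in> S \<inter> T" by simp
  qed
  ultimately show ?thesis unfolding diophantine_in_Q_def by blast
qed

lemma diophantine_INT:
  assumes "finite P" "\<And>p. p \<in> P \<Longrightarrow> diophantine_in_Q (S p)"
  shows "diophantine_in_Q (\<Inter>p\<in>P. S p)"
  using assms by (induction P rule: finite_induct) (auto intro: diophantine_UNIV diophantine_Int)

text \<open>
  The set of all \<open>t\<close> for which \<open>E t u x y = 0\<close> is solvable lies between \<open>\<int>\<close> and the local ring, so two elements of it with their
  witnesses describe an element of the local ring. The nine rationals involved are the values of the first nine variables.
\<close>

lemma diophantine_local_ring_of_integer_test: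
  fixes E :: "rat \<Rightarrow> rat \<Rightarrow> rat \<Rightarrow> rat \<Rightarrow> rat"
  assumes p: "prime p"
    and pol: "\<And>i j k l. polynomial_function (\<lambda>v. E (v i) (v j) (v k) (v l))"
    and Z: "\<And>k. \<exists>u x y. E (of_int k) u x y = 0"
    and J: "\<And>t u x y. E t u x y = 0 \<Longrightarrow> t \<in> local_ring p"
  shows "diophantine_in_Q (local_ring p)"
proof -
  define F where "F = (\<lambda>v::nat \<Rightarrow> rat. (v 0 * (1 + of_nat p * v 2) - v 1)\<^sup>2
      + ((E (v 1) (v 3) (v 4) (v 5))\<^sup>2 + (E (v 2) (v 6) (v 7) (v 8))\<^sup>2))"
  have "polynomial_function F" unfolding F_def by (intro polynomial_function_intros pol)
  moreover have "x \<in> local_ring p \<longleftrightarrow> (\<exists>v. v 0 = x \<and> F v = 0)" for x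
  proof -
    have "x \<in> local_ring p \<longleftrightarrow> (\<exists>t1\<in>{t. \<exists>u x y. E t u x y = 0}. \<exists>t2\<in>{t. \<exists>u x y. E t u x y = 0}.
        x * (1 + of_nat p * t2) = t1)"
      by (rule local_ring_eq_of_integers[OF p]) (use Z J in auto)
    also have "\<dots> \<longleftrightarrow> (\<exists>v. v 0 = x \<and> F v = 0)"
    proof
      assume "\<exists>t1\<in>{t. \<exists>u x y. E t u x y = 0}. \<exists>t2\<in>{t. \<exists>u x y. E t u x y = 0}.
        x * (1 + of_nat p * t2) = t1"
      then obtain t1 t2 u1 x1 y1 u2 x2 y2 where
        *: "x * (1 + of_nat p * t2) = t1" "E t1 u1 x1 y1 = 0" "E t2 u2 x2 y2 = 0" by blast
      have "F (\<lambda>i. [x, t1, t2, u1, x1, y1, u2, x2, y2] ! i) = 0" using * by (simp add: F_def)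
      moreover have "[x, t1, t2, u1, x1, y1, u2, x2, y2] ! 0 = x" by simp
      ultimately show "\<exists>v. v 0 = x \<and> F v = 0" by blast
    next
      assume "\<exists>v. v 0 = x \<and> F v = 0"
      then obtain v where v: "v 0 = x" "F v = 0" by blast
      have "(x * (1 + of_nat p * v 2) - v 1)\<^sup>2 \<ge> 0" "(E (v 1) (v 3) (v 4) (v 5))\<^sup>2 \<ge> 0"
        "(E (v 2) (v 6) (v 7) (v 8))\<^sup>2 \<ge> 0" by auto
      moreover have "(x * (1 + of_nat p * v 2) - v 1)\<^sup>2 + ((E (v 1) (v 3) (v 4) (v 5))\<^sup>2
          + (E (v 2) (v 6) (v 7) (v 8))\<^sup>2) = 0" using v by (simp add: F_def)
      ultimately have "(x * (1 + of_nat p * v 2) - v 1)\<^sup>2 = 0" "(E (v 1) (v 3) (v 4) (v 5))\<^sup>2 = 0"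
        "(E (v 2) (v 6) (v 7) (v 8))\<^sup>2 = 0" by linarith+
      hence *: "x * (1 + of_nat p * v 2) = v 1" "E (v 1) (v 3) (v 4) (v 5) = 0" "E (v 2) (v 6) (v 7) (v 8) = 0"
        by auto
      have "v 1 \<in> {t. \<exists>u x y. E t u x y = 0}" "v 2 \<in> {t. \<exists>u x y. E t u x y = 0}" using *(2,3) by blast+
      thus "\<exists>t1\<in>{t. \<exists>u x y. E t u x y = 0}. \<exists>t2\<in>{t. \<exists>u x y. E t u x y = 0}.
        x * (1 + of_nat p * t2) = t1" using *(1) by blast
    qed
    finally show ?thesis .
  qed
  ultimately show ?thesis unfolding diophantine_in_Q_def by blast
qed

theorem diophantine_local_ring:
  assumes p: "prime p"
  shows "diophantine_in_Q (local_ring p)"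
proof (cases "odd p")
  case True
  obtain d where d: "\<And>k. odd_integer_test p d (of_int k)" "\<And>t. odd_integer_test p d t \<Longrightarrow> t \<in> local_ring p"
    using odd_integer_test_exists[OF p True] by blast
  define E :: "rat \<Rightarrow> rat \<Rightarrow> rat \<Rightarrow> rat \<Rightarrow> rat" where
    "E = (\<lambda>t u x y. 1 + of_nat p * (2 * of_nat d * t)\<^sup>2 + of_nat p * of_nat d * u\<^sup>2 - (x\<^sup>2 + of_nat d * y\<^sup>2))"
  have E: "odd_integer_test p d t \<longleftrightarrow> (\<exists>u x y. E t u x y = 0)" for t
    by (simp add: odd_integer_test_def E_def)
  show ?thesis
  proof (rule diophantine_local_ring_of_integer_test[where E = E, OF p])
    show "polynomial_function (\<lambda>v. E (v i) (v j) (v k) (v l))" for i j k l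
      unfolding E_def by (intro polynomial_function_intros)
    show "\<exists>u x y. E (of_int k) u x y = 0" for k
      using d(1)[of k] by (simp only: E)
    show "t \<in> local_ring p" if "E t u x y = 0" for t u x y
      using d(2)[of t] that by (auto simp only: E)
  qed
next
  case False
  hence p2: "p = 2" using p primes_dvd_imp_eq[of 2 p] by auto
  define E :: "rat \<Rightarrow> rat \<Rightarrow> rat \<Rightarrow> rat \<Rightarrow> rat" where
    "E = (\<lambda>t u x y. (2 + 7 * t\<^sup>2 - (u\<^sup>2 + x\<^sup>2 + y\<^sup>2)) * (2 + 7 * (t + 1)\<^sup>2 - (u\<^sup>2 + x\<^sup>2 + y\<^sup>2)))"
  have E: "even_integer_test t \<longleftrightarrow> (\<exists>u x y. E t u x y = 0)" for t
    by (simp add: even_integer_test_def E_def)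
  show ?thesis
  proof (rule diophantine_local_ring_of_integer_test[where E = E, OF p])
    show "polynomial_function (\<lambda>v. E (v i) (v j) (v k) (v l))" for i j k l
      unfolding E_def by (intro polynomial_function_intros)
    show "\<exists>u x y. E (of_int k) u x y = 0" for k
      using even_integer_test_of_int[of k] by (simp only: E)
    show "t \<in> local_ring p" if "E t u x y = 0" for t u x y
      using even_integer_test_integral[of t] that p2 by (auto simp only: E)
  qed
qed

section \<open>Subrings of the rationals as intersections of local rings\<close>

lemma local_ring_closed:
  assumes "prime p" "x \<in> local_ring p" "y \<in> local_ring p"
  shows "x + y \<in> local_ring p" "x * y \<in> local_ring p"
proof -
  obtain a b where ab: "x = of_int a / of_int b" "\<not> int p dvd b" using assms by (auto simp: local_ring_def)
  obtain c d where cd: "y = of_int c / of_int d" "\<not> int p dvd d" using assms by (auto simp: local_ring_def)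
  have nz: "b \<noteq> 0" "d \<noteq> 0" using ab cd by auto
  have nd: "\<not> int p dvd b * d" using ab cd assms(1) by (simp add: prime_dvd_mult_iff)
  have "x + y = of_int (a * d + c * b) / of_int (b * d)" using nz by (simp add: ab cd field_simps)
  thus "x + y \<in> local_ring p" using nd unfolding local_ring_def by blast
  have "x * y = of_int (a * c) / of_int (b * d)" by (simp add: ab cd)
  thus "x * y \<in> local_ring p" using nd unfolding local_ring_def by blast
qed

lemma of_int_in_local_ring:
  assumes "prime p"
  shows "of_int k \<in> local_ring p"
proof -
  have "\<not> int p dvd 1" using prime_gt_1_nat[OF assms] by (simp add: zdvd1_eq)
  moreover have "of_int k = (of_int k / of_int 1 :: rat)" by simp
  ultimately show ?thesis unfolding local_ring_def by blast
qed

lemma inverse_in_subring_of: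
  assumes "b > 0" "\<And>p. prime p \<Longrightarrow> p dvd b \<Longrightarrow> p \<in> W"
  shows "1 / of_nat b \<in> subring_of W"
  using assms
proof (induction b rule: less_induct)
  case (less b)
  show ?case
  proof (cases "b = 1")
    case True
    thus ?thesis using subring_of.of_int[of 1 W] by simp
  next
    case False
    then obtain p where p: "prime p" "p dvd b" by (metis prime_factor_nat)
    then obtain k where k: "b = p * k" by (auto elim: dvdE)
    have "k > 0" using less.prems(1) k by (cases k) auto
    moreover have "k < b" using n_less_n_mult_m[of k p] \<open>k > 0\<close> prime_gt_1_nat[OF p(1)] by (simp add: k mult.commute)
    ultimately have "1 / of_nat k \<in> subring_of W" using less.IH[of k] less.prems(2) k by auto
    moreover have "1 / of_nat p \<in> subring_of W" using less.prems(2)[OF p] by (rule subring_of.inverse_of)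
    ultimately have "1 / of_nat p * (1 / of_nat k) \<in> subring_of W" by (intro subring_of.mult)
    thus ?thesis by (simp add: k)
  qed
qed

lemma subring_of_eq_local_rings:
  assumes "W \<subseteq> Primes"
  shows "subring_of W = (\<Inter>p\<in>Primes - W. local_ring p)"
proof (intro equalityI subsetI)
  fix x assume "x \<in> subring_of W"
  thus "x \<in> (\<Inter>p\<in>Primes - W. local_ring p)"
  proof induction
    case (inverse_of q)
    have "1 / of_nat q \<in> local_ring p" if "p \<in> Primes - W" for p
    proof -
      have "\<not> int p dvd int q" using that inverse_of assms primes_dvd_imp_eq[of p q] by auto
      thus ?thesis unfolding local_ring_def by (intro CollectI exI[of _ 1] exI[of _ "int q"]) simp
    qed
    thus ?case by blast
  qed (auto intro: of_int_in_local_ring local_ring_closed)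
next
  fix x assume x: "x \<in> (\<Inter>p\<in>Primes - W. local_ring p)"
  obtain a b where ab: "quotient_of x = (a, b)" by fastforce
  have xab: "x = of_int a / of_int b" and b: "b > 0" and cop: "coprime a b"
    using quotient_of_div[OF ab] quotient_of_denom_pos[OF ab] quotient_of_coprime[OF ab] by auto
  have "p \<in> W" if p: "prime p" "p dvd nat b" for p
  proof (rule ccontr)
    assume "p \<notin> W"
    hence "x \<in> local_ring p" using x p by auto
    then obtain c e where ce: "x = of_int c / of_int e" "\<not> int p dvd e" by (auto simp: local_ring_def)
    have "e \<noteq> 0" using ce by auto
    hence "(of_int (a * e) :: rat) = of_int (c * b)" using xab ce(1) b by (simp add: field_simps)
    hence e: "a * e = c * b" by (simp only: of_int_eq_iff)
    have pb: "int p dvd b" using p(2) b by (metis int_dvd_int_iff nat_0_le order_less_imp_le)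
    hence "int p dvd a * e" unfolding e by simp
    hence "int p dvd a" using prime_dvd_multD[of "int p" a e] p(1) ce(2) by auto
    hence "is_unit (int p)" using coprime_common_divisor[OF cop] pb by blast
    thus False using p(1) by auto
  qed
  hence "1 / of_nat (nat b) \<in> subring_of W" using b by (intro inverse_in_subring_of) auto
  hence "of_int a * (1 / of_nat (nat b)) \<in> subring_of W" by (intro subring_of.mult subring_of.of_int)
  thus "x \<in> subring_of W" using b by (simp add: xab)
qed

lemma subring_of_Primes: "subring_of Primes = UNIV"
  using subring_of_eq_local_rings[of Primes] by simp

lemma diophantine_cofinite_subring:
  assumes "W \<subseteq> Primes" "finite (Primes - W)"
  shows "diophantine_in_Q (subring_of W)"
  unfolding subring_of_eq_local_rings[OF assms(1)]
  by (rule diophantine_INT[OF assms(2)]) (auto intro: diophantine_local_ring)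

section \<open>Transfer of models to the rationals\<close>

text \<open>
  Only the variables below some bound \<open>N\<close> matter, and each of them is forced into \<open>R\<close> by its own copy of the polynomial that
  defines \<open>R\<close>.
\<close>

lemma dioph_set_over_Q:
  assumes R: "diophantine_in_Q R" and z: "0 \<in> R"
  shows "\<exists>f'. dioph_set UNIV k f' = dioph_set R k f"
proof -
  obtain G where G: "polynomial_function G" "\<And>x. x \<in> R \<longleftrightarrow> (\<exists>v. v 0 = x \<and> G v = 0)"
    using R unfolding diophantine_in_Q_def by blast
  obtain N0 where N0: "\<And>v v'. (\<And>i. i < N0 \<Longrightarrow> v i = v' i) \<Longrightarrow> eval_mpoly v f = eval_mpoly v' f"
    using eval_mpoly_cong_finite by blast
  define N where "N = Suc (max N0 k)"
  have N: "N > 0" "k \<le> N" "N0 \<le> N" by (auto simp: N_def)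
  \<comment> \<open>block \<open>j\<close> of length \<open>N\<close> holds the \<open>j\<close>-th witness for each of the first \<open>N\<close> variables\<close>
  define \<rho> where "\<rho> = (\<lambda>i j. if j = 0 then i else N + (j * N + i))"
  define H where "H = (\<lambda>v. (eval_mpoly v f)\<^sup>2 + (\<Sum>i<N. (G (\<lambda>j. v (\<rho> i j)))\<^sup>2))"
  have "polynomial_function H" unfolding H_def
    by (intro polynomial_function_add polynomial_function_power polynomial_function_sum
        polynomial_function_eval polynomial_function_rename[OF G(1)])
  then obtain f' where f': "\<And>v. eval_mpoly v f' = H v" by (auto simp: polynomial_function_def)
  have H0: "H v = 0 \<longleftrightarrow> eval_mpoly v f = 0 \<and> (\<forall>i<N. G (\<lambda>j. v (\<rho> i j)) = 0)" for v
  proof -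
    have "(\<Sum>i<N. (G (\<lambda>j. v (\<rho> i j)))\<^sup>2) \<ge> 0" by (intro sum_nonneg) auto
    hence "H v = 0 \<longleftrightarrow> (eval_mpoly v f)\<^sup>2 = 0 \<and> (\<Sum>i<N. (G (\<lambda>j. v (\<rho> i j)))\<^sup>2) = 0"
      unfolding H_def using zero_le_power2[of "eval_mpoly v f"] by linarith
    thus ?thesis by (auto simp: sum_nonneg_eq_0_iff)
  qed
  have "dioph_set UNIV k f' = dioph_set R k f"
  proof (intro equalityI subsetI)
    fix xs assume "xs \<in> dioph_set UNIV k f'"
    then obtain y where len: "length xs = k" and H: "H (tuple_append xs y) = 0"
      by (auto simp: dioph_set_def f')
    define v where "v = tuple_append xs y"
    have vR: "v i \<in> R" if "i < N" for i
    proof -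
      have "G (\<lambda>j. v (\<rho> i j)) = 0" using H that by (simp add: H0 v_def)
      moreover have "v (\<rho> i 0) = v i" by (simp add: \<rho>_def)
      ultimately show ?thesis unfolding G(2) by (intro exI[of _ "\<lambda>j. v (\<rho> i j)"] conjI)
    qed
    have xsR: "set xs \<subseteq> R"
    proof
      fix x assume "x \<in> set xs"
      then obtain i where i: "i < k" "x = xs ! i" using len by (auto simp: in_set_conv_nth)
      thus "x \<in> R" using vR[of i] N(2) len by (simp add: v_def tuple_append_def)
    qed
    define y' where "y' = (\<lambda>i. if i + k < N then y i else 0)"
    have "y' i \<in> R" for i
    proof (cases "i + k < N")
      case True
      thus ?thesis using vR[of "i + k"] len by (simp add: y'_def v_def tuple_append_def)
    qed (simp add: y'_def z)
    moreover have "eval_mpoly (tuple_append xs y') f = eval_mpoly v f"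
      by (rule N0) (use N(3) len in \<open>auto simp: v_def y'_def tuple_append_def\<close>)
    ultimately show "xs \<in> dioph_set R k f" using len xsR H by (auto simp: dioph_set_def H0 v_def)
  next
    fix xs assume "xs \<in> dioph_set R k f"
    then obtain y where len: "length xs = k" and xsR: "set xs \<subseteq> R" and y: "\<And>i. y i \<in> R"
      and e: "eval_mpoly (tuple_append xs y) f = 0" by (auto simp: dioph_set_def)
    define v where "v = tuple_append xs y"
    have "v i \<in> R" for i
      using xsR y len by (auto simp: v_def tuple_append_def)
    hence "\<forall>i. \<exists>w. w 0 = v i \<and> G w = 0" using G(2) by simp
    from choice[OF this] obtain w where "\<forall>i. w i 0 = v i \<and> G (w i) = 0" by (elim exE)
    hence w: "\<And>i. w i 0 = v i" "\<And>i. G (w i) = 0" by simp_all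
    define u where "u = (\<lambda>t. if t < N then v t else w ((t - N) mod N) ((t - N) div N))"
    have "(\<lambda>j. u (\<rho> i j)) = w i" if "i < N" for i
    proof
      fix j
      show "u (\<rho> i j) = w i j" using that w(1) N(1) by (simp add: u_def \<rho>_def)
    qed
    moreover have "eval_mpoly u f = eval_mpoly v f" by (rule N0) (use N(3) in \<open>simp add: u_def\<close>)
    ultimately have "H u = 0" using w(2) e by (simp add: H0 v_def)
    moreover have "tuple_append xs (\<lambda>i. u (i + k)) = u"
      using len N(2) by (auto simp: tuple_append_def u_def v_def fun_eq_iff)
    ultimately show "xs \<in> dioph_set UNIV k f'" using len by (auto simp: dioph_set_def f' intro!: exI[of _ "\<lambda>i. u (i + k)"])
  qed
  thus ?thesis by blast
qed

lemma dioph_model_over_Q: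
  assumes R: "diophantine_in_Q R" and z: "0 \<in> R" and m: "dioph_model_via R n h hp ht"
  shows "admits_dioph_model UNIV"
proof -
  obtain h' where h': "dioph_set UNIV n h' = dioph_set R n h" using dioph_set_over_Q[OF R z] by blast
  obtain hp' where hp': "dioph_set UNIV (3 * n) hp' = dioph_set R (3 * n) hp" using dioph_set_over_Q[OF R z] by blast
  obtain ht' where ht': "dioph_set UNIV (3 * n) ht' = dioph_set R (3 * n) ht" using dioph_set_over_Q[OF R z] by blast
  have "dioph_model_via UNIV n h' hp' ht'"
    using m unfolding dioph_model_via_def h' hp' ht' by (auto simp: polys_over_def)
  thus ?thesis unfolding admits_dioph_model_def by blast
qed

section \<open>The Cantor space of sets of primes\<close>

text \<open>
  The basic open sets in a form that does not mention strings.
\<close>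

definition agreeing_below :: "nat set \<Rightarrow> nat \<Rightarrow> nat set set" where
  "agreeing_below W k = {V. V \<subseteq> Primes \<and> (\<forall>p\<in>Primes. p < k \<longrightarrow> (p \<in> V \<longleftrightarrow> p \<in> W))}"

lemma agreeing_below_refl: "W \<subseteq> Primes \<Longrightarrow> W \<in> agreeing_below W k"
  by (simp add: agreeing_below_def)

lemma agreeing_below_subset_Primes: "V \<in> agreeing_below W k \<Longrightarrow> V \<subseteq> Primes"
  by (simp add: agreeing_below_def)

lemma agreeing_below_subset: "V \<in> agreeing_below W k \<Longrightarrow> k \<le> j \<Longrightarrow> agreeing_below V j \<subseteq> agreeing_below W k"
  unfolding agreeing_below_def by fastforce

lemma openin_agreeing_below: "openin cantor_primes (agreeing_below W k)"
proof -
  define B where "B = (\<lambda>p. if p < k then {p \<in> W} else (UNIV :: bool set))"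
  have "openin (product_topology (\<lambda>_. discrete_topology (UNIV :: bool set)) Primes) (Pi\<^sub>E Primes B)"
  proof (rule product_topology_basis)
    have "{p. B p \<noteq> topspace (discrete_topology UNIV)} \<subseteq> {..<k}" by (auto simp: B_def)
    thus "finite {p. B p \<noteq> topspace (discrete_topology UNIV)}" by (rule finite_subset) simp
  qed simp
  moreover have "agreeing_below W k = (\<lambda>W. restrict (\<lambda>p. p \<in> W) Primes) -` (Pi\<^sub>E Primes B) \<inter> Pow Primes"
    by (auto simp: agreeing_below_def B_def PiE_iff split: if_splits)
  ultimately show ?thesis unfolding cantor_primes_def openin_pullback_topology by blast
qed

lemma openin_cantor_primes_nbhd:
  assumes U: "openin cantor_primes U" and W: "W \<in> U"
  shows "W \<subseteq> Primes \<and> (\<exists>k. agreeing_below W k \<subseteq> U)"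
proof -
  obtain U' where U': "openin (product_topology (\<lambda>_. discrete_topology (UNIV :: bool set)) Primes) U'"
      "U = (\<lambda>W. restrict (\<lambda>p. p \<in> W) Primes) -` U' \<inter> Pow Primes"
    using U unfolding cantor_primes_def openin_pullback_topology by blast
  have "restrict (\<lambda>p. p \<in> W) Primes \<in> U'" using W U'(2) by simp
  then obtain X where X: "finite {p \<in> Primes. X p \<noteq> (UNIV :: bool set)}"
      "restrict (\<lambda>p. p \<in> W) Primes \<in> Pi\<^sub>E Primes X" "Pi\<^sub>E Primes X \<subseteq> U'"
    using U'(1) unfolding openin_product_topology_alt by fastforce
  obtain k where k: "\<forall>p\<in>{p \<in> Primes. X p \<noteq> UNIV}. p < k"
    using X(1) unfolding finite_nat_set_iff_bounded by blast
  have "agreeing_below W k \<subseteq> U"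
  proof
    fix V assume V: "V \<in> agreeing_below W k"
    have "restrict (\<lambda>p. p \<in> V) Primes \<in> Pi\<^sub>E Primes X"
    proof (rule PiE_I)
      fix p assume p: "p \<in> Primes"
      show "restrict (\<lambda>p. p \<in> V) Primes p \<in> X p"
      proof (cases "X p = UNIV")
        case False
        hence "p < k" using k p by blast
        hence "(p \<in> V) = (p \<in> W)" using V p by (simp add: agreeing_below_def)
        moreover have "restrict (\<lambda>p. p \<in> W) Primes p \<in> X p" using X(2) p by (rule PiE_mem)
        ultimately show ?thesis using p by simp
      qed simp
    qed simp
    hence h: "restrict (\<lambda>p. p \<in> V) Primes \<in> U'" using X(3) by (rule subsetD[rotated])
    show "V \<in> U" unfolding U'(2)
      by (intro IntI vimageI2 h) (use V in \<open>auto simp: agreeing_below_def\<close>)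
  qed
  thus ?thesis using W U'(2) by blast
qed

lemma interior_cantor_primes:
  "W \<in> cantor_primes interior_of S \<longleftrightarrow> W \<subseteq> Primes \<and> (\<exists>k. agreeing_below W k \<subseteq> S)"
proof
  assume "W \<in> cantor_primes interior_of S"
  then obtain U where U: "openin cantor_primes U" "W \<in> U" "U \<subseteq> S" unfolding interior_of_def by auto
  from openin_cantor_primes_nbhd[OF U(1,2)] obtain k where "W \<subseteq> Primes" "agreeing_below W k \<subseteq> U" by auto
  thus "W \<subseteq> Primes \<and> (\<exists>k. agreeing_below W k \<subseteq> S)" using U(3) by (intro conjI exI[of _ k]) auto
next
  assume "W \<subseteq> Primes \<and> (\<exists>k. agreeing_below W k \<subseteq> S)"
  then obtain k where k: "W \<subseteq> Primes" "agreeing_below W k \<subseteq> S" by auto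
  show "W \<in> cantor_primes interior_of S"
    unfolding interior_of_def
    by (intro CollectI exI[of _ "agreeing_below W k"] conjI openin_agreeing_below agreeing_below_refl k)
qed

lemma topspace_cantor_primes: "topspace cantor_primes = Pow Primes"
  by (auto simp: cantor_primes_def topspace_pullback_topology topspace_product_topology)

lemma closure_cantor_primes:
  "W \<in> cantor_primes closure_of S \<longleftrightarrow> W \<subseteq> Primes \<and> (\<forall>k. agreeing_below W k \<inter> S \<noteq> {})"
proof
  assume "W \<in> cantor_primes closure_of S"
  hence W: "W \<subseteq> Primes" "\<And>T. W \<in> T \<Longrightarrow> openin cantor_primes T \<Longrightarrow> \<exists>y\<in>S. y \<in> T"
    by (auto simp: in_closure_of topspace_cantor_primes)
  show "W \<subseteq> Primes \<and> (\<forall>k. agreeing_below W k \<inter> S \<noteq> {})"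
  proof (intro conjI allI W(1))
    fix k
    from W(2)[OF agreeing_below_refl[OF W(1)] openin_agreeing_below]
    show "agreeing_below W k \<inter> S \<noteq> {}" by auto
  qed
next
  assume W: "W \<subseteq> Primes \<and> (\<forall>k. agreeing_below W k \<inter> S \<noteq> {})"
  have *: "\<exists>y. y \<in> S \<and> y \<in> T" if T: "W \<in> T" "openin cantor_primes T" for T
  proof -
    from openin_cantor_primes_nbhd[OF T(2,1)] obtain k where k: "agreeing_below W k \<subseteq> T" by auto
    from W have "agreeing_below W k \<inter> S \<noteq> {}" by simp
    thus ?thesis using k by auto
  qed
  show "W \<in> cantor_primes closure_of S" using W * by (simp add: in_closure_of topspace_cantor_primes)
qed

lemma nowhere_dense_cantor_primes:
  "nowhere_dense_in cantor_primes S \<longleftrightarrow> S \<subseteq> Pow Primes \<and>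
     (\<forall>W k. W \<subseteq> Primes \<longrightarrow> (\<exists>V\<in>agreeing_below W k. \<exists>j. agreeing_below V j \<inter> S = {}))"
proof -
  have "cantor_primes interior_of (cantor_primes closure_of S) = {} \<longleftrightarrow>
     (\<forall>W k. W \<subseteq> Primes \<longrightarrow> \<not> agreeing_below W k \<subseteq> cantor_primes closure_of S)"
    by (auto simp: set_eq_iff interior_cantor_primes simp del: subset_iff)
  also have "\<dots> \<longleftrightarrow> (\<forall>W k. W \<subseteq> Primes \<longrightarrow> (\<exists>V\<in>agreeing_below W k. \<exists>j. agreeing_below V j \<inter> S = {}))"
  proof -
    have "\<not> agreeing_below W k \<subseteq> cantor_primes closure_of S \<longleftrightarrow>
        (\<exists>V\<in>agreeing_below W k. \<exists>j. agreeing_below V j \<inter> S = {})" for W k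
    proof -
      have "agreeing_below W k \<subseteq> cantor_primes closure_of S \<longleftrightarrow>
          (\<forall>V\<in>agreeing_below W k. \<forall>j. agreeing_below V j \<inter> S \<noteq> {})"
        by (auto simp: subset_iff closure_cantor_primes dest: agreeing_below_subset_Primes)
      thus ?thesis by simp
    qed
    thus ?thesis by simp
  qed
  finally show ?thesis unfolding nowhere_dense_in_def by (simp add: topspace_cantor_primes)
qed

text \<open>
  Nested basic open sets are chosen so that the \<open>i\<close>-th one avoids the \<open>i\<close>-th set of the family and fixes at least
  the first \<open>i\<close> places. They have a common point.
\<close>

theorem baire_cantor_primes:
  assumes ctb: "countable \<F>" and nd: "\<And>T. T \<in> \<F> \<Longrightarrow> nowhere_dense_in cantor_primes T"
    and W: "W \<subseteq> Primes"
  obtains V where "V \<in> agreeing_below W k" "V \<notin> \<Union>\<F>"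
proof (cases "\<F> = {}")
  case True
  thus ?thesis using that[of W] agreeing_below_refl[OF W] by simp
next
  case False
  define T where "T = from_nat_into \<F>"
  have T: "range T = \<F>" unfolding T_def by (rule range_from_nat_into[OF False ctb])
  have step: "\<exists>s'. fst s' \<in> agreeing_below (fst s) (snd s) \<and> snd s \<le> snd s' \<and> i \<le> snd s' \<and>
      agreeing_below (fst s') (snd s') \<inter> T i = {}" if "fst s \<subseteq> Primes" for s i
  proof -
    have "nowhere_dense_in cantor_primes (T i)" using nd T by blast
    then obtain V j where V: "V \<in> agreeing_below (fst s) (snd s)" "agreeing_below V j \<inter> T i = {}"
      unfolding nowhere_dense_cantor_primes using \<open>fst s \<subseteq> Primes\<close> by blast
    define j' where "j' = max j (max i (snd s))"
    have "agreeing_below V j' \<subseteq> agreeing_below V j"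
      using agreeing_below_subset[OF agreeing_below_refl[OF agreeing_below_subset_Primes[OF V(1)]], of j j']
      by (simp add: j'_def)
    thus ?thesis using V by (intro exI[of _ "(V, j')"]) (auto simp: j'_def)
  qed
  have "\<exists>s. s 0 = (W, k) \<and> (\<forall>i. fst (s i) \<subseteq> Primes) \<and> (\<forall>i. fst (s (Suc i)) \<in> agreeing_below (fst (s i)) (snd (s i)) \<and>
      snd (s i) \<le> snd (s (Suc i)) \<and> i \<le> snd (s (Suc i)) \<and>
      agreeing_below (fst (s (Suc i))) (snd (s (Suc i))) \<inter> T i = {})"
  proof -
    define nxt where "nxt = (\<lambda>i s. SOME s'. fst s' \<in> agreeing_below (fst s) (snd s) \<and> snd s \<le> snd s' \<and> i \<le> snd s' \<and>
      agreeing_below (fst s') (snd s') \<inter> T i = {})"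
    define s where "s = rec_nat (W, k) nxt"
    have s0: "s 0 = (W, k)" and sS: "s (Suc i) = nxt i (s i)" for i by (simp_all add: s_def)
    have sub: "fst (s i) \<subseteq> Primes" for i
    proof (induction i)
      case (Suc i)
      show ?case unfolding sS nxt_def using someI_ex[OF step[OF Suc, of i]] agreeing_below_subset_Primes by blast
    qed (simp add: s0 W)
    have "fst (s (Suc i)) \<in> agreeing_below (fst (s i)) (snd (s i)) \<and> snd (s i) \<le> snd (s (Suc i)) \<and>
        i \<le> snd (s (Suc i)) \<and> agreeing_below (fst (s (Suc i))) (snd (s (Suc i))) \<inter> T i = {}" for i
      unfolding sS nxt_def by (rule someI_ex[OF step[OF sub]])
    thus ?thesis using s0 sub by blast
  qed
  then obtain s where s0: "s 0 = (W, k)" and sub: "\<And>i. fst (s i) \<subseteq> Primes"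
    and s1: "\<And>i. fst (s (Suc i)) \<in> agreeing_below (fst (s i)) (snd (s i))"
    and s2: "\<And>i. snd (s i) \<le> snd (s (Suc i))" and s3: "\<And>i. i \<le> snd (s (Suc i))"
    and s4: "\<And>i. agreeing_below (fst (s (Suc i))) (snd (s (Suc i))) \<inter> T i = {}" by blast
  have mono: "snd (s i) \<le> snd (s j)" if "i \<le> j" for i j
    using that by (induction j rule: dec_induct) (use s2 le_trans in \<open>auto intro: le_trans\<close>)
  have agree: "fst (s j) \<in> agreeing_below (fst (s i)) (snd (s i))" if "i \<le> j" for i j
    using that
  proof (induction j rule: dec_induct)
    case base
    show ?case by (rule agreeing_below_refl[OF sub])
  next
    case (step j)
    thus ?case using agreeing_below_subset[OF step.IH mono[OF step.hyps(1)]] s1[of j] by blast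
  qed
  define L where "L = {p. \<exists>i. p < snd (s i) \<and> p \<in> fst (s i)}"
  have L: "L \<in> agreeing_below (fst (s i)) (snd (s i))" for i
  proof -
    have "L \<subseteq> Primes" using sub by (auto simp: L_def)
    moreover have "p \<in> L \<longleftrightarrow> p \<in> fst (s i)" if p: "p \<in> Primes" "p < snd (s i)" for p
    proof
      assume "p \<in> L"
      then obtain j where j: "p < snd (s j)" "p \<in> fst (s j)" by (auto simp: L_def)
      show "p \<in> fst (s i)"
        using agree[of i j] agree[of j i] p j by (cases "i \<le> j") (auto simp: agreeing_below_def)
    qed (use p in \<open>auto simp: L_def\<close>)
    ultimately show ?thesis by (simp add: agreeing_below_def)
  qed
  have "L \<notin> T i" for i using L[of "Suc i"] s4[of i] by blast
  hence "L \<notin> \<Union>\<F>" using T by blast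
  moreover have "L \<in> agreeing_below W k" using L[of 0] s0 by simp
  ultimately show ?thesis using that by blast
qed

section \<open>Loci of solvable equations\<close>

text \<open>
  The sets \<open>W\<close> over which a tuple with the rational entries \<open>xs\<close> extends to a zero of \<open>f\<close>. Every atomic statement about a
  diophantine model has this form.
\<close>

definition partial_zero_locus :: "rat list \<Rightarrow> rat_mpoly \<Rightarrow> nat set set" where
  "partial_zero_locus xs f = {W. W \<subseteq> Primes \<and>
     (\<exists>v. (\<forall>i. v i \<in> subring_of W) \<and> (\<forall>i<length xs. v i = xs ! i) \<and> eval_mpoly v f = 0)}"

lemma dioph_set_iff_locus:
  assumes "W \<subseteq> Primes"
  shows "xs \<in> dioph_set (subring_of W) k f \<longleftrightarrow> length xs = k \<and> W \<in> partial_zero_locus xs f"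
proof
  assume "xs \<in> dioph_set (subring_of W) k f"
  then obtain y where *: "length xs = k" "set xs \<subseteq> subring_of W" "\<And>i. y i \<in> subring_of W"
      "eval_mpoly (tuple_append xs y) f = 0" by (auto simp: dioph_set_def)
  have "tuple_append xs y i \<in> subring_of W" for i using * by (auto simp: tuple_append_def)
  moreover have "tuple_append xs y i = xs ! i" if "i < length xs" for i using that by (simp add: tuple_append_def)
  ultimately show "length xs = k \<and> W \<in> partial_zero_locus xs f"
    using * assms by (auto simp: partial_zero_locus_def)
next
  assume "length xs = k \<and> W \<in> partial_zero_locus xs f"
  then obtain v where *: "length xs = k" "\<And>i. v i \<in> subring_of W" "\<And>i. i < length xs \<Longrightarrow> v i = xs ! i"
      "eval_mpoly v f = 0" by (auto simp: partial_zero_locus_def)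
  have "tuple_append xs (\<lambda>i. v (i + k)) = v" using *(1,3) by (auto simp: tuple_append_def fun_eq_iff)
  moreover have "set xs \<subseteq> subring_of W"
  proof
    fix x assume "x \<in> set xs"
    then obtain i where "i < length xs" "x = xs ! i" by (auto simp: in_set_conv_nth)
    thus "x \<in> subring_of W" using *(2)[of i] *(3)[of i] by simp
  qed
  ultimately show "xs \<in> dioph_set (subring_of W) k f"
    using *(1,2,4) by (auto simp: dioph_set_def intro!: exI[of _ "\<lambda>i. v (i + k)"])
qed

lemma subring_of_finitely_many_primes:
  assumes "x \<in> subring_of W"
  shows "\<exists>k. \<forall>V. (\<forall>p\<in>W. p < k \<longrightarrow> p \<in> V) \<longrightarrow> x \<in> subring_of V"
  using assms
proof induction
  case (of_int k)
  show ?case by (auto intro: subring_of.of_int)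
next
  case (inverse_of p)
  show ?case by (rule exI[of _ "Suc p"]) (use inverse_of in \<open>auto intro: subring_of.inverse_of\<close>)
next
  case (add x y)
  then obtain k l where "\<forall>V. (\<forall>p\<in>W. p < k \<longrightarrow> p \<in> V) \<longrightarrow> x \<in> subring_of V"
      "\<forall>V. (\<forall>p\<in>W. p < l \<longrightarrow> p \<in> V) \<longrightarrow> y \<in> subring_of V" by blast
  thus ?case by (intro exI[of _ "max k l"]) (auto intro!: subring_of.add)
next
  case (mult x y)
  then obtain k l where "\<forall>V. (\<forall>p\<in>W. p < k \<longrightarrow> p \<in> V) \<longrightarrow> x \<in> subring_of V"
      "\<forall>V. (\<forall>p\<in>W. p < l \<longrightarrow> p \<in> V) \<longrightarrow> y \<in> subring_of V" by blast
  thus ?case by (intro exI[of _ "max k l"]) (auto intro!: subring_of.mult)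
qed

text \<open>
  A zero involves finitely many primes of \<open>W\<close>. Only membership of these primes in \<open>V\<close> is needed, and no prime has
  to be absent from \<open>V\<close>: this is stronger than openness, and rigidity of models rests on it.
\<close>

lemma partial_zero_locus_monotone_open:
  assumes W: "W \<in> partial_zero_locus xs f"
  shows "\<exists>k. \<forall>V\<subseteq>Primes. (\<forall>p\<in>W. p < k \<longrightarrow> p \<in> V) \<longrightarrow> V \<in> partial_zero_locus xs f"
proof -
  obtain v where v: "\<And>i. v i \<in> subring_of W" "\<And>i. i < length xs \<Longrightarrow> v i = xs ! i" "eval_mpoly v f = 0"
    using W by (auto simp: partial_zero_locus_def)
  obtain N0 where N0: "\<And>v v'. (\<And>i. i < N0 \<Longrightarrow> v i = v' i) \<Longrightarrow> eval_mpoly v f = eval_mpoly v' f"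
    using eval_mpoly_cong_finite by blast
  define N where "N = max N0 (length xs)"
  have "\<forall>i. \<exists>k. \<forall>V. (\<forall>p\<in>W. p < k \<longrightarrow> p \<in> V) \<longrightarrow> v i \<in> subring_of V"
    using subring_of_finitely_many_primes[OF v(1)] by blast
  from choice[OF this] obtain k where k: "\<And>i V. (\<forall>p\<in>W. p < k i \<longrightarrow> p \<in> V) \<Longrightarrow> v i \<in> subring_of V" by blast
  define K where "K = (\<Sum>i<N. k i)"
  have K: "k i \<le> K" if "i < N" for i unfolding K_def using that by (intro member_le_sum) auto
  have "V \<in> partial_zero_locus xs f" if V: "V \<subseteq> Primes" "\<forall>p\<in>W. p < K \<longrightarrow> p \<in> V" for V
  proof -
    define v' where "v' = (\<lambda>i. if i < N then v i else 0)"
    have "v' i \<in> subring_of V" for i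
    proof (cases "i < N")
      case True
      have "\<forall>p\<in>W. p < k i \<longrightarrow> p \<in> V" using V(2) K[OF True] by auto
      thus ?thesis using k True by (simp add: v'_def)
    next
      case False
      thus ?thesis using subring_of.of_int[of 0 V] by (simp add: v'_def)
    qed
    moreover have "eval_mpoly v' f = eval_mpoly v f" by (rule N0) (simp add: v'_def N_def)
    moreover have "v' i = xs ! i" if "i < length xs" for i using that v(2) by (simp add: v'_def N_def)
    ultimately show ?thesis using V(1) v(3) by (auto simp: partial_zero_locus_def)
  qed
  thus ?thesis by blast
qed

lemma integer_polys_over_subring: "f \<in> polys_over \<int> \<Longrightarrow> f \<in> polys_over (subring_of W)"
  by (auto simp: polys_over_def Ints_def) (metis rangeE subring_of.of_int)

text \<open>
  The prescribed rational values are imposed by squares, and the common denominator of the coefficients is cleared.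
\<close>

lemma partial_zero_locus_eq_HTP_locus: "\<exists>g\<in>polys_over \<int>. HTP_locus g = partial_zero_locus xs f"
proof -
  define F where "F = (\<lambda>v. (eval_mpoly v f)\<^sup>2 + (\<Sum>i<length xs. (v i - xs ! i)\<^sup>2))"
  have "polynomial_function F" unfolding F_def by (intro polynomial_function_intros)
  then obtain g where g: "g \<in> polys_over \<int>" "\<And>v. eval_mpoly v g = 0 \<longleftrightarrow> F v = 0"
    using integer_polynomial_for_zeros by blast
  have F0: "F v = 0 \<longleftrightarrow> eval_mpoly v f = 0 \<and> (\<forall>i<length xs. v i = xs ! i)" for v
  proof -
    have "(\<Sum>i<length xs. (v i - xs ! i)\<^sup>2) \<ge> 0" by (intro sum_nonneg) auto
    hence "F v = 0 \<longleftrightarrow> (eval_mpoly v f)\<^sup>2 = 0 \<and> (\<Sum>i<length xs. (v i - xs ! i)\<^sup>2) = 0"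
      unfolding F_def using zero_le_power2[of "eval_mpoly v f"] by linarith
    thus ?thesis by (auto simp: sum_nonneg_eq_0_iff)
  qed
  have "HTP_locus g = partial_zero_locus xs f"
    by (auto simp: HTP_locus_def HTP_def partial_zero_locus_def g(2) F0 integer_polys_over_subring[OF g(1)])
  thus ?thesis using g(1) by blast
qed

lemma HTP_locus_open:
  assumes "W \<in> HTP_locus g" "g \<in> polys_over \<int>"
  shows "\<exists>k. agreeing_below W k \<subseteq> HTP_locus g"
proof -
  have eq: "HTP_locus g = partial_zero_locus [] g"
    by (auto simp: HTP_locus_def HTP_def partial_zero_locus_def integer_polys_over_subring[OF assms(2)])
  have W: "W \<subseteq> Primes" using assms(1) by (simp add: HTP_locus_def)
  obtain k where "\<forall>V\<subseteq>Primes. (\<forall>p\<in>W. p < k \<longrightarrow> p \<in> V) \<longrightarrow> V \<in> HTP_locus g"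
    using partial_zero_locus_monotone_open[of W "[]" g] assms(1) eq by auto
  hence "agreeing_below W k \<subseteq> HTP_locus g" using W by (auto simp: agreeing_below_def)
  thus ?thesis by blast
qed

text \<open>
  A basic open set either meets the locus, which is open, or lies in the interior of its complement.
\<close>

lemma HTP_boundary_nowhere_dense:
  assumes "g \<in> polys_over \<int>"
  shows "nowhere_dense_in cantor_primes (HTP_boundary g)"
  unfolding nowhere_dense_cantor_primes
proof (intro conjI allI impI)
  show "HTP_boundary g \<subseteq> Pow Primes" by (auto simp: HTP_boundary_def)
  fix W k assume W: "W \<subseteq> Primes"
  show "\<exists>V\<in>agreeing_below W k. \<exists>j. agreeing_below V j \<inter> HTP_boundary g = {}"
  proof (cases "\<exists>V\<in>agreeing_below W k. V \<in> HTP_locus g")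
    case True
    then obtain V where V: "V \<in> agreeing_below W k" "V \<in> HTP_locus g" by blast
    obtain j where "agreeing_below V j \<subseteq> HTP_locus g" using HTP_locus_open[OF V(2) assms] by blast
    hence "agreeing_below V j \<inter> HTP_boundary g = {}" by (auto simp: HTP_boundary_def)
    thus ?thesis using V(1) by blast
  next
    case False
    have "V \<notin> HTP_boundary g" if V: "V \<in> agreeing_below W k" for V
    proof -
      have "agreeing_below V k \<subseteq> agreeing_below W k" by (rule agreeing_below_subset[OF V order_refl])
      hence "agreeing_below V k \<subseteq> Pow Primes - HTP_locus g" using False agreeing_below_subset_Primes by blast
      hence "V \<in> cantor_primes interior_of (Pow Primes - HTP_locus g)"
        unfolding interior_cantor_primes using agreeing_below_subset_Primes[OF V] by blast
      thus ?thesis by (simp add: HTP_boundary_def)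
    qed
    thus ?thesis using agreeing_below_refl[OF W] by blast
  qed
qed

lemma HTP_generic_decides:
  assumes W: "HTP_generic W" and nW: "W \<notin> partial_zero_locus xs f"
  shows "\<exists>k. agreeing_below W k \<inter> partial_zero_locus xs f = {}"
proof -
  obtain g where g: "g \<in> polys_over \<int>" "HTP_locus g = partial_zero_locus xs f"
    using partial_zero_locus_eq_HTP_locus by blast
  have "W \<notin> HTP_boundary g" "W \<subseteq> Primes" using W g(1) by (auto simp: HTP_generic_def)
  hence "W \<in> cantor_primes interior_of (Pow Primes - HTP_locus g)"
    using nW g(2) by (auto simp: HTP_boundary_def)
  thus ?thesis unfolding interior_cantor_primes g(2) by blast
qed

lemma countable_poly_mapping:
  assumes "countable (UNIV :: 'a set)" "countable (UNIV :: 'b set)"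
  shows "countable (UNIV :: ('a \<Rightarrow>\<^sub>0 'b::zero) set)"
proof -
  define G where "G = (\<lambda>f :: 'a \<Rightarrow>\<^sub>0 'b. (\<lambda>m. (m, Poly_Mapping.lookup f m)) ` Poly_Mapping.keys f)"
  have "inj G"
  proof (rule injI)
    fix f g assume e: "G f = G g"
    have *: "Poly_Mapping.lookup f' m = Poly_Mapping.lookup g' m"
      if "G f' = G g'" "m \<in> Poly_Mapping.keys f'" for f' g' m
    proof -
      have "(m, Poly_Mapping.lookup f' m) \<in> G f'" using that(2) by (simp add: G_def)
      hence "(m, Poly_Mapping.lookup f' m) \<in> G g'" using that(1) by simp
      thus ?thesis by (auto simp: G_def)
    qed
    show "f = g"
    proof (rule poly_mapping_eqI)
      fix m
      show "Poly_Mapping.lookup f m = Poly_Mapping.lookup g m"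
      proof (cases "m \<in> Poly_Mapping.keys f \<or> m \<in> Poly_Mapping.keys g")
        case True
        thus ?thesis using *[OF e, of m] *[OF e[symmetric], of m] by auto
      qed (simp add: in_keys_iff)
    qed
  qed
  moreover have "G ` UNIV \<subseteq> {A. finite A \<and> A \<subseteq> UNIV \<times> UNIV}" by (auto simp: G_def)
  moreover have "countable {A. finite A \<and> A \<subseteq> (UNIV :: 'a set) \<times> (UNIV :: 'b set)}"
    using assms by (intro countable_Collect_finite_subset countable_SIGMA) auto
  ultimately have "countable (G ` UNIV)" using countable_subset by auto
  thus ?thesis using \<open>inj G\<close> by (rule countable_image_inj_on)
qed

lemma countable_rat_mpoly: "countable (A :: rat_mpoly set)"
proof -
  have "countable (UNIV :: (nat \<Rightarrow>\<^sub>0 nat) set)" by (rule countable_poly_mapping) auto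
  hence "countable (UNIV :: rat_mpoly set)" by (rule countable_poly_mapping) auto
  thus ?thesis by (rule countable_subset[OF subset_UNIV])
qed

section \<open>Rigidity of models on a basic open set\<close>

definition model_iso :: "rat set \<Rightarrow> nat \<Rightarrow> rat_mpoly \<Rightarrow> rat_mpoly \<Rightarrow> rat_mpoly \<Rightarrow> (int \<Rightarrow> rat list) \<Rightarrow> bool" where
  "model_iso R n h hp ht \<phi> \<longleftrightarrow> bij_betw \<phi> UNIV (dioph_set R n h) \<and>
     dioph_set R (3 * n) hp = {\<phi> a @ \<phi> b @ \<phi> (a + b) | a b. True} \<and>
     dioph_set R (3 * n) ht = {\<phi> a @ \<phi> b @ \<phi> (a * b) | a b. True}"

lemma model_iso_length: "model_iso R n h hp ht \<phi> \<Longrightarrow> length (\<phi> a) = n"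
proof -
  assume "model_iso R n h hp ht \<phi>"
  hence "\<phi> a \<in> dioph_set R n h" by (auto simp: model_iso_def bij_betw_def)
  thus ?thesis by (simp add: dioph_set_def)
qed

lemma model_iso_inj: "model_iso R n h hp ht \<phi> \<Longrightarrow> \<phi> a = \<phi> b \<longleftrightarrow> a = b"
  by (auto simp: model_iso_def bij_betw_def inj_on_def)

lemma model_iso_sum:
  assumes m: "model_iso R n h hp ht \<phi>" and l: "length xs = n" "length ys = n"
    and e: "xs @ ys @ zs \<in> dioph_set R (3 * n) hp"
  obtains a b where "xs = \<phi> a" "ys = \<phi> b" "zs = \<phi> (a + b)"
proof -
  obtain a b where "xs @ ys @ zs = \<phi> a @ \<phi> b @ \<phi> (a + b)" using m e by (auto simp: model_iso_def)
  thus ?thesis using that[of a b] l model_iso_length[OF m] by simp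
qed

lemma model_iso_product:
  assumes m: "model_iso R n h hp ht \<phi>" and l: "length xs = n" "length ys = n"
    and e: "xs @ ys @ zs \<in> dioph_set R (3 * n) ht"
  obtains a b where "xs = \<phi> a" "ys = \<phi> b" "zs = \<phi> (a * b)"
proof -
  obtain a b where "xs @ ys @ zs = \<phi> a @ \<phi> b @ \<phi> (a * b)" using m e by (auto simp: model_iso_def)
  thus ?thesis using that[of a b] l model_iso_length[OF m] by simp
qed

text \<open>
  A set \<open>D\<close> that is dense in a basic open set and on which three fixed polynomials give a model. The union of two members
  of the basic open set belongs to it, and this makes the facts about members of \<open>D\<close> comparable.
\<close>

locale dense_models =
  fixes n :: nat and h hp ht :: rat_mpoly and W\<^sub>0 :: "nat set" and k\<^sub>0 :: nat and D :: "nat set set"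
  assumes models: "\<And>W. W \<in> D \<Longrightarrow> W \<in> agreeing_below W\<^sub>0 k\<^sub>0 \<and> (\<exists>\<phi>. model_iso (subring_of W) n h hp ht \<phi>)"
    and dense: "\<And>V j. V \<in> agreeing_below W\<^sub>0 k\<^sub>0 \<Longrightarrow> agreeing_below V j \<inter> D \<noteq> {}"
    and W\<^sub>0: "W\<^sub>0 \<subseteq> Primes"
begin

lemma Primes_of_D: "W \<in> D \<Longrightarrow> W \<subseteq> Primes"
  using models agreeing_below_subset_Primes by blast

text \<open>
  Both facts persist near \<open>W1 \<union> W2\<close>.
\<close>

lemma common_extension:
  assumes W: "W1 \<in> agreeing_below W\<^sub>0 k\<^sub>0" "W2 \<in> agreeing_below W\<^sub>0 k\<^sub>0"
    and x: "W1 \<in> partial_zero_locus xs f" and y: "W2 \<in> partial_zero_locus ys g"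
  obtains W3 where "W3 \<in> D" "W3 \<in> partial_zero_locus xs f" "W3 \<in> partial_zero_locus ys g"
proof -
  obtain k1 where k1: "\<And>V. V \<subseteq> Primes \<Longrightarrow> (\<forall>p\<in>W1. p < k1 \<longrightarrow> p \<in> V) \<Longrightarrow> V \<in> partial_zero_locus xs f"
    using partial_zero_locus_monotone_open[OF x] by blast
  obtain k2 where k2: "\<And>V. V \<subseteq> Primes \<Longrightarrow> (\<forall>p\<in>W2. p < k2 \<longrightarrow> p \<in> V) \<Longrightarrow> V \<in> partial_zero_locus ys g"
    using partial_zero_locus_monotone_open[OF y] by blast
  have "W1 \<union> W2 \<in> agreeing_below W\<^sub>0 k\<^sub>0" using W by (auto simp: agreeing_below_def)
  then obtain W3 where W3: "W3 \<in> D" "W3 \<in> agreeing_below (W1 \<union> W2) (max k1 k2)" using dense by blast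
  have P: "W3 \<subseteq> Primes" using Primes_of_D[OF W3(1)] .
  have "p \<in> W3" if "p \<in> W1 \<union> W2" "p < max k1 k2" for p
    using W3(2) that agreeing_below_subset_Primes[OF W(1)] agreeing_below_subset_Primes[OF W(2)]
    by (auto simp: agreeing_below_def)
  hence "W3 \<in> partial_zero_locus xs f" "W3 \<in> partial_zero_locus ys g"
    by (auto intro!: k1 k2 P)
  thus ?thesis using that W3(1) by blast
qed

lemma common_extension_dioph_sets:
  assumes "W1 \<in> D" "W2 \<in> D" "xs \<in> dioph_set (subring_of W1) k f" "ys \<in> dioph_set (subring_of W2) l g"
  obtains W3 \<psi> where "W3 \<in> D" "model_iso (subring_of W3) n h hp ht \<psi>"
    "xs \<in> dioph_set (subring_of W3) k f" "ys \<in> dioph_set (subring_of W3) l g"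
proof -
  have x: "length xs = k" "W1 \<in> partial_zero_locus xs f" and y: "length ys = l" "W2 \<in> partial_zero_locus ys g"
    using assms dioph_set_iff_locus Primes_of_D by blast+
  obtain W3 where W3: "W3 \<in> D" "W3 \<in> partial_zero_locus xs f" "W3 \<in> partial_zero_locus ys g"
    using common_extension[OF _ _ x(2) y(2)] models assms(1,2) by blast
  obtain \<psi> where "model_iso (subring_of W3) n h hp ht \<psi>" using models W3(1) by blast
  moreover have "xs \<in> dioph_set (subring_of W3) k f" "ys \<in> dioph_set (subring_of W3) l g"
    using W3 x(1) y(1) dioph_set_iff_locus[OF Primes_of_D[OF W3(1)]] by blast+
  ultimately show ?thesis using that W3(1) by blast
qed

lemma sum_in_dioph_set:
  assumes "model_iso R n h hp ht \<phi>"
  shows "\<phi> a @ \<phi> b @ \<phi> (a + b) \<in> dioph_set R (3 * n) hp" "\<phi> a @ \<phi> b @ \<phi> (a * b) \<in> dioph_set R (3 * n) ht"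
  using assms by (auto simp: model_iso_def)

lemma iso_zero_unique:
  assumes W: "W1 \<in> D" "W2 \<in> D"
    and i: "model_iso (subring_of W1) n h hp ht \<phi>1" "model_iso (subring_of W2) n h hp ht \<phi>2"
  shows "\<phi>1 0 = \<phi>2 0"
proof -
  obtain W3 \<psi> where W3: "model_iso (subring_of W3) n h hp ht \<psi>"
      "\<phi>1 0 @ \<phi>1 0 @ \<phi>1 (0 + 0) \<in> dioph_set (subring_of W3) (3 * n) hp"
      "\<phi>2 0 @ \<phi>2 0 @ \<phi>2 (0 + 0) \<in> dioph_set (subring_of W3) (3 * n) hp"
    using common_extension_dioph_sets[OF W sum_in_dioph_set(1)[OF i(1), of 0 0] sum_in_dioph_set(1)[OF i(2), of 0 0]]
    by blast
  have "\<phi> 0 = \<psi> 0" if len: "length (\<phi> 0) = n" and e: "\<phi> 0 @ \<phi> 0 @ \<phi> (0 + 0) \<in> dioph_set (subring_of W3) (3 * n) hp"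
    for \<phi> :: "int \<Rightarrow> rat list"
  proof -
    obtain a b where "\<phi> 0 = \<psi> a" "\<phi> 0 = \<psi> b" "\<phi> (0 + 0) = \<psi> (a + b)"
      by (rule model_iso_sum[OF W3(1) len len e])
    hence "\<psi> a = \<psi> b" "\<psi> a = \<psi> (a + b)" by simp_all
    hence "a = b" "a = a + b" by (simp_all only: model_iso_inj[OF W3(1)])
    thus ?thesis using \<open>\<phi> 0 = \<psi> a\<close> by simp
  qed
  from this[OF model_iso_length[OF i(1)] W3(2)] this[OF model_iso_length[OF i(2)] W3(3)] show ?thesis by simp
qed

text \<open>
  The value at \<open>1\<close> is idempotent and, by the previous lemma, different from the value at \<open>0\<close>.
\<close>

lemma iso_one_unique:
  assumes W: "W1 \<in> D" "W2 \<in> D"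
    and i: "model_iso (subring_of W1) n h hp ht \<phi>1" "model_iso (subring_of W2) n h hp ht \<phi>2"
  shows "\<phi>1 1 = \<phi>2 1"
proof -
  obtain W3 \<psi> where W3: "W3 \<in> D" "model_iso (subring_of W3) n h hp ht \<psi>"
      "\<phi>1 1 @ \<phi>1 1 @ \<phi>1 (1 * 1) \<in> dioph_set (subring_of W3) (3 * n) ht"
      "\<phi>2 1 @ \<phi>2 1 @ \<phi>2 (1 * 1) \<in> dioph_set (subring_of W3) (3 * n) ht"
    using common_extension_dioph_sets[OF W sum_in_dioph_set(2)[OF i(1), of 1 1] sum_in_dioph_set(2)[OF i(2), of 1 1]]
    by blast
  have "\<phi> 1 = \<psi> 1" if len: "length (\<phi> 1) = n" and e: "\<phi> 1 @ \<phi> 1 @ \<phi> (1 * 1) \<in> dioph_set (subring_of W3) (3 * n) ht"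
    and nz: "\<phi> 1 \<noteq> \<psi> 0" for \<phi> :: "int \<Rightarrow> rat list"
  proof -
    obtain a b where "\<phi> 1 = \<psi> a" "\<phi> 1 = \<psi> b" "\<phi> (1 * 1) = \<psi> (a * b)"
      by (rule model_iso_product[OF W3(2) len len e])
    hence "\<psi> a = \<psi> b" "\<psi> a = \<psi> (a * b)" "\<phi> 1 = \<psi> a" by simp_all
    hence "a = b" "a = a * b" "a \<noteq> 0" using nz by (auto simp: model_iso_inj[OF W3(2)])
    hence "a = 1" by simp
    thus ?thesis using \<open>\<phi> 1 = \<psi> a\<close> by simp
  qed
  note one = this
  have "\<phi>1 1 \<noteq> \<psi> 0" "\<phi>2 1 \<noteq> \<psi> 0"
    using iso_zero_unique[OF W(1) W3(1) i(1) W3(2)] iso_zero_unique[OF W(2) W3(1) i(2) W3(2)]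
      model_iso_inj[OF i(1), of 1 0] model_iso_inj[OF i(2), of 1 0] by auto
  thus ?thesis using one[OF model_iso_length[OF i(1)] W3(3)] one[OF model_iso_length[OF i(2)] W3(4)] by simp
qed

lemma iso_unique:
  assumes W: "W1 \<in> D" "W2 \<in> D"
    and i: "model_iso (subring_of W1) n h hp ht \<phi>1" "model_iso (subring_of W2) n h hp ht \<phi>2"
  shows "\<phi>1 = \<phi>2"
proof
  fix a
  have succ: "\<phi>1 a = \<phi>2 a \<longleftrightarrow> \<phi>1 (a + 1) = \<phi>2 (a + 1)" for a
  proof -
    obtain W3 \<psi> where W3: "model_iso (subring_of W3) n h hp ht \<psi>"
        "\<phi>1 a @ \<phi>1 1 @ \<phi>1 (a + 1) \<in> dioph_set (subring_of W3) (3 * n) hp"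
        "\<phi>2 a @ \<phi>2 1 @ \<phi>2 (a + 1) \<in> dioph_set (subring_of W3) (3 * n) hp"
      using common_extension_dioph_sets[OF W sum_in_dioph_set(1)[OF i(1), of a 1] sum_in_dioph_set(1)[OF i(2), of a 1]]
      by blast
    obtain b c where 1: "\<phi>1 a = \<psi> b" "\<phi>1 1 = \<psi> c" "\<phi>1 (a + 1) = \<psi> (b + c)"
      by (rule model_iso_sum[OF W3(1) model_iso_length[OF i(1)] model_iso_length[OF i(1)] W3(2)])
    obtain d e where 2: "\<phi>2 a = \<psi> d" "\<phi>2 1 = \<psi> e" "\<phi>2 (a + 1) = \<psi> (d + e)"
      by (rule model_iso_sum[OF W3(1) model_iso_length[OF i(2)] model_iso_length[OF i(2)] W3(3)])
    have "c = e" using 1(2) 2(2) iso_one_unique[OF W i] model_iso_inj[OF W3(1)] by simp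
    thus ?thesis using 1 2 by (simp add: model_iso_inj[OF W3(1)])
  qed
  show "\<phi>1 a = \<phi>2 a"
  proof (induction a rule: int_induct[where k = 0])
    case base
    show ?case by (rule iso_zero_unique[OF W i])
  next
    case (step1 a)
    thus ?case using succ[of a] by simp
  next
    case (step2 a)
    thus ?case using succ[of "a - 1"] by simp
  qed
qed

lemma dioph_sets_constant:
  assumes W: "W1 \<in> D" "W2 \<in> D"
  shows "dioph_set (subring_of W1) n h = dioph_set (subring_of W2) n h"
    "dioph_set (subring_of W1) (3 * n) hp = dioph_set (subring_of W2) (3 * n) hp"
    "dioph_set (subring_of W1) (3 * n) ht = dioph_set (subring_of W2) (3 * n) ht"
proof -
  obtain \<phi> where 1: "model_iso (subring_of W1) n h hp ht \<phi>" using models W(1) by blast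
  obtain \<phi>' where 2: "model_iso (subring_of W2) n h hp ht \<phi>'" using models W(2) by blast
  have "\<phi> = \<phi>'" by (rule iso_unique[OF W 1 2])
  hence 2: "model_iso (subring_of W2) n h hp ht \<phi>" using 2 by simp
  show "dioph_set (subring_of W1) n h = dioph_set (subring_of W2) n h"
    "dioph_set (subring_of W1) (3 * n) hp = dioph_set (subring_of W2) (3 * n) hp"
    "dioph_set (subring_of W1) (3 * n) ht = dioph_set (subring_of W2) (3 * n) ht"
    using 1 2 by (auto simp: model_iso_def bij_betw_def)
qed

text \<open>
  Members of the set at \<open>X\<close> are members at some element of \<open>D\<close> by openness. The assumption \<open>sep\<close> gives the converse; it holds when
  \<open>X\<close> decides every locus on a neighbourhood, or when \<open>X\<close> contains every element of \<open>D\<close>.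
\<close>

lemma dioph_set_transfer:
  assumes X: "X \<in> agreeing_below W\<^sub>0 k\<^sub>0"
    and const: "\<And>W. W \<in> D \<Longrightarrow> dioph_set (subring_of W) k f = S"
    and sep: "\<And>xs. X \<notin> partial_zero_locus xs f \<Longrightarrow> \<exists>W\<in>D. W \<notin> partial_zero_locus xs f"
  shows "dioph_set (subring_of X) k f = S"
proof (intro equalityI subsetI)
  have XP: "X \<subseteq> Primes" by (rule agreeing_below_subset_Primes[OF X])
  {
    fix xs assume "xs \<in> dioph_set (subring_of X) k f"
    hence xs: "length xs = k" "X \<in> partial_zero_locus xs f" using dioph_set_iff_locus[OF XP] by auto
    obtain W where W: "W \<in> D" "W \<in> partial_zero_locus xs f"
      by (rule common_extension[OF X X xs(2) xs(2)])
    show "xs \<in> S" using W xs(1) dioph_set_iff_locus[OF Primes_of_D[OF W(1)]] const[OF W(1)] by blast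
  }
  {
    fix xs assume xs: "xs \<in> S"
    have "length xs = k \<and> W \<in> partial_zero_locus xs f" if "W \<in> D" for W
      using xs const[OF that] dioph_set_iff_locus[OF Primes_of_D[OF that]] by blast
    moreover obtain W where "W \<in> D" using dense[OF X] by blast
    ultimately have "length xs = k" "X \<in> partial_zero_locus xs f" using sep by blast+
    thus "xs \<in> dioph_set (subring_of X) k f" using dioph_set_iff_locus[OF XP] by blast
  }
qed

lemma model_iso_transfer:
  assumes X: "X \<in> agreeing_below W\<^sub>0 k\<^sub>0"
    and sep: "\<And>xs f. X \<notin> partial_zero_locus xs f \<Longrightarrow> \<exists>W\<in>D. W \<notin> partial_zero_locus xs f"
  shows "\<exists>\<phi>. model_iso (subring_of X) n h hp ht \<phi>"
proof -
  obtain W where W: "W \<in> D" using dense[OF X] by blast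
  obtain \<phi> where \<phi>: "model_iso (subring_of W) n h hp ht \<phi>" using models[OF W] by blast
  have "dioph_set (subring_of X) n h = dioph_set (subring_of W) n h"
    by (rule dioph_set_transfer[OF X dioph_sets_constant(1)[OF _ W] sep])
  moreover have "dioph_set (subring_of X) (3 * n) hp = dioph_set (subring_of W) (3 * n) hp"
    by (rule dioph_set_transfer[OF X dioph_sets_constant(2)[OF _ W] sep])
  moreover have "dioph_set (subring_of X) (3 * n) ht = dioph_set (subring_of W) (3 * n) ht"
    by (rule dioph_set_transfer[OF X dioph_sets_constant(3)[OF _ W] sep])
  ultimately have "model_iso (subring_of X) n h hp ht \<phi>" using \<phi> by (simp add: model_iso_def)
  thus ?thesis by blast
qed

lemma model_iso_generic:
  assumes X: "X \<in> agreeing_below W\<^sub>0 k\<^sub>0" and g: "HTP_generic X"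
  shows "\<exists>\<phi>. model_iso (subring_of X) n h hp ht \<phi>"
proof (rule model_iso_transfer[OF X])
  fix xs f assume "X \<notin> partial_zero_locus xs f"
  then obtain k where k: "agreeing_below X k \<inter> partial_zero_locus xs f = {}"
    using HTP_generic_decides[OF g] by blast
  obtain W where "W \<in> agreeing_below X k \<inter> D" using dense[OF X] by blast
  thus "\<exists>W\<in>D. W \<notin> partial_zero_locus xs f" using k by blast
qed

text \<open>
  The largest element of the basic open set contains all of \<open>D\<close>, so it lies in every locus that an element of \<open>D\<close> lies in.
\<close>

lemma model_iso_top: "\<exists>\<phi>. model_iso (subring_of {p \<in> Primes. p < k\<^sub>0 \<longrightarrow> p \<in> W\<^sub>0}) n h hp ht \<phi>"
proof (rule model_iso_transfer)
  let ?T = "{p \<in> Primes. p < k\<^sub>0 \<longrightarrow> p \<in> W\<^sub>0}"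
  show T: "?T \<in> agreeing_below W\<^sub>0 k\<^sub>0" by (auto simp: agreeing_below_def)
  fix xs f assume nT: "?T \<notin> partial_zero_locus xs f"
  obtain W where W: "W \<in> D" using dense[OF T] by blast
  have sub: "W \<subseteq> ?T" using models[OF W] by (auto simp: agreeing_below_def)
  have "W \<notin> partial_zero_locus xs f"
  proof
    assume "W \<in> partial_zero_locus xs f"
    from partial_zero_locus_monotone_open[OF this] obtain k where
      k: "\<And>V. V \<subseteq> Primes \<Longrightarrow> (\<forall>p\<in>W. p < k \<longrightarrow> p \<in> V) \<Longrightarrow> V \<in> partial_zero_locus xs f" by auto
    have "?T \<in> partial_zero_locus xs f"
    proof (rule k)
      show "\<forall>p\<in>W. p < k \<longrightarrow> p \<in> ?T" using subsetD[OF sub] by (intro ballI impI)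
    qed (rule agreeing_below_subset_Primes[OF T])
    thus False using nT by contradiction
  qed
  thus "\<exists>W\<in>D. W \<notin> partial_zero_locus xs f" using W by blast
qed

end

section \<open>The dichotomy\<close>

lemma dioph_model_via_iff:
  "dioph_model_via R n h hp ht \<longleftrightarrow> h \<in> polys_over R \<and> hp \<in> polys_over R \<and> ht \<in> polys_over R \<and>
     (\<exists>\<phi>. model_iso R n h hp ht \<phi>)"
  by (simp add: dioph_model_via_def model_iso_def)

lemma basic_open_agreeing_below:
  assumes "\<sigma> \<in> prime_strings"
  obtains W k where "W \<subseteq> Primes" "basic_open \<sigma> = agreeing_below W k"
proof -
  obtain k where k: "dom \<sigma> = {p. prime p \<and> p < k}" using assms by (auto simp: prime_strings_def)
  define W where "W = {p \<in> Primes. \<sigma> p = Some True}"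
  have "\<sigma> p = Some (p \<in> V) \<longleftrightarrow> (p \<in> V \<longleftrightarrow> p \<in> W)" if p: "prime p" "p < k" for p V
  proof -
    have "p \<in> dom \<sigma>" using p k by simp
    then obtain b where "\<sigma> p = Some b" by blast
    thus ?thesis using p by (auto simp: W_def)
  qed
  hence "basic_open \<sigma> = agreeing_below W k"
    unfolding basic_open_def agreeing_below_def k by auto
  moreover have "W \<subseteq> Primes" by (auto simp: W_def)
  ultimately show ?thesis using that by blast
qed

lemma agreeing_below_basic_open:
  assumes "W \<subseteq> Primes"
  obtains \<sigma> where "\<sigma> \<in> prime_strings" "basic_open \<sigma> = agreeing_below W k"
proof -
  define \<sigma> where "\<sigma> = (\<lambda>p. if prime p \<and> p < k then Some (p \<in> W) else None)"
  have d: "dom \<sigma> = {p. prime p \<and> p < k}" by (auto simp: \<sigma>_def split: if_splits)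
  hence "\<sigma> \<in> prime_strings" by (auto simp: prime_strings_def)
  moreover have "basic_open \<sigma> = agreeing_below W k"
    unfolding basic_open_def agreeing_below_def d by (auto simp: \<sigma>_def)
  ultimately show ?thesis using that by blast
qed

lemma boundaries_countable: "countable (HTP_boundary ` polys_over \<int>)"
  by (intro countable_image countable_rat_mpoly)

lemma HTP_generic_iff: "HTP_generic W \<longleftrightarrow> W \<subseteq> Primes \<and> W \<notin> \<Union>(HTP_boundary ` polys_over \<int>)"
  by (auto simp: HTP_generic_def)

text \<open>
  The polynomials of a model have coefficients in the ring at hand. Clearing denominators changes neither the zeros
  nor, therefore, the model, and makes one triple serve all rings.
\<close>

lemma integer_polynomial_same_dioph_sets:
  "\<exists>f'\<in>polys_over \<int>. \<forall>R k. dioph_set R k f' = dioph_set R k f"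
proof -
  obtain f' c where *: "f' \<in> polys_over \<int>" "c \<noteq> 0" "\<And>v. eval_mpoly v f' = c * eval_mpoly v f"
    using integer_multiple_of_mpoly[of f] by blast
  have "\<forall>R k. dioph_set R k f' = dioph_set R k f" using *(2,3) by (simp add: dioph_set_def)
  thus ?thesis using *(1) by (rule bexI)
qed

lemma generic_uniform_model_if_not_meager:
  assumes nm: "\<not> meager_in cantor_primes dioph_model_class"
  shows generic_uniform_model
proof -
  define E where "E = (\<lambda>(n, h, hp, ht). {W. W \<subseteq> Primes \<and> dioph_model_via (subring_of W) n h hp ht})"
  have "dioph_model_class = \<Union>(range E)"
    by (auto simp: dioph_model_class_def admits_dioph_model_def E_def)
  moreover have "countable (range E)"
  proof -
    have "countable (UNIV :: (nat \<times> rat_mpoly \<times> rat_mpoly \<times> rat_mpoly) set)"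
      unfolding UNIV_Times_UNIV[symmetric] by (intro countable_SIGMA countable_rat_mpoly) auto
    thus ?thesis by (rule countable_image)
  qed
  ultimately obtain q where q: "\<not> nowhere_dense_in cantor_primes (E q)"
    using nm unfolding meager_in_def by blast
  obtain n h hp ht where qe: "q = (n, h, hp, ht)" by (cases q)
  have "E q \<subseteq> Pow Primes" by (auto simp: E_def qe)
  with q have "\<not> (\<forall>W k. W \<subseteq> Primes \<longrightarrow> (\<exists>V\<in>agreeing_below W k. \<exists>j. agreeing_below V j \<inter> E q = {}))"
    by (simp only: nowhere_dense_cantor_primes simp_thms)
  then obtain W k where W: "W \<subseteq> Primes"
      and nd: "\<not> (\<exists>V\<in>agreeing_below W k. \<exists>j. agreeing_below V j \<inter> E q = {})"
    by (simp only: not_all not_imp) (elim exE conjE, rule)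
  have dense: "agreeing_below V j \<inter> E q \<noteq> {}" if "V \<in> agreeing_below W k" for V j
    using nd that by auto
  obtain h' where h': "h' \<in> polys_over \<int>" "\<forall>R k. dioph_set R k h' = dioph_set R k h"
    using integer_polynomial_same_dioph_sets[of h] by auto
  obtain hp' where hp': "hp' \<in> polys_over \<int>" "\<forall>R k. dioph_set R k hp' = dioph_set R k hp"
    using integer_polynomial_same_dioph_sets[of hp] by auto
  obtain ht' where ht': "ht' \<in> polys_over \<int>" "\<forall>R k. dioph_set R k ht' = dioph_set R k ht"
    using integer_polynomial_same_dioph_sets[of ht] by auto
  interpret dense_models n h' hp' ht' W k "E q \<inter> agreeing_below W k"
  proof
    show "V \<in> agreeing_below W k \<and> (\<exists>\<phi>. model_iso (subring_of V) n h' hp' ht' \<phi>)"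
      if "V \<in> E q \<inter> agreeing_below W k" for V
      using that by (auto simp: E_def qe dioph_model_via_iff model_iso_def h' hp' ht')
    show "agreeing_below V j \<inter> (E q \<inter> agreeing_below W k) \<noteq> {}" if V: "V \<in> agreeing_below W k" for V j
    proof -
      obtain U where U: "U \<in> agreeing_below V (max j k) \<inter> E q" using dense[OF V] by blast
      have "agreeing_below V (max j k) \<subseteq> agreeing_below W k" by (rule agreeing_below_subset[OF V]) simp
      moreover have "agreeing_below V (max j k) \<subseteq> agreeing_below V j"
        by (rule agreeing_below_subset[OF agreeing_below_refl[OF agreeing_below_subset_Primes[OF V]]]) simp
      ultimately show ?thesis using U by blast
    qed
    show "W \<subseteq> Primes" by (rule W)
  qed
  obtain \<sigma> where \<sigma>: "\<sigma> \<in> prime_strings" "basic_open \<sigma> = agreeing_below W k"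
    by (rule agreeing_below_basic_open[OF W])
  have "dioph_model_via (subring_of V) n h' hp' ht'" if "V \<in> basic_open \<sigma>" "HTP_generic V" for V
    unfolding dioph_model_via_iff using that \<sigma>(2) model_iso_generic[of V] h'(1) hp'(1) ht'(1)
    by (simp add: integer_polys_over_subring)
  thus ?thesis unfolding generic_uniform_model_def using h'(1) hp'(1) ht'(1) \<sigma>(1) by blast
qed

lemma not_meager_if_generic_uniform_model:
  assumes generic_uniform_model
  shows "\<not> meager_in cantor_primes dioph_model_class"
proof
  assume "meager_in cantor_primes dioph_model_class"
  then obtain \<F> where F: "countable \<F>" "\<forall>T\<in>\<F>. nowhere_dense_in cantor_primes T"
      "dioph_model_class = \<Union>\<F>" unfolding meager_in_def by auto
  obtain n h hp ht \<sigma> where \<sigma>: "\<sigma> \<in> prime_strings"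
      and m: "\<forall>V\<in>basic_open \<sigma>. HTP_generic V \<longrightarrow> dioph_model_via (subring_of V) n h hp ht"
    using assms unfolding generic_uniform_model_def by blast
  obtain W k where W: "W \<subseteq> Primes" "basic_open \<sigma> = agreeing_below W k"
    by (rule basic_open_agreeing_below[OF \<sigma>])
  have c: "countable (\<F> \<union> HTP_boundary ` polys_over \<int>)" using F(1) boundaries_countable by simp
  obtain V where V: "V \<in> agreeing_below W k" "V \<notin> \<Union>(\<F> \<union> HTP_boundary ` polys_over \<int>)"
  proof (rule baire_cantor_primes[OF c _ W(1)])
    show "nowhere_dense_in cantor_primes T" if "T \<in> \<F> \<union> HTP_boundary ` polys_over \<int>" for T
      using that F(2) HTP_boundary_nowhere_dense by auto
  qed
  have VP: "V \<subseteq> Primes" by (rule agreeing_below_subset_Primes[OF V(1)])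
  hence "HTP_generic V" using V(2) unfolding HTP_generic_iff by blast
  hence "V \<in> dioph_model_class"
    using bspec[OF m, of V] V(1) W(2) VP by (auto simp: dioph_model_class_def admits_dioph_model_def)
  thus False using V(2) F(3) by blast
qed

lemma model_over_Q_if_generic_uniform_model:
  assumes generic_uniform_model
  shows "Primes \<in> dioph_model_class"
proof -
  obtain n h hp ht \<sigma> where \<sigma>: "\<sigma> \<in> prime_strings" and int: "h \<in> polys_over \<int>" "hp \<in> polys_over \<int>" "ht \<in> polys_over \<int>"
      and m: "\<forall>V\<in>basic_open \<sigma>. HTP_generic V \<longrightarrow> dioph_model_via (subring_of V) n h hp ht"
    using assms unfolding generic_uniform_model_def by blast
  obtain W k where W: "W \<subseteq> Primes" "basic_open \<sigma> = agreeing_below W k"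
    by (rule basic_open_agreeing_below[OF \<sigma>])
  interpret dense_models n h hp ht W k "{V \<in> agreeing_below W k. HTP_generic V}"
  proof
    show "V \<in> agreeing_below W k \<and> (\<exists>\<phi>. model_iso (subring_of V) n h hp ht \<phi>)"
      if "V \<in> {V \<in> agreeing_below W k. HTP_generic V}" for V
      using that bspec[OF m, of V] W(2) by (simp add: dioph_model_via_iff)
    show "agreeing_below V j \<inter> {V \<in> agreeing_below W k. HTP_generic V} \<noteq> {}"
      if V: "V \<in> agreeing_below W k" for V j
    proof -
      have VP: "V \<subseteq> Primes" by (rule agreeing_below_subset_Primes[OF V])
      obtain U where U: "U \<in> agreeing_below V (max j k)" "U \<notin> \<Union>(HTP_boundary ` polys_over \<int>)"
      proof (rule baire_cantor_primes[OF boundaries_countable _ VP])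
        show "nowhere_dense_in cantor_primes T" if "T \<in> HTP_boundary ` polys_over \<int>" for T
          using that HTP_boundary_nowhere_dense by auto
      qed
      have "agreeing_below V (max j k) \<subseteq> agreeing_below W k" by (rule agreeing_below_subset[OF V]) simp
      moreover have "agreeing_below V (max j k) \<subseteq> agreeing_below V j"
        by (rule agreeing_below_subset[OF agreeing_below_refl[OF VP]]) simp
      moreover have "HTP_generic U"
        unfolding HTP_generic_iff using U agreeing_below_subset_Primes[OF U(1)] by blast
      ultimately show ?thesis using U(1) by blast
    qed
    show "W \<subseteq> Primes" by (rule W(1))
  qed
  let ?T = "{p \<in> Primes. p < k \<longrightarrow> p \<in> W}"
  have "dioph_model_via (subring_of ?T) n h hp ht"
    unfolding dioph_model_via_iff using model_iso_top int by (simp add: integer_polys_over_subring)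
  moreover have "diophantine_in_Q (subring_of ?T)"
  proof (rule diophantine_cofinite_subring)
    have "Primes - ?T \<subseteq> {..<k}" by auto
    thus "finite (Primes - ?T)" by (rule finite_subset) simp
  qed auto
  moreover have "0 \<in> subring_of ?T" using subring_of.of_int[of 0 ?T] by simp
  ultimately have "admits_dioph_model UNIV" by (intro dioph_model_over_Q)
  thus ?thesis by (simp add: dioph_model_class_def subring_of_Primes)
qed

theorem theorem5p3:
  shows "(meager_in cantor_primes dioph_model_class \<or> generic_uniform_model) \<and>
         \<not> (meager_in cantor_primes dioph_model_class \<and> generic_uniform_model) \<and>
         (generic_uniform_model \<longrightarrow> Primes \<in> dioph_model_class)"
  using generic_uniform_model_if_not_meager not_meager_if_generic_uniform_model
    model_over_Q_if_generic_uniform_model by blast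

end
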